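(* Let $G=(V,E)$ be the $1$-skeleton of the Archimedean solid $(4,6,10)$ (the truncated icosidodecahedron), let $\Gamma=\mathrm{Aut}(G)$, and let $\varphi=\frac{1+\sqrt5}{2}$. The simplex of $\Gamma$-invariant transition probabilities is $$\Delta=\Delta_\Gamma=\{(x,y,z)\mid x,y,z\ge0,\ x+y+z=1\},$$ where $x,y,z$ are the transition probabilities for the edge-equivalence classes separating $4$- and $6$-gons, $4$- and $10$-gons, and $6$- and $10$-gons, respectively. Then the restriction of $\lambda_1:\Pi_G\to[-1,1]$ to $\mathrm{int}(\Delta)\subset\Pi_G$ is analytic and strictly convex, and $\lambda_1(X)$ has multiplicity three for all $X\in\mathrm{int}(\Delta)$. Moreover, $$X_0=\frac{1}{14+5\varphi}(5,\,3+3\varphi,\,6+2\varphi)$$ is the unique point in $\Delta$ at which $\lambda_1$ assumes its global minimum, with $$\lambda_1(X_0)=\frac{10+7\varphi}{14+5\varphi}.$$ The spectral representation $\Phi_{X_0}:V\to S^2$ of $P_{X_0}$ for the eigenvalue $\lambda_1(X_0)$ (taking values in a $2$-sphere centred at the origin of $\mathbb{R}^3$) is faithful and equilateral.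
   Context: The Archimedean solid with vertex configuration $(4,6,10)$ has $120$ vertices, each of degree three, at each of which a $4$-gon, a $6$-gon and a $10$-gon meet; combinatorially its $1$-skeleton $G$ is the Cayley graph of the Coxeter group $H_3$ with respect to its standard generators, and $\mathrm{Aut}(G)\cong H_3$ acts simply transitively on $V$. $\Pi_G$ is the set of symmetric stochastic matrices $P=(p_{ij})_{i,j\in V}$ with $p_{ij}=0$ whenever $i\ne j$ and $\{i,j\}\notin E$. The eigenvalues of $P\in\Pi_G$ with multiplicity are $1=\lambda_0(P)\ge\lambda_1(P)\ge\dots\ge-1$. A point $X=(x,y,z)\in\Delta$ is identified with the matrix $P_X\in\Pi_G$ with zero diagonal whose entry $p_{ij}$ for an edge $\{i,j\}$ is $x$, $y$ or $z$ according to the $\Gamma$-equivalence class of the edge (edge between a $4$-gon and a $6$-gon, a $4$-gon and a $10$-gon, a $6$-gon and a $10$-gon, respectively), and $\lambda_1(X):=\lambda_1(P_X)$. $\mathrm{int}(\Delta)$ is the subset of $\Delta$ where $x,y,z>0$. If $\lambda$ is an eigenvalue of $P$ of multiplicity $k$ and $\phi_1,\dots,\phi_k$ is an orthonormal basis of its eigenspace (for $\langle f,g\rangle=\sum_{i\in V}f(i)g(i)$), the spectral representation is $\Phi:V\to\mathbb{R}^k$, $\Phi(i)=(\phi_1(i),\dots,\phi_k(i))$, defined up to an orthogonal transformation of $\mathbb{R}^k$. It is faithful if injective, and equilateral if $\|\Phi(i)-\Phi(j)\|$ is the same for all edges $\{i,j\}\in E$. *)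

theory Defs
  imports "HOL-Analysis.Analysis" "HOL-Library.Multiset"
begin

section \<open>The truncated icosidodecahedron and its 1-skeleton\<close>

definition golden_ratio :: real where
  "golden_ratio = (1 + sqrt 5) / 2"

text \<open>All points obtained from \<open>(a, b, c)\<close> by sign changes and even (i.e. cyclic) permutations
  of the coordinates.\<close>

definition signed_cyclic :: "real \<Rightarrow> real \<Rightarrow> real \<Rightarrow> (real^3) set" where
  "signed_cyclic a b c =
     (\<Union>a'\<in>{a, -a}. \<Union>b'\<in>{b, -b}. \<Union>c'\<in>{c, -c}.
        {vector [a', b', c'], vector [b', c', a'], vector [c', a', b']})"

text \<open>The standard coordinates of the truncated icosidodecahedron with edge length
  \<open>2 / golden_ratio\<close>, centred at the origin.  The 120 points lie on a common sphere; the facets of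
  their convex hull are 30 squares, 20 regular hexagons and 12 regular decagons.\<close>

definition solid_points :: "(real^3) set" where
  "solid_points = (let p = golden_ratio in
       signed_cyclic (1 / p) (1 / p) (3 + p)
     \<union> signed_cyclic (2 / p) p (1 + 2 * p)
     \<union> signed_cyclic (1 / p) (p\<^sup>2) (3 * p - 1)
     \<union> signed_cyclic (2 * p - 1) 2 (2 + p)
     \<union> signed_cyclic p 3 (2 * p))"

definition solid :: "(real^3) set" where
  "solid = convex hull solid_points"

lemma finite_solid_points: "finite solid_points"
  by (simp add: solid_points_def signed_cyclic_def Let_def)

lemma solid_points_nonempty: "solid_points \<noteq> {}"
  by (simp add: solid_points_def signed_cyclic_def Let_def)

lemma finite_extreme_points_solid: "finite {v. v extreme_point_of solid}"
  by (rule finite_subset[OF _ finite_solid_points])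
     (auto simp: solid_def dest: extreme_point_of_convex_hull)

typedef vertex = "{v :: real^3. v extreme_point_of solid}"
  morphisms pos Abs_vertex
proof -
  have "compact solid" "convex solid" "solid \<noteq> {}"
    by (simp_all add: solid_def finite_imp_compact_convex_hull finite_solid_points
        solid_points_nonempty)
  then show ?thesis
    using extreme_point_exists_convex by blast
qed

instance vertex :: finite
proof
  have "(UNIV :: vertex set) = Abs_vertex ` {v. v extreme_point_of solid}"
    by (metis type_definition.Abs_image type_definition_vertex)
  then show "finite (UNIV :: vertex set)"
    by (metis finite_extreme_points_solid finite_imageI)
qed

definition skeleton_edges :: "vertex set set" where
  "skeleton_edges = {{i, j} | i j. closed_segment (pos i) (pos j) edge_of solid}"

definition ngon_facet :: "nat \<Rightarrow> (real^3) set \<Rightarrow> bool" where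
  "ngon_facet n F \<longleftrightarrow> F facet_of solid \<and> card {v. v extreme_point_of F} = n"

text \<open>For an edge \<open>{i, j}\<close>: it lies between an \<open>m\<close>-gon and an \<open>n\<close>-gon
  (used only with \<open>m \<noteq> n\<close>).\<close>

definition separates :: "nat \<Rightarrow> nat \<Rightarrow> vertex \<Rightarrow> vertex \<Rightarrow> bool" where
  "separates m n i j \<longleftrightarrow>
     (\<exists>F F'. ngon_facet m F \<and> ngon_facet n F' \<and> closed_segment (pos i) (pos j) \<subseteq> F \<inter> F')"


section \<open>Transition matrices on a graph\<close>

definition graph_aut :: "'v set set \<Rightarrow> ('v \<Rightarrow> 'v) set" where
  "graph_aut E = {\<sigma>. bij \<sigma> \<and> (\<forall>i j. {\<sigma> i, \<sigma> j} \<in> E \<longleftrightarrow> {i, j} \<in> E)}"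

definition sym_stochastic :: "'v::finite set set \<Rightarrow> (real^'v^'v) set" where
  "sym_stochastic E =
     {P. (\<forall>i j. P $ i $ j = P $ j $ i) \<and> (\<forall>i j. 0 \<le> P $ i $ j) \<and> (\<forall>i. (\<Sum>j\<in>UNIV. P $ i $ j) = 1) \<and>
         (\<forall>i j. i \<noteq> j \<longrightarrow> {i, j} \<notin> E \<longrightarrow> P $ i $ j = 0)}"

text \<open>The invariant transition probabilities have vanishing diagonal: loops \<open>{i}\<close> are not edges.\<close>

definition invariant_transitions :: "'v::finite set set \<Rightarrow> (real^'v^'v) set" where
  "invariant_transitions E =
     {P \<in> sym_stochastic E. (\<forall>i. P $ i $ i = 0) \<and>
        (\<forall>\<sigma>\<in>graph_aut E. \<forall>i j. P $ \<sigma> i $ \<sigma> j = P $ i $ j)}"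

definition prob_simplex :: "(real \<times> real \<times> real) set" where
  "prob_simplex = {(x, y, z). 0 \<le> x \<and> 0 \<le> y \<and> 0 \<le> z \<and> x + y + z = 1}"

definition int_prob_simplex :: "(real \<times> real \<times> real) set" where
  "int_prob_simplex = {(x, y, z) \<in> prob_simplex. 0 < x \<and> 0 < y \<and> 0 < z}"

fun transition_matrix :: "real \<times> real \<times> real \<Rightarrow> real^vertex^vertex" where
  "transition_matrix (x, y, z) =
     (\<chi> i j. if {i, j} \<notin> skeleton_edges then 0
            else if separates 4 6 i j then x
            else if separates 4 10 i j then y
            else if separates 6 10 i j then z
            else 0)"


section \<open>Eigenvalues and spectral representations\<close>

definition eigenspace :: "real^'n^'n \<Rightarrow> real \<Rightarrow> (real^'n) set" where
  "eigenspace A l = {f. A *v f = l *\<^sub>R f}"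

definition multiplicity_of :: "real^'n^'n \<Rightarrow> real \<Rightarrow> nat" where
  "multiplicity_of A l = dim (eigenspace A l)"

text \<open>The sum ranges over the finitely many real eigenvalues.  Multiplicities are geometric; for
  the symmetric matrices considered here they agree with the algebraic ones and add up to the
  size of the matrix.\<close>

definition eigenvalue_mset :: "real^'n^'n \<Rightarrow> real multiset" where
  "eigenvalue_mset A = (\<Sum>l | eigenspace A l \<noteq> {0}. replicate_mset (multiplicity_of A l) l)"

text \<open>\<open>eigval A k\<close> is the eigenvalue with index \<open>k\<close> (starting from 0) when the eigenvalues are
  listed with multiplicity in descending order.\<close>

definition eigval :: "real^'n^'n \<Rightarrow> nat \<Rightarrow> real" where
  "eigval A k = rev (sorted_list_of_multiset (eigenvalue_mset A)) ! k"

text \<open>The coordinate functions of \<open>\<Phi>\<close> form an orthonormal basis of the eigenspace.\<close>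

definition spectral_representation ::
    "real^'v^'v \<Rightarrow> real \<Rightarrow> ('v::finite \<Rightarrow> real^'k) \<Rightarrow> bool" where
  "spectral_representation P l \<Phi> \<longleftrightarrow>
     (\<forall>a b. (\<Sum>i\<in>UNIV. \<Phi> i $ a * \<Phi> i $ b) = (if a = b then 1 else 0)) \<and>
     span (range (\<lambda>a. \<chi> i. \<Phi> i $ a)) = eigenspace P l"

definition equilateral :: "'v set set \<Rightarrow> ('v \<Rightarrow> real^'k) \<Rightarrow> bool" where
  "equilateral E \<Phi> \<longleftrightarrow> (\<exists>d. \<forall>i j. {i, j} \<in> E \<longrightarrow> norm (\<Phi> i - \<Phi> j) = d)"


section \<open>Real analytic functions of two variables; strict convexity\<close>

definition real_analytic2_on :: "(real \<times> real \<Rightarrow> real) \<Rightarrow> (real \<times> real) set \<Rightarrow> bool" where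
  "real_analytic2_on f U \<longleftrightarrow>
     (\<forall>(a, b)\<in>U. \<exists>c :: nat \<Rightarrow> nat \<Rightarrow> real. \<exists>r>0.
        \<forall>x y. \<bar>x - a\<bar> < r \<longrightarrow> \<bar>y - b\<bar> < r \<longrightarrow>
          ((\<lambda>(m, n). c m n * (x - a) ^ m * (y - b) ^ n) has_sum f (x, y)) UNIV)"

text \<open>Analyticity on the open triangle \<open>int_prob_simplex\<close>, expressed in its global affine chart
  \<open>(x, y) \<mapsto> (x, y, 1 - x - y)\<close>.\<close>

definition analytic_on_int_simplex :: "(real \<times> real \<times> real \<Rightarrow> real) \<Rightarrow> bool" where
  "analytic_on_int_simplex g \<longleftrightarrow>
     real_analytic2_on (\<lambda>(x, y). g (x, y, 1 - x - y))
       {(x, y). (x, y, 1 - x - y) \<in> int_prob_simplex}"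

definition strictly_convex_on :: "'a::real_vector set \<Rightarrow> ('a \<Rightarrow> real) \<Rightarrow> bool" where
  "strictly_convex_on S f \<longleftrightarrow> convex S \<and>
     (\<forall>x\<in>S. \<forall>y\<in>S. \<forall>t. x \<noteq> y \<longrightarrow> 0 < t \<longrightarrow> t < 1 \<longrightarrow>
        f ((1 - t) *\<^sub>R x + t *\<^sub>R y) < (1 - t) * f x + t * f y)"

end

theory Submission
  imports Defs
begin

text \<open>The 120 vertices are the orbit of a point \<open>rho\<close> of the open Weyl chamber under the reflection group
  generated by the three simple reflections, and a transition matrix of the simplex acts on functions on
  the vertices as a convex combination of three involutions, namely right multiplication by these
  reflections. Two such involutions \<open>R\<close>, \<open>S\<close> with \<open>(R S)\<^sup>n = 1\<close> satisfy
  \<open>(v - R v) \<bullet> (v - S v) \<ge> - cos (\<pi> / n) \<parallel>v - R v\<parallel> \<parallel>v - S v\<parallel>\<close>.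
  Inserted into the eigenvalue equation, this bounds the spectral gap from below by the gap \<open>2 m\<close> of the
  three-dimensional reflection representation, where \<open>m\<close> is the least eigenvalue of a weighted Gram
  matrix of the simple roots. Equality forces every eigenfunction to generate a copy of the reflection
  representation, so the multiplicity is three and the eigenfunctions are the coordinate functions of
  the orbit of a chamber point. Analyticity holds because \<open>m\<close> is a simple root of a cubic polynomial,
  strict convexity because the second eigenvalue is a maximum of Rayleigh quotients. At \<open>X0\<close> the orbit is
  the vertex set itself, up to scaling; it is equilateral, and the Rayleigh quotients of its coordinate
  functions on an arbitrary matrix show that \<open>X0\<close> is optimal.\<close>

section \<open>Pairs of reflections and the spectral gap\<close>

text \<open>The permutation representation on functions of the vertices is never decomposed into
  irreducibles. All its constituents are treated at once, because the angle bound for a pair of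
  generators only involves the dihedral group that they generate: \<open>v - R v\<close> and
  \<open>v - S v\<close> never enclose a larger angle than the two simple roots do. Squaring
  \<open>e v = x (v - X v) + y (v - Y v) + z (v - Z v)\<close> then leaves a quadratic form in the
  three norms that dominates the weighted Gram form, and a positive eigenvector of the latter turns
  the difference into a sum of squares. The weights of \<open>X0\<close> come from the demand that
  the orbit be equilateral: the chamber point must have equal heights over the three walls, so (1,
  1, 1) must be the eigenvector. The equations x - z/2 = y - phi z/2 = z - x/2 - phi y/2 with x + y
  + z = 1 have \<open>X0\<close> as solution. The combinatorics of the solid is obtained from the
  faces at one vertex, which the three dual weights describe; what remains are finite checks with
  integer pairs representing a + b phi.\<close>

definition inner_involution :: "('a::real_inner \<Rightarrow> 'a) \<Rightarrow> bool" where
  "inner_involution R \<longleftrightarrow> linear R \<and> (\<forall>a. R (R a) = a) \<and> (\<forall>a b. R a \<bullet> b = a \<bullet> R b)"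

lemma inner_involutionD:
  assumes "inner_involution R"
  shows "R (a + b) = R a + R b" "R (a - b) = R a - R b" "R (- a) = - R a"
    "R (t *\<^sub>R a) = t *\<^sub>R R a" "R (R a) = a" "R a \<bullet> b = a \<bullet> R b"
  using assms by (auto simp: inner_involution_def linear_add linear_diff linear_neg linear_cmul)

text \<open>The clause for equality says that \<open>R\<close> acts on \<open>v - S v\<close>
  exactly as the Euclidean reflection in the vector \<open>v - R v\<close> would. This rigidity
  later bounds the multiplicity.\<close>

definition angle_bound :: "real \<Rightarrow> ('a::real_inner \<Rightarrow> 'a) \<Rightarrow> ('a \<Rightarrow> 'a) \<Rightarrow> bool" where
  "angle_bound c R S \<longleftrightarrow>
     (\<forall>v. - c * norm (v - R v) * norm (v - S v) \<le> (v - R v) \<bullet> (v - S v) \<and>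
        (v - R v \<noteq> 0 \<longrightarrow> (v - R v) \<bullet> (v - S v) = - c * norm (v - R v) * norm (v - S v) \<longrightarrow>
           R (v - S v) = (v - S v) + (2 * c * norm (v - S v) / norm (v - R v)) *\<^sub>R (v - R v)))"

text \<open>In the applications \<open>p = v - R v\<close>, \<open>q = v - S v\<close>, and
  \<open>e\<close> is their common component in the sign representation, which only increases
  \<open>p \<bullet> q\<close>. The rest of \<open>p\<close> is negated by \<open>R\<close>, so it
  is paired only with the negated half of \<open>q - e\<close>, and \<open>h\<close> bounds the norm
  of that half by \<open>c * norm (q - e)\<close>. Cauchy-Schwarz finishes.\<close>

lemma angle_bound_aux:
  fixes p q e :: "'a::real_inner"
  assumes R: "inner_involution R" and c: "0 \<le> c" and p: "R p = - p" and e: "R e = - e"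
    and pe: "(p - e) \<bullet> e = 0" and qe: "(q - e) \<bullet> e = 0"
    and h: "norm ((q - e) - R (q - e)) \<le> 2 * c * norm (q - e)"
  shows "- c * norm p * norm q \<le> p \<bullet> q"
    and "p \<noteq> 0 \<Longrightarrow> p \<bullet> q = - c * norm p * norm q \<Longrightarrow>
      R q = q + (2 * c * norm q / norm p) *\<^sub>R p"
proof -
  note RD = inner_involutionD[OF R]
  define p' q' h' where "p' = p - e" and "q' = q - e" and "h' = (1/2) *\<^sub>R (q' - R q')"
  have pq: "p \<bullet> q = p' \<bullet> q' + e \<bullet> e"
    using pe qe by (simp add: p'_def q'_def inner_diff_left inner_diff_right inner_commute)
  have Rp': "R p' = - p'" by (simp add: p'_def RD p e)
  have "p' \<bullet> R q' = - (p' \<bullet> q')"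
    using RD(6)[of p' q'] Rp' by simp
  then have ph: "p' \<bullet> q' = p' \<bullet> h'"
    by (simp add: h'_def inner_diff_right)
  have nh: "norm h' \<le> c * norm q'"
    using h by (simp add: h'_def q'_def)
  have pp: "norm p ^ 2 = norm p' ^ 2 + norm e ^ 2"
    using pe by (simp add: p'_def power2_norm_eq_inner inner_diff_left inner_diff_right inner_commute)
  have qq: "norm q ^ 2 = norm q' ^ 2 + norm e ^ 2"
    using qe by (simp add: q'_def power2_norm_eq_inner inner_diff_left inner_diff_right inner_commute)
  have np: "norm p' \<le> norm p" by (rule power2_le_imp_le) (use pp in auto)
  have nq: "norm q' \<le> norm q" by (rule power2_le_imp_le) (use qq in auto)
  have "- (norm p' * norm h') \<le> p' \<bullet> h'"
    using Cauchy_Schwarz_ineq2[of p' h'] by linarith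
  moreover have "norm p' * norm h' \<le> norm p' * (c * norm q')"
    using nh by (rule mult_left_mono) simp
  ultimately have 1: "- (c * norm p' * norm q') \<le> p' \<bullet> q'"
    by (simp add: ph algebra_simps)
  have 2: "c * norm p' * norm q' \<le> c * norm p * norm q"
    using np nq c by (intro mult_mono) auto
  show "- c * norm p * norm q \<le> p \<bullet> q"
    using 1 2 inner_ge_zero[of e] unfolding pq by (simp only: minus_mult_left)
  assume p0: "p \<noteq> 0" and eq: "p \<bullet> q = - c * norm p * norm q"
  have "e \<bullet> e \<le> 0" using 1 2 eq by (simp add: pq)
  then have e0: "e = 0" by (metis inner_eq_zero_iff inner_ge_zero order.antisym)
  \<comment> \<open>If equality holds, Cauchy-Schwarz is tight and \<open>h'\<close> must be the
    multiple \<open>- s p\<close>. This is verified by expanding the squared norm of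
    \<open>h' + s p\<close>.\<close>
  define s where "s = c * norm q / norm p"
  have sp: "s * norm p = c * norm q" using p0 by (simp add: s_def)
  have "p \<bullet> h' = - c * norm p * norm q"
    using eq ph e0 by (simp add: p'_def q'_def)
  then have ph2: "s * (h' \<bullet> p) = - ((c * norm q)^2)"
    using sp by (simp add: inner_commute power2_eq_square algebra_simps)
  have "norm (h' + s *\<^sub>R p)^2 = norm h'^2 + 2 * (s * (h' \<bullet> p)) + (s * norm p)^2"
    unfolding power2_norm_eq_inner power_mult_distrib
    by (simp add: inner_add_left inner_add_right inner_commute algebra_simps power2_eq_square)
  also have "\<dots> \<le> 0"
    using nh power_mono[OF nh, of 2] e0 by (simp add: ph2 sp q'_def)
  finally have "h' + s *\<^sub>R p = 0" by simp
  then have "h' = - (s *\<^sub>R p)" by (simp add: eq_neg_iff_add_eq_0)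
  moreover have "q - R q = 2 *\<^sub>R h'" by (simp add: h'_def q'_def e0)
  ultimately have "q - R q = - ((2 * s) *\<^sub>R p)" by simp
  then have "R q = q + (2 * s) *\<^sub>R p" by (simp add: algebra_simps)
  then show "R q = q + (2 * c * norm q / norm p) *\<^sub>R p"
    by (simp add: s_def)
qed

lemma involution_diff:
  assumes "inner_involution R" shows "R (v - R v) = - (v - R v)"
  by (simp add: inner_involutionD[OF assms])

text \<open>The vector \<open>e\<close> is twice the projection of \<open>v\<close> to the sign
  representation of the dihedral group generated by \<open>R\<close> and \<open>S\<close>: four
  signed terms over 2 here, six over 3 and ten over 5 in the next cases. Without it,
  \<open>v - S v\<close> is fixed by \<open>R\<close>, hence the constant 0.\<close>

lemma angle_bound_2:
  assumes R: "inner_involution R" and S: "inner_involution S"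
    and braid: "\<And>v. R (S v) = S (R v)"
  shows "angle_bound 0 R S"
proof -
  note D = inner_involutionD[OF R] inner_involutionD[OF S]
  have *: "R ((v - S v) - e) = (v - S v) - e"
    "((v - R v) - e) \<bullet> e = 0" "((v - S v) - e) \<bullet> e = 0" "R e = - e"
    if "e = (1/2) *\<^sub>R (v - R v - S v + R (S v))" for v e
  proof -
    show Re: "R e = - e" and "R ((v - S v) - e) = (v - S v) - e"
      by (simp_all add: that D braid algebra_simps scaleR_2)
        (simp_all add: scaleR_half_double algebra_simps flip: scaleR_add_left)
    have Se: "S e = - e" by (simp add: that D braid algebra_simps)
    have "(v - R v) \<bullet> e = 2 * (v \<bullet> e)" "(v - S v) \<bullet> e = 2 * (v \<bullet> e)"
      using Re Se by (simp_all add: D inner_diff_left)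
    moreover have "e \<bullet> e = 2 * (v \<bullet> e)"
      by (subst that) (simp add: D inner_add_left inner_diff_left Re Se)
    ultimately show "((v - R v) - e) \<bullet> e = 0" "((v - S v) - e) \<bullet> e = 0"
      by (simp_all add: inner_diff_left)
  qed
  show ?thesis unfolding angle_bound_def
    using angle_bound_aux[OF R order.refl involution_diff[OF R] *(4,2,3)[OF refl]] *(1)[OF refl]
    by simp
qed

text \<open>Once the sign component is removed, the alternating sum over the group vanishes on
  \<open>q\<close>. As \<open>S q = - q\<close>, only three terms survive, and pairing them with
  \<open>q\<close> determines \<open>q \<bullet> R q\<close>.\<close>

lemma angle_bound_3:
  assumes R: "inner_involution R" and S: "inner_involution S"
    and braid: "\<And>v. S (R (S v)) = R (S (R v))"
  shows "angle_bound (1/2) R S"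
proof -
  note D = inner_involutionD[OF R] inner_involutionD[OF S]
  have *: "norm (((v - S v) - e) - R ((v - S v) - e)) \<le> 2 * (1/2) * norm ((v - S v) - e)"
    "((v - R v) - e) \<bullet> e = 0" "((v - S v) - e) \<bullet> e = 0" "R e = - e"
    if e: "e = (1/3) *\<^sub>R (v - R v - S v + R (S v) + S (R v) - R (S (R v)))" for v e
  proof -
    show Re: "R e = - e" by (simp add: that D braid algebra_simps)
    have Se: "S e = - e" by (simp add: that D braid algebra_simps flip: braid)
    have "(v - R v) \<bullet> e = 2 * (v \<bullet> e)" "(v - S v) \<bullet> e = 2 * (v \<bullet> e)"
      using Re Se by (simp_all add: D inner_diff_left)
    moreover have "e \<bullet> e = 2 * (v \<bullet> e)"
      by (subst that) (simp add: D inner_add_left inner_diff_left Re Se)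
    ultimately show "((v - R v) - e) \<bullet> e = 0" "((v - S v) - e) \<bullet> e = 0"
      by (simp_all add: inner_diff_left)
    define q where "q = (v - S v) - e"
    have Sq: "S q = - q" by (simp add: q_def D Se)
    have "(1 + 1 + 1) *\<^sub>R e = v - R v - S v + R (S v) + S (R v) - R (S (R v))" by (simp add: e)
    then have "q - R q + S (R q) = 0"
      unfolding scaleR_add_left scaleR_one
      by (simp add: q_def D braid Re Se algebra_simps)
    then have "q \<bullet> q - q \<bullet> R q + q \<bullet> S (R q) = 0"
      by (metis inner_add_right inner_diff_right inner_zero_right)
    moreover have "q \<bullet> S (R q) = - (q \<bullet> R q)" using Sq D(12)[of q "R q"] by simp
    ultimately have "q \<bullet> R q = (q \<bullet> q) / 2" by simp
    then have "norm (q - R q)^2 = norm q ^ 2"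
      by (simp add: power2_norm_eq_inner inner_diff_left inner_diff_right inner_commute D)
    then show "norm (((v - S v) - e) - R ((v - S v) - e)) \<le> 2 * (1/2) * norm ((v - S v) - e)"
      by (simp add: q_def)
  qed
  show ?thesis unfolding angle_bound_def
    using angle_bound_aux[OF R _ involution_diff[OF R] *(4,2,3,1)[OF refl]]
    by simp
qed

lemma golden_ratio_props:
  "golden_ratio * golden_ratio = golden_ratio + 1" "golden_ratio\<^sup>2 = golden_ratio + 1"
  "1 < golden_ratio" "golden_ratio < 2" "1 / golden_ratio = golden_ratio - 1"
proof -
  have s: "sqrt 5 * sqrt 5 = 5" by simp
  show 1: "golden_ratio * golden_ratio = golden_ratio + 1"
    by (simp add: golden_ratio_def field_simps)
  then show "golden_ratio\<^sup>2 = golden_ratio + 1" by (simp add: power2_eq_square)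
  have "2 < sqrt 5" "sqrt 5 < 3" by (simp_all add: real_less_rsqrt real_less_lsqrt)
  then show 2: "1 < golden_ratio" "golden_ratio < 2" by (simp_all add: golden_ratio_def)
  show "1 / golden_ratio = golden_ratio - 1" using 1 2 by (simp add: field_simps)
qed

text \<open>The dihedral group of order ten has two irreducible representations of dimension two, so
  the alternating sum alone does not determine \<open>q \<bullet> R q\<close>. The missing
  inequality comes from one explicit square.\<close>

lemma angle_bound_5:
  assumes R: "inner_involution R" and S: "inner_involution S"
    and braid: "\<And>v. S (R (S (R (S v)))) = R (S (R (S (R v))))"
  shows "angle_bound (golden_ratio/2) R S"
proof -
  note D = inner_involutionD[OF R] inner_involutionD[OF S]
  define g where "g = golden_ratio"
  have *: "norm (((v - S v) - e) - R ((v - S v) - e)) \<le> 2 * (g/2) * norm ((v - S v) - e)"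
    "((v - R v) - e) \<bullet> e = 0" "((v - S v) - e) \<bullet> e = 0" "R e = - e"
    if e: "e = (1/5) *\<^sub>R (v - R v - S v + R (S v) + S (R v) - R (S (R v)) - S (R (S v))
       + R (S (R (S v))) + S (R (S (R v))) - R (S (R (S (R v)))))" for v e
  proof -
    show Re: "R e = - e" by (simp add: that D braid algebra_simps)
    have Se: "S e = - e" by (simp add: that D braid algebra_simps flip: braid)
    have "(v - R v) \<bullet> e = 2 * (v \<bullet> e)" "(v - S v) \<bullet> e = 2 * (v \<bullet> e)"
      using Re Se by (simp_all add: D inner_diff_left)
    moreover have "e \<bullet> e = 2 * (v \<bullet> e)"
      by (subst that) (simp add: D inner_add_left inner_diff_left Re Se)
    ultimately show "((v - R v) - e) \<bullet> e = 0" "((v - S v) - e) \<bullet> e = 0"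
      by (simp_all add: inner_diff_left)
    define q where "q = (v - S v) - e"
    have Sq: "S q = - q" by (simp add: q_def D Se)
    have "(1 + 1 + 1 + 1 + 1) *\<^sub>R e = v - R v - S v + R (S v) + S (R v) - R (S (R v)) - S (R (S v))
       + R (S (R (S v))) + S (R (S (R v))) - R (S (R (S (R v))))" by (simp add: e)
    then have "q - R q + S (R q) - R (S (R q)) + S (R (S (R q))) = 0"
      unfolding scaleR_add_left scaleR_one
      by (simp add: q_def D braid Re Se algebra_simps)
    then have "q \<bullet> q - q \<bullet> R q + q \<bullet> S (R q) - q \<bullet> R (S (R q)) + q \<bullet> S (R (S (R q))) = 0"
      by (metis inner_add_right inner_diff_right inner_zero_right)
    moreover have S1: "q \<bullet> S a = - (q \<bullet> a)" for a using Sq D(12)[of q a] by simp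
    ultimately have g2: "q \<bullet> R (S (R q)) = (q \<bullet> q) / 2 - q \<bullet> R q" by simp
    \<comment> \<open>This vector is sqrt 5 times the component of \<open>q\<close> in the
      irreducible representation with the doubled angle. It vanishes on the reflection
      representation, where the bound is attained.\<close>
    have "norm (R q - S (R q) + (g - 1) *\<^sub>R q)^2
       = 2 * (q \<bullet> q) - 2 * (q \<bullet> R (S (R q))) + (g-1)^2 * (q \<bullet> q) + 4 * (g-1) * (q \<bullet> R q)"
      unfolding power2_norm_eq_inner
      by (simp add: inner_diff_left inner_diff_right inner_add_left inner_add_right D S1 Sq
          inner_commute[of "R q" q] inner_commute[of "S (R q)" q] power2_eq_square)
        (simp add: algebra_simps)
    then have "0 \<le> 2 * (q \<bullet> q) - 2 * (q \<bullet> R (S (R q))) + (g-1)^2 * (q \<bullet> q) + 4 * (g-1) * (q \<bullet> R q)"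
      by (metis zero_le_power2)
    also have "\<dots> = (3 - g) * (q \<bullet> q) + (4 * g - 2) * (q \<bullet> R q)"
      using golden_ratio_props by (simp add: g2 power2_eq_square algebra_simps g_def)
    also have "\<dots> = (2 * g - 1) * ((g - 1) * (q \<bullet> q) + 2 * (q \<bullet> R q))"
    proof -
      have "(2*g - 1) * (g - 1) = 3 - g" using golden_ratio_props by (simp add: algebra_simps g_def)
      then show ?thesis by (simp add: distrib_left mult.assoc[symmetric])
    qed
    finally have "0 \<le> (2 * g - 1) * ((g - 1) * (q \<bullet> q) + 2 * (q \<bullet> R q))" .
    then have "0 \<le> (g - 1) * (q \<bullet> q) + 2 * (q \<bullet> R q)"
      using golden_ratio_props by (simp add: g_def zero_le_mult_iff)
    then have "norm (q - R q)^2 \<le> (g * norm q) ^ 2"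
      using golden_ratio_props 
      by (simp add: power2_norm_eq_inner inner_diff_left inner_diff_right inner_commute[of "R q" q] D
           power_mult_distrib g_def algebra_simps)
    then have "norm (q - R q) \<le> g * norm q"
      by (rule power2_le_imp_le) (use golden_ratio_props in \<open>simp add: g_def\<close>)
    then show "norm (((v - S v) - e) - R ((v - S v) - e)) \<le> 2 * (g/2) * norm ((v - S v) - e)"
      by (simp add: q_def)
  qed
  show ?thesis unfolding angle_bound_def
    using angle_bound_aux[OF R _ involution_diff[OF R] *(4,2,3,1)[OF refl]] golden_ratio_props
    by (simp add: g_def)
qed


text \<open>Since \<open>v \<bullet> (v - R v)\<close> is half the squared norm of
  \<open>v - R v\<close>, both sides of the squared eigenvalue equation are expressed by the three
  norms and the slacks of the angle bounds. For \<open>e = 2 * m\<close> every nonnegative term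
  vanishes, so the norms are proportional to \<open>(kx, ky, kz)\<close> and all angle bounds are
  tight.\<close>

lemma spectral_gap:
  fixes X Y Z :: "'a::real_inner \<Rightarrow> 'a"
  assumes inv: "inner_involution X" "inner_involution Y" "inner_involution Z"
    and XY: "angle_bound 0 X Y" "angle_bound 0 Y X"
    and XZ: "angle_bound (1/2) X Z" "angle_bound (1/2) Z X"
    and YZ: "angle_bound (golden_ratio/2) Y Z" "angle_bound (golden_ratio/2) Z Y"
    and pos: "0 < x" "0 < y" "0 < z" "0 < kx" "0 < ky" "0 < kz" "0 < m"
    and kx: "x * kx - z * kz / 2 = m * kx"
    and ky: "y * ky - golden_ratio * z * kz / 2 = m * ky"
    and kz: "z * kz - x * kx / 2 - golden_ratio * y * ky / 2 = m * kz"
    and eig: "x *\<^sub>R (v - X v) + y *\<^sub>R (v - Y v) + z *\<^sub>R (v - Z v) = e *\<^sub>R v"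
    and nonfix: "\<not> (X v = v \<and> Y v = v \<and> Z v = v)"
  shows "2 * m \<le> e"
    and "e = 2 * m \<Longrightarrow>
      X (v - Y v) = v - Y v \<and>
      X (v - Z v) = (v - Z v) + (kz / kx) *\<^sub>R (v - X v) \<and>
      Y (v - X v) = v - X v \<and>
      Y (v - Z v) = (v - Z v) + (golden_ratio * kz / ky) *\<^sub>R (v - Y v) \<and>
      Z (v - X v) = (v - X v) + (kx / kz) *\<^sub>R (v - Z v) \<and>
      Z (v - Y v) = (v - Y v) + (golden_ratio * ky / kz) *\<^sub>R (v - Z v)"
proof -
  define p q r where "p = v - X v" and "q = v - Y v" and "r = v - Z v"
  \<comment> \<open>Norms relative to the positive eigenvector. In these variables the form minus
    \<open>m * W\<close> becomes a combination of \<open>(a - d)\<^sup>2\<close> and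
    \<open>(b - d)\<^sup>2\<close>; there is no \<open>a - b\<close> because the first two roots are
    orthogonal.\<close>
  define a b d where "a = norm p / kx" and "b = norm q / ky" and "d = norm r / kz"
  have n: "norm p = kx * a" "norm q = ky * b" "norm r = kz * d"
    using pos by (simp_all add: a_def b_def d_def)
  have abd: "0 \<le> a" "0 \<le> b" "0 \<le> d" using pos by (simp_all add: a_def b_def d_def)
  let ?g = golden_ratio
  have g: "0 < ?g" using golden_ratio_props by simp
  have half: "v \<bullet> (v - R v) = (norm (v - R v))^2 / 2" if "inner_involution R" for R
    by (simp add: power2_norm_eq_inner inner_diff_left inner_diff_right inner_involutionD[OF that])
  define W where "W = x * (kx*a)^2 + y * (ky*b)^2 + z * (kz*d)^2"
  define pq pr qr where "pq = p \<bullet> q" and "pr = p \<bullet> r + 1/2 * norm p * norm r"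
    and "qr = q \<bullet> r + ?g/2 * norm q * norm r"
  have pq0: "0 \<le> pq" "0 \<le> pr" "0 \<le> qr"
    using XY(1) XZ(1) YZ(1) unfolding angle_bound_def pq_def pr_def qr_def p_def q_def r_def
    by (simp_all add: algebra_simps)
  have "(e *\<^sub>R v) \<bullet> (x *\<^sub>R p + y *\<^sub>R q + z *\<^sub>R r) = e / 2 * W"
    unfolding inner_add_right inner_scaleR_right inner_scaleR_left p_def q_def r_def half[OF inv(1)] half[OF inv(2)] half[OF inv(3)]
    by (simp add: W_def n algebra_simps flip: p_def q_def r_def)
  moreover have "(x *\<^sub>R p + y *\<^sub>R q + z *\<^sub>R r) \<bullet> (x *\<^sub>R p + y *\<^sub>R q + z *\<^sub>R r)
     = x^2 * norm p^2 + y^2 * norm q^2 + z^2 * norm r^2 + 2*x*y*(p \<bullet> q) + 2*x*z*(p \<bullet> r) + 2*y*z*(q \<bullet> r)"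
    by (simp add: inner_add_left inner_add_right power2_norm_eq_inner inner_commute)
      (simp add: power2_eq_square algebra_simps)
  ultimately have "e / 2 * W = x^2 * norm p^2 + y^2 * norm q^2 + z^2 * norm r^2 
     + 2*x*y*(p \<bullet> q) + 2*x*z*(p \<bullet> r) + 2*y*z*(q \<bullet> r)"
    unfolding eig[folded p_def q_def r_def] by linarith
  also have "\<dots> = x^2 * (kx*a)^2 + y^2 * (ky*b)^2 + z^2 * (kz*d)^2 + 2*x*y*pq
      + 2*x*z*(pr - 1/2 * (kx*a) * (kz*d)) + 2*y*z*(qr - ?g/2 * (ky*b) * (kz*d))"
    by (simp add: pq_def pr_def qr_def n)
  finally have 1: "e / 2 * W = \<dots>" .
  \<comment> \<open>The eigenvector equation, multiplied by \<open>x * kx\<close>, trades the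
    diagonal coefficient for \<open>m\<close> and off-diagonal ones.\<close>
  have sx: "x^2 * kx^2 = m * x * kx^2 + x * z * kx * kz / 2"
  proof -
    have "x * kx = m * kx + z * kz / 2" using kx by simp
    then have "x * kx * (x * kx) = (m * kx + z * kz / 2) * (x * kx)" by simp
    then show ?thesis by (simp add: power2_eq_square algebra_simps)
  qed
  have sy: "y^2 * ky^2 = m * y * ky^2 + ?g * y * z * ky * kz / 2"
  proof -
    have "y * ky = m * ky + ?g * z * kz / 2" using ky by simp
    then have "y * ky * (y * ky) = (m * ky + ?g * z * kz / 2) * (y * ky)" by simp
    then show ?thesis by (simp add: power2_eq_square algebra_simps)
  qed
  have sz: "z^2 * kz^2 = m * z * kz^2 + x * z * kx * kz / 2 + ?g * y * z * ky * kz / 2"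
  proof -
    have "z * kz = m * kz + x * kx / 2 + ?g * y * ky / 2" using kz by simp
    then have "z * kz * (z * kz) = (m * kz + x * kx / 2 + ?g * y * ky / 2) * (z * kz)" by simp
    then show ?thesis by (simp add: power2_eq_square algebra_simps)
  qed
  have 2: "(e / 2 - m) * W = x*z*kx*kz/2 * (a - d)^2 + ?g*y*z*ky*kz/2 * (b - d)^2
      + 2*x*y*pq + 2*x*z*pr + 2*y*z*qr"
  proof -
    have "(e / 2 - m) * W = (x^2 * kx^2 - m * x * kx^2) * a^2 + (y^2 * ky^2 - m * y * ky^2) * b^2
      + (z^2 * kz^2 - m * z * kz^2) * d^2 + 2*x*y*pq
      + 2*x*z*(pr - 1/2 * (kx*a) * (kz*d)) + 2*y*z*(qr - ?g/2 * (ky*b) * (kz*d))"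
      unfolding left_diff_distrib[of "e / 2"] 1 by (simp add: W_def power_mult_distrib algebra_simps)
    then show ?thesis
      unfolding sx sy sz by (simp add: power2_eq_square algebra_simps add_divide_distrib)
  qed
  have "a \<noteq> 0 \<or> b \<noteq> 0 \<or> d \<noteq> 0"
    using nonfix n by (auto simp: p_def q_def r_def)
  then have W: "0 < W"
  proof -
    have "0 \<le> x * (kx*a)^2" "0 \<le> y * (ky*b)^2" "0 \<le> z * (kz*d)^2" using pos by auto
    moreover have "0 < x * (kx*a)^2 \<or> 0 < y * (ky*b)^2 \<or> 0 < z * (kz*d)^2"
      using pos \<open>a \<noteq> 0 \<or> b \<noteq> 0 \<or> d \<noteq> 0\<close> by auto
    ultimately show ?thesis unfolding W_def by linarith
  qed
  have terms: "0 \<le> x*z*kx*kz/2 * (a - d)^2" "0 \<le> ?g*y*z*ky*kz/2 * (b - d)^2"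
      "0 \<le> 2*x*y*pq" "0 \<le> 2*x*z*pr" "0 \<le> 2*y*z*qr"
    using pos pq0 g by simp_all
  then have "0 \<le> (e / 2 - m) * W" unfolding 2 by linarith
  then show "2 * m \<le> e" using W by (simp add: zero_le_mult_iff)
  assume "e = 2 * m"
  then have "(e / 2 - m) * W = 0" by simp
  then have zero: "x*z*kx*kz/2 * (a - d)^2 = 0" "?g*y*z*ky*kz/2 * (b - d)^2 = 0"
      "2*x*y*pq = 0" "2*x*z*pr = 0" "2*y*z*qr = 0"
    using terms unfolding 2 by linarith+
  then have ab: "a = d" "b = d" and pqz: "pq = 0" "pr = 0" "qr = 0" using pos g by simp_all
  then have d0: "0 < d" using abd \<open>a \<noteq> 0 \<or> b \<noteq> 0 \<or> d \<noteq> 0\<close> by linarith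
  then have nz: "p \<noteq> 0" "q \<noteq> 0" "r \<noteq> 0" using n pos ab by (metis mult_pos_pos norm_zero order_less_irrefl)+
  have eqs: "p \<bullet> q = 0" "p \<bullet> r = - (1/2) * norm p * norm r" "q \<bullet> r = - (?g/2) * norm q * norm r"
    using pqz by (simp_all add: pq_def pr_def qr_def)
  have ratios: "norm r / norm p = kz / kx" "norm r / norm q = kz / ky" "norm p / norm r = kx / kz"
    "norm q / norm r = ky / kz"
    using d0 ab by (simp_all add: n)
  have E: "R (v - S v) = (v - S v) + (2 * c * (norm (v - S v) / norm (v - R v))) *\<^sub>R (v - R v)"
    if "angle_bound c R S" "v - R v \<noteq> 0" "(v - R v) \<bullet> (v - S v) = - c * norm (v - R v) * norm (v - S v)"
    for c R S
    using that by (simp add: angle_bound_def)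
  show "X (v - Y v) = v - Y v \<and>
      X (v - Z v) = (v - Z v) + (kz / kx) *\<^sub>R (v - X v) \<and>
      Y (v - X v) = v - X v \<and>
      Y (v - Z v) = (v - Z v) + (golden_ratio * kz / ky) *\<^sub>R (v - Y v) \<and>
      Z (v - X v) = (v - X v) + (kx / kz) *\<^sub>R (v - Z v) \<and>
      Z (v - Y v) = (v - Y v) + (golden_ratio * ky / kz) *\<^sub>R (v - Z v)"
    using E[OF XY(1)] E[OF XY(2)] E[OF XZ(1)] E[OF XZ(2)] E[OF YZ(1)] E[OF YZ(2)]
      nz eqs ratios unfolding p_def[symmetric] q_def[symmetric] r_def[symmetric]
    by (simp add: inner_commute mult.commute)
qed

section \<open>The second eigenvalue of a symmetric stochastic matrix\<close>

lemma rev_sorted_nth_ge: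
  assumes "sorted xs" and k: "k < length (filter (\<lambda>l. c \<le> l) xs)"
  shows "(c::'a::linorder) \<le> rev xs ! k"
proof (rule ccontr)
  assume "\<not> c \<le> rev xs ! k"
  then have lt: "rev xs ! k < c" by simp
  have "k < length (rev xs)" using order.strict_trans2[OF k length_filter_le] by simp
  have "\<not> c \<le> l" if l: "l \<in> set (drop k (rev xs))" for l
  proof -
    obtain j where j: "j < length (rev xs)" "k \<le> j" "l = rev xs ! j"
      using l by (auto simp: in_set_conv_nth) (metis add.commute le_add1 length_rev less_diff_conv nth_drop rev_nth)
    then have "rev xs ! j \<le> rev xs ! k"
      using \<open>sorted xs\<close> by (simp add: sorted_rev_nth_mono)
    then show ?thesis using lt j by simp
  qed
  then have "filter (\<lambda>l. c \<le> l) (drop k (rev xs)) = []"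
    by (simp add: filter_empty_conv)
  then have "length (filter (\<lambda>l. c \<le> l) (rev xs)) \<le> k"
    by (metis append_Nil2 append_take_drop_id filter_append length_filter_le length_take min.bounded_iff)
  then show False using k by (simp flip: rev_filter)
qed

lemma rev_sorted_nth_le:
  assumes "sorted xs" and "length (filter (\<lambda>l. c < l) xs) \<le> k" and k: "k < length xs"
  shows "rev xs ! k \<le> (c::'a::linorder)"
proof (rule ccontr)
  assume "\<not> rev xs ! k \<le> c"
  then have lt: "c < rev xs ! k" by simp
  have "c < l" if l: "l \<in> set (take (Suc k) (rev xs))" for l
  proof -
    obtain j where j: "j < length (rev xs)" "j \<le> k" "l = rev xs ! j"
      using l by (auto simp: in_set_conv_nth)
    then have "rev xs ! k \<le> rev xs ! j"
      using \<open>sorted xs\<close> k by (simp add: sorted_rev_nth_mono)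
    then show ?thesis using lt j by simp
  qed
  then have "filter (\<lambda>l. c < l) (take (Suc k) (rev xs)) = take (Suc k) (rev xs)"
    by (simp add: filter_id_conv)
  then have "Suc k \<le> length (filter (\<lambda>l. c < l) (rev xs))"
    by (metis append_take_drop_id filter_append k length_append length_rev length_take less_eq_Suc_le
        le_add1 min.absorb2)
  then show False using assms(2) by (simp flip: rev_filter)
qed

lemma eigval_ge:
  assumes "k < size (filter_mset (\<lambda>l. c \<le> l) (eigenvalue_mset A))"
  shows "c \<le> eigval A k"
proof -
  let ?xs = "sorted_list_of_multiset (eigenvalue_mset A)"
  have "size (filter_mset (\<lambda>l. c \<le> l) (mset ?xs)) = length (filter (\<lambda>l. c \<le> l) ?xs)"
    by (metis mset_filter size_mset)
  then show ?thesis unfolding eigval_def using assms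
    by (intro rev_sorted_nth_ge) simp_all
qed

lemma eigval_le:
  assumes "size (filter_mset (\<lambda>l. c < l) (eigenvalue_mset A)) \<le> k" "k < size (eigenvalue_mset A)"
  shows "eigval A k \<le> c"
proof -
  let ?xs = "sorted_list_of_multiset (eigenvalue_mset A)"
  have "size (filter_mset (\<lambda>l. c < l) (mset ?xs)) = length (filter (\<lambda>l. c < l) ?xs)"
    by (metis mset_filter size_mset)
  moreover have "length ?xs = size (eigenvalue_mset A)"
    by (metis mset_sorted_list_of_multiset size_mset)
  ultimately show ?thesis unfolding eigval_def using assms
    by (intro rev_sorted_nth_le) simp_all
qed

lemma inner_symmetric_matrix:
  fixes P :: "real^'n^'n"
  assumes "\<And>i j. P $ i $ j = P $ j $ i"
  shows "(P *v f) \<bullet> g = f \<bullet> (P *v g)"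
proof -
  have "transpose P = P" by (simp add: transpose_def vec_eq_iff assms)
  then show ?thesis by (metis dot_lmul_matrix vector_transpose_matrix)
qed

lemma subspace_eigenspace: "subspace (eigenspace A l)"
  by (auto simp: eigenspace_def subspace_def matrix_vector_right_distrib
      matrix_vector_mult_scaleR scaleR_add_right)

lemma finite_eigenvalues:
  fixes P :: "real^'n^'n"
  assumes sym: "\<And>i j. P $ i $ j = P $ j $ i"
  shows "finite {l. eigenspace P l \<noteq> {0}}"
proof -
  let ?L = "{l. eigenspace P l \<noteq> {0}}"
  have "\<exists>f. f \<noteq> 0 \<and> P *v f = l *\<^sub>R f" if "l \<in> ?L" for l
    using that subspace_0[OF subspace_eigenspace, of P l] by (auto simp: eigenspace_def)
  then obtain F where F: "\<And>l. l \<in> ?L \<Longrightarrow> F l \<noteq> 0 \<and> P *v F l = l *\<^sub>R F l" by metis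
  have orth: "F l \<bullet> F l' = 0" if "l \<in> ?L" "l' \<in> ?L" "l \<noteq> l'" for l l'
  proof -
    have "l * (F l \<bullet> F l') = l' * (F l \<bullet> F l')"
      using inner_symmetric_matrix[OF sym, of "F l" "F l'"] F[OF that(1)] F[OF that(2)] by simp
    then show ?thesis using that(3) by simp
  qed
  have "inj_on F ?L"
    by (rule inj_onI) (metis F inner_eq_zero_iff orth)
  moreover have "finite (F ` ?L)"
    by (rule pairwise_orthogonal_imp_finite)
      (auto simp: pairwise_def orthogonal_def intro!: orth)
  ultimately show ?thesis by (rule finite_imageD[rotated])
qed

lemma count_eigenvalue_mset:
  fixes P :: "real^'n^'n"
  assumes sym: "\<And>i j. P $ i $ j = P $ j $ i"
  shows "count (eigenvalue_mset P) l = multiplicity_of P l"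
proof -
  have "dim (eigenspace P l) = 0" if "eigenspace P l = {0}" using that by simp
  then show ?thesis
    using finite_eigenvalues[OF sym]
    by (auto simp: eigenvalue_mset_def count_sum multiplicity_of_def sum.delta)
qed

lemma multiplicity_pos:
  assumes "P *v f = l *\<^sub>R f" "f \<noteq> 0" shows "0 < multiplicity_of P l"
proof -
  have "f \<in> eigenspace P l" using assms by (simp add: eigenspace_def)
  then have "\<not> eigenspace P l \<subseteq> {0}" using assms by auto
  then show ?thesis unfolding multiplicity_of_def by (metis dim_eq_0 gr0I)
qed

text \<open>The constant function and \<open>f\<close> contribute two entries not below
  \<open>l\<close> to the list of eigenvalues. For \<open>l = 1\<close> they share an eigenspace,
  and their orthogonality makes it at least two-dimensional.\<close>

lemma eigval_1_ge:
  fixes P :: "real^'n^'n"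
  assumes sym: "\<And>i j. P $ i $ j = P $ j $ i" and one: "P *v 1 = 1"
    and f: "P *v f = l *\<^sub>R f" "f \<noteq> 0" "f \<bullet> 1 = 0" and "l \<le> 1"
  shows "l \<le> eigval P 1"
proof (rule eigval_ge)
  let ?M = "eigenvalue_mset P"
  have "{#1, l#} \<subseteq># filter_mset (\<lambda>l'. l \<le> l') ?M"
  proof (cases "l = 1")
    case True
    have "independent {f, 1}"
      by (rule pairwise_orthogonal_independent)
        (use f in \<open>auto simp: pairwise_def orthogonal_def inner_commute\<close>)
    moreover have "{f, 1} \<subseteq> eigenspace P l" using f one True by (simp add: eigenspace_def)
    ultimately have "card {f, 1} \<le> multiplicity_of P l"
      unfolding multiplicity_of_def by (simp add: independent_card_le_dim)
    moreover have "f \<noteq> 1" using f by auto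
    ultimately show ?thesis
      using True by (simp add: subseteq_mset_def count_eigenvalue_mset[OF sym])
  next
    case False
    have "0 < multiplicity_of P 1" "0 < multiplicity_of P l"
      using one f by (auto intro!: multiplicity_pos)
    then show ?thesis
      using False \<open>l \<le> 1\<close> by (auto simp add: subseteq_mset_def count_eigenvalue_mset[OF sym] Suc_le_eq)
  qed
  then show "1 < size (filter_mset (\<lambda>l'. l \<le> l') ?M)"
    by (drule_tac size_mset_mono) simp
qed

text \<open>Only the simple eigenvalue 1 can exceed \<open>c\<close>. The eigenvector
  \<open>f\<close> ensures that the list has an entry with index 1 at all.\<close>

lemma eigval_1_le:
  fixes P :: "real^'n^'n"
  assumes sym: "\<And>i j. P $ i $ j = P $ j $ i" and one: "multiplicity_of P 1 = 1"
    and le: "\<And>l f. P *v f = l *\<^sub>R f \<Longrightarrow> f \<noteq> 0 \<Longrightarrow> l \<noteq> 1 \<Longrightarrow> l \<le> c"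
    and f: "P *v f = l *\<^sub>R f" "f \<noteq> 0" "l \<noteq> 1"
  shows "eigval P 1 \<le> c"
proof (rule eigval_le)
  let ?M = "eigenvalue_mset P"
  have "multiplicity_of P l' = 0" if "c < l'" "l' \<noteq> 1" for l'
  proof -
    have "eigenspace P l' \<subseteq> {0}"
      using le[of _ l'] that by (force simp: eigenspace_def)
    then show ?thesis by (simp add: multiplicity_of_def)
  qed
  then have "filter_mset (\<lambda>l'. c < l') ?M \<subseteq># {#1#}"
    using one by (auto simp: subseteq_mset_def count_eigenvalue_mset[OF sym])
  then show "size (filter_mset (\<lambda>l'. c < l') ?M) \<le> 1"
    by (drule_tac size_mset_mono) simp
  have "{#1, l#} \<subseteq># ?M"
    using one f multiplicity_pos[OF f(1,2)]
    by (auto simp: subseteq_mset_def count_eigenvalue_mset[OF sym] Suc_le_eq)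
  then show "1 < size ?M"
    by (drule_tac size_mset_mono) simp
qed

text \<open>First variation at the maximiser \<open>f\<close> in the direction of its residual
  \<open>g\<close>: the bound at \<open>f + t g\<close> becomes
  \<open>0 \<le> t * t * B - 2 * t * (g \<bullet> g)\<close> for all \<open>t\<close>, which forces
  \<open>g = 0\<close>.\<close>

lemma rayleigh_max_eigenvector:
  fixes P :: "real^'n^'n"
  assumes sym: "\<And>i j. P $ i $ j = P $ j $ i" and V: "subspace V" "\<And>g. g \<in> V \<Longrightarrow> P *v g \<in> V"
    and bound: "\<And>g. g \<in> V \<Longrightarrow> g \<bullet> (P *v g) \<le> l * (g \<bullet> g)"
    and f: "f \<in> V" "f \<bullet> (P *v f) = l * (f \<bullet> f)"
  shows "P *v f = l *\<^sub>R f"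
proof -
  define g where "g = P *v f - l *\<^sub>R f"
  define B where "B = l * (g \<bullet> g) - g \<bullet> (P *v g)"
  have g: "g \<in> V" unfolding g_def using V f by (simp add: subspace_diff subspace_scale)
  have B: "0 \<le> B" using bound[OF g] by (simp add: B_def)
  have ineq: "0 \<le> t * t * B - 2 * t * (g \<bullet> g)" for t
  proof -
    have "(f + t *\<^sub>R g) \<bullet> (P *v (f + t *\<^sub>R g)) \<le> l * ((f + t *\<^sub>R g) \<bullet> (f + t *\<^sub>R g))"
      using bound V f g by (simp add: subspace_add subspace_scale)
    moreover have "f \<bullet> (P *v g) = g \<bullet> (P *v f)"
      using inner_symmetric_matrix[OF sym, of f g] by (simp add: inner_commute)
    moreover have "g \<bullet> (P *v f) = g \<bullet> g + l * (g \<bullet> f)"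
      by (simp add: g_def inner_diff_left inner_diff_right algebra_simps)
    ultimately show ?thesis
      using f(2) by (simp add: matrix_vector_right_distrib matrix_vector_mult_scaleR inner_add_left
          inner_add_right B_def inner_commute[of f g] algebra_simps)
  qed
  have "g \<bullet> g \<le> 0"
  proof (cases "B = 0")
    case True
    then show ?thesis using ineq[of 1] by simp
  next
    case False
    then have "0 < B" using B by simp
    \<comment> \<open>The parabola in \<open>t\<close> has its minimum at
      \<open>t = (g \<bullet> g) / B\<close>.\<close>
    have "0 \<le> B * ((g \<bullet> g) / B * ((g \<bullet> g) / B) * B - 2 * ((g \<bullet> g) / B) * (g \<bullet> g))"
      using ineq[of "(g \<bullet> g) / B"] B by (rule mult_nonneg_nonneg[rotated])
    also have "\<dots> = - ((g \<bullet> g) * (g \<bullet> g))"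
      using \<open>0 < B\<close> by (simp add: field_simps)
    finally show ?thesis by (simp add: mult_le_0_iff)
  qed
  then have "g = 0" by (metis inner_eq_zero_iff inner_ge_zero order.antisym)
  then show ?thesis by (simp add: g_def)
qed

lemma rayleigh_max_exists:
  fixes P :: "real^'n^'n"
  assumes sym: "\<And>i j. P $ i $ j = P $ j $ i" and V: "subspace V" "\<And>g. g \<in> V \<Longrightarrow> P *v g \<in> V"
    and h: "h \<in> V" "h \<noteq> 0"
  obtains l f where "f \<in> V" "f \<noteq> 0" "P *v f = l *\<^sub>R f" "\<And>g. g \<in> V \<Longrightarrow> g \<bullet> (P *v g) \<le> l * (g \<bullet> g)"
proof -
  let ?S = "sphere 0 1 \<inter> V"
  have "compact ?S" by (intro compact_Int_closed closed_subspace V) simp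
  moreover have "(1 / norm h) *\<^sub>R h \<in> ?S" using h V by (simp add: subspace_scale)
  then have "?S \<noteq> {}" by blast
  moreover have "continuous_on ?S (\<lambda>g. g \<bullet> (P *v g))"
    by (intro continuous_intros linear_continuous_on matrix_vector_mul_bounded_linear)
  ultimately obtain f where f: "f \<in> ?S" and max: "\<And>g. g \<in> ?S \<Longrightarrow> g \<bullet> (P *v g) \<le> f \<bullet> (P *v f)"
    by (meson continuous_attains_sup)
  define l where "l = f \<bullet> (P *v f)"
  have bound: "g \<bullet> (P *v g) \<le> l * (g \<bullet> g)" if "g \<in> V" for g
  proof (cases "g = 0")
    case False
    define u where "u = (1 / norm g) *\<^sub>R g"
    have "u \<in> ?S" using that False V by (simp add: u_def subspace_scale)
    then have ul: "u \<bullet> (P *v u) \<le> l" using max by (simp add: l_def)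
    have g: "g = norm g *\<^sub>R u" using False by (simp add: u_def)
    have "g \<bullet> (P *v g) = (norm g)^2 * (u \<bullet> (P *v u))"
      by (subst (1 2) g) (simp add: matrix_vector_mult_scaleR power2_eq_square)
    also have "\<dots> \<le> (norm g)^2 * l" using ul by (rule mult_left_mono) simp
    finally show ?thesis by (simp add: power2_norm_eq_inner mult.commute)
  qed simp
  have "f \<bullet> f = 1" using f by (simp add: norm_eq_sqrt_inner)
  then have "P *v f = l *\<^sub>R f"
    using rayleigh_max_eigenvector[OF sym V bound, of f] f by (simp add: l_def)
  then show ?thesis using that[of f l] f bound by force
qed

lemma stochastic_one:
  assumes "P \<in> sym_stochastic E" shows "P *v 1 = 1"
  using assms by (simp add: sym_stochastic_def vec_eq_iff matrix_vector_mult_def)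

lemma stochastic_rayleigh_le_one:
  assumes P: "P \<in> sym_stochastic E" shows "f \<bullet> (P *v f) \<le> f \<bullet> f"
proof -
  have sym: "P $ i $ j = P $ j $ i" and nn: "0 \<le> P $ i $ j" and row: "(\<Sum>j\<in>UNIV. P $ i $ j) = 1" for i j
    using P by (auto simp: sym_stochastic_def)
  have "f \<bullet> (P *v f) = (\<Sum>i\<in>UNIV. \<Sum>j\<in>UNIV. P $ i $ j * (f $ i * f $ j))"
    by (simp add: inner_vec_def matrix_vector_mult_def sum_distrib_left algebra_simps)
  also have "\<dots> \<le> (\<Sum>i\<in>UNIV. \<Sum>j\<in>UNIV. P $ i $ j * ((f $ i)^2 / 2 + (f $ j)^2 / 2))"
  proof (intro sum_mono mult_left_mono nn)
    show "f $ i * f $ j \<le> (f $ i)^2 / 2 + (f $ j)^2 / 2" for i j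
      using sum_squares_bound[of "f $ i" "f $ j"] by simp
  qed
  also have "\<dots> = (\<Sum>i\<in>UNIV. \<Sum>j\<in>UNIV. P $ i $ j * ((f $ i)^2 / 2)) + (\<Sum>j\<in>UNIV. \<Sum>i\<in>UNIV. P $ i $ j * ((f $ j)^2 / 2))"
    by (subst (2) sum.swap) (simp add: distrib_left sum.distrib)
  also have "(\<Sum>j\<in>UNIV. \<Sum>i\<in>UNIV. P $ i $ j * ((f $ j)^2 / 2)) = (\<Sum>j\<in>UNIV. \<Sum>i\<in>UNIV. P $ j $ i * ((f $ j)^2 / 2))"
    by (simp add: sym)
  finally show ?thesis
    by (simp only: row inner_vec_def flip: sum_distrib_right sum.distrib)
      (simp add: power2_eq_square)
qed

text \<open>\<open>P\<close> may be reducible with 1 as a multiple eigenvalue, so the argument goes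
  through a maximiser on the complement of the constants. Its eigenvalue \<open>l\<close> is at most
  1 and therefore at most the eigenvalue of index 1; equality for \<open>f\<close> makes
  \<open>f\<close> a maximiser as well.\<close>

lemma rayleigh_le_eigval_1:
  fixes P :: "real^'n^'n"
  assumes P: "P \<in> sym_stochastic E" and f: "f \<bullet> 1 = 0"
  shows "f \<bullet> (P *v f) \<le> eigval P 1 * (f \<bullet> f)"
    and "f \<bullet> (P *v f) = eigval P 1 * (f \<bullet> f) \<Longrightarrow> P *v f = eigval P 1 *\<^sub>R f"
proof -
  let ?V = "{g. 1 \<bullet> g = 0} :: (real^'n) set"
  have sym: "\<And>i j. P $ i $ j = P $ j $ i" using P by (auto simp: sym_stochastic_def)
  have one: "P *v 1 = 1" by (rule stochastic_one[OF P])
  have V: "subspace ?V" by (rule subspace_hyperplane)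
  have inv: "P *v g \<in> ?V" if "g \<in> ?V" for g
    using that inner_symmetric_matrix[OF sym, of 1 g] one by simp
  have *: "f \<bullet> (P *v f) \<le> eigval P 1 * (f \<bullet> f) \<and>
     (f \<bullet> (P *v f) = eigval P 1 * (f \<bullet> f) \<longrightarrow> P *v f = eigval P 1 *\<^sub>R f)"
  proof (cases "f = 0")
    case False
    have "f \<in> ?V" using f by (simp add: inner_commute)
    have "\<exists>l h. h \<in> ?V \<and> h \<noteq> 0 \<and> P *v h = l *\<^sub>R h \<and> (\<forall>g. g \<in> ?V \<longrightarrow> g \<bullet> (P *v g) \<le> l * (g \<bullet> g))"
    proof (rule rayleigh_max_exists[OF sym V, where h = f])
      show "f \<in> ?V" "f \<noteq> 0" using \<open>f \<in> ?V\<close> False by auto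
    next
      fix l h assume "h \<in> ?V" "h \<noteq> 0" "P *v h = l *\<^sub>R h"
        "\<And>g. g \<in> ?V \<Longrightarrow> g \<bullet> (P *v g) \<le> l * (g \<bullet> g)"
      then show ?thesis by blast
    qed (rule inv)
    then obtain l h where h: "h \<in> ?V" "h \<noteq> 0" "P *v h = l *\<^sub>R h"
      and max: "\<And>g. g \<in> ?V \<Longrightarrow> g \<bullet> (P *v g) \<le> l * (g \<bullet> g)"
      by blast
    have "l * (h \<bullet> h) \<le> 1 * (h \<bullet> h)"
      using stochastic_rayleigh_le_one[OF P, of h] h by simp
    moreover have "0 < h \<bullet> h" using h by simp
    ultimately have "l \<le> 1" by (metis mult_le_cancel_right not_less_iff_gr_or_eq)
    then have le: "l \<le> eigval P 1"
      using eigval_1_ge[OF sym one h(3,2)] h(1) by (simp add: inner_commute)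
    have fl: "f \<bullet> (P *v f) \<le> l * (f \<bullet> f)" using max f by (simp add: inner_commute)
    have ff: "0 < f \<bullet> f" using False by simp
    have "l * (f \<bullet> f) \<le> eigval P 1 * (f \<bullet> f)" using le ff by simp
    moreover have "P *v f = eigval P 1 *\<^sub>R f" if "f \<bullet> (P *v f) = eigval P 1 * (f \<bullet> f)"
    proof -
      have "eigval P 1 * (f \<bullet> f) \<le> l * (f \<bullet> f)" using that fl by simp
      then have "eigval P 1 = l" using le ff by simp
      then show ?thesis
        using rayleigh_max_eigenvector[OF sym V inv max, of f] that f by (simp add: inner_commute)
    qed
    ultimately show ?thesis using fl by auto
  qed simp
  show "f \<bullet> (P *v f) \<le> eigval P 1 * (f \<bullet> f)"
    and "f \<bullet> (P *v f) = eigval P 1 * (f \<bullet> f) \<Longrightarrow> P *v f = eigval P 1 *\<^sub>R f"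
    using * by auto
qed

section \<open>Analytic solutions of cubic equations\<close>

lemma has_sum_fibres:
  fixes F :: "'i \<Rightarrow> real"
  assumes "(F has_sum a) I"
  shows "((\<lambda>x. infsum F {i \<in> I. g i = x}) has_sum a) UNIV"
proof (rule has_sum_Sigma'[where f = "\<lambda>(x, i). F i" and B = "\<lambda>x. {i \<in> I. g i = x}"])
  have "Sigma UNIV (\<lambda>x. {i \<in> I. g i = x}) = (\<lambda>i. (g i, i)) ` I" by auto
  moreover have "inj_on (\<lambda>i. (g i, i)) I" by (auto simp: inj_on_def)
  ultimately show "((\<lambda>(x, i). F i) has_sum a) (Sigma UNIV (\<lambda>x. {i \<in> I. g i = x}))"
    using assms by (simp add: has_sum_reindex o_def)
  show "((\<lambda>y. case (x, y) of (x, i) \<Rightarrow> F i) has_sum infsum F {i \<in> I. g i = x}) {i \<in> I. g i = x}" for x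
    using has_sum_imp_summable[OF assms] by (auto intro!: has_sum_infsum intro: summable_on_subset_banach)
qed

text \<open>Absolutely convergent double power series on the polydisc of radius \<open>r\<close>, with \<open>\<ell>\<^sup>1\<close>-norm
  at most \<open>C\<close>. These form a Banach algebra, in which the fixed point equation for the root of the
  characteristic polynomial is solved below.\<close>

definition power_bounded :: "real \<Rightarrow> real \<Rightarrow> (real \<Rightarrow> real \<Rightarrow> real) \<Rightarrow> bool" where
  "power_bounded r C f \<longleftrightarrow>
     (\<exists>c S. ((\<lambda>x. \<bar>c x\<bar> * r ^ (fst x + snd x)) has_sum S) UNIV \<and> S \<le> C \<and>
        (\<forall>h k. \<bar>h\<bar> \<le> r \<longrightarrow> \<bar>k\<bar> \<le> r \<longrightarrow>
           ((\<lambda>x :: nat \<times> nat. c x * h ^ fst x * k ^ snd x) has_sum f h k) UNIV))"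

text \<open>Monomials may be indexed by any set and may repeat. Collecting equal ones adds their
  coefficients, which cannot increase the norm. Infinite sums and products of series arise in this
  redundant form.\<close>

lemma power_boundedI:
  fixes \<alpha> :: "'i \<Rightarrow> real" and p q :: "'i \<Rightarrow> nat"
  assumes r: "0 < r" and abs: "((\<lambda>i. \<bar>\<alpha> i\<bar> * r ^ (p i + q i)) has_sum S) I" and S: "S \<le> C"
    and f: "\<And>h k. \<bar>h\<bar> \<le> r \<Longrightarrow> \<bar>k\<bar> \<le> r \<Longrightarrow> ((\<lambda>i. \<alpha> i * h ^ p i * k ^ q i) has_sum f h k) I"
  shows "power_bounded r C f"
proof -
  define fib where "fib x = {i \<in> I. (p i, q i) = x}" for x
  define c where "c x = infsum \<alpha> (fib x)" for x
  define d where "d x = infsum (\<lambda>i. \<bar>\<alpha> i\<bar> * r ^ (p i + q i)) (fib x)" for x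
  have d: "(d has_sum S) UNIV"
    unfolding d_def fib_def by (rule has_sum_fibres[OF abs])
  have le: "\<bar>c x\<bar> * r ^ (fst x + snd x) \<le> d x" for x
  proof -
    have "(\<lambda>i. \<bar>\<alpha> i\<bar> * r ^ (p i + q i)) summable_on fib x"
      using has_sum_imp_summable[OF abs] by (rule summable_on_subset_banach) (auto simp: fib_def)
    then have "(\<lambda>i. norm (\<alpha> i * r ^ (p i + q i))) summable_on fib x"
      using r by (simp add: abs_mult)
    then have "norm (infsum (\<lambda>i. \<alpha> i * r ^ (p i + q i)) (fib x))
        \<le> infsum (\<lambda>i. norm (\<alpha> i * r ^ (p i + q i))) (fib x)"
      by (rule norm_infsum_bound)
    also have "\<dots> = d x" using r by (simp add: d_def abs_mult)
    also have "infsum (\<lambda>i. \<alpha> i * r ^ (p i + q i)) (fib x) = infsum (\<lambda>i. \<alpha> i * r ^ (fst x + snd x)) (fib x)"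
      by (rule infsum_cong) (auto simp: fib_def)
    also have "\<dots> = c x * r ^ (fst x + snd x)"
      unfolding c_def by (rule infsum_cmult_left')
    finally show ?thesis using r by (simp add: abs_mult)
  qed
  have "(\<lambda>x. norm (c x * r ^ (fst x + snd x))) summable_on UNIV"
    using r le by (intro Infinite_Sum.abs_summable_on_comparison_test'[OF has_sum_imp_summable[OF d]])
      (simp add: abs_mult)
  then have "(\<lambda>x. \<bar>c x\<bar> * r ^ (fst x + snd x)) summable_on UNIV"
    using r by (simp add: abs_mult)
  then obtain S' where S': "((\<lambda>x. \<bar>c x\<bar> * r ^ (fst x + snd x)) has_sum S') UNIV"
    by (auto simp: summable_on_def)
  have "S' \<le> S" by (rule has_sum_mono[OF S' d]) (simp add: le)
  moreover have "((\<lambda>x. c x * h ^ fst x * k ^ snd x) has_sum f h k) UNIV" if "\<bar>h\<bar> \<le> r" "\<bar>k\<bar> \<le> r" for h k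
  proof -
    have "((\<lambda>x. infsum (\<lambda>i. \<alpha> i * h ^ p i * k ^ q i) (fib x)) has_sum f h k) UNIV"
      unfolding fib_def by (rule has_sum_fibres[OF f[OF that]])
    moreover have "infsum (\<lambda>i. \<alpha> i * h ^ p i * k ^ q i) (fib x) = c x * h ^ fst x * k ^ snd x" for x
    proof -
      have "infsum (\<lambda>i. \<alpha> i * h ^ p i * k ^ q i) (fib x) = infsum (\<lambda>i. \<alpha> i * (h ^ fst x * k ^ snd x)) (fib x)"
        by (rule infsum_cong) (auto simp: fib_def)
      also have "\<dots> = c x * (h ^ fst x * k ^ snd x)"
        unfolding c_def by (rule infsum_cmult_left')
      finally show ?thesis by simp
    qed
    ultimately show ?thesis by simp
  qed
  ultimately show ?thesis
    unfolding power_bounded_def using S' S by (intro exI[of _ c] exI[of _ S']) auto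
qed

lemma power_bounded_imp_bound:
  assumes "power_bounded r C f" "\<bar>h\<bar> \<le> r" "\<bar>k\<bar> \<le> r"
  shows "\<bar>f h k\<bar> \<le> C"
proof -
  obtain c S where c: "((\<lambda>x. \<bar>c x\<bar> * r ^ (fst x + snd x)) has_sum S) UNIV" "S \<le> C"
    "((\<lambda>x :: nat \<times> nat. c x * h ^ fst x * k ^ snd x) has_sum f h k) UNIV"
    using assms by (auto simp: power_bounded_def)
  have le: "norm (c x * h ^ fst x * k ^ snd x) \<le> \<bar>c x\<bar> * r ^ (fst x + snd x)" for x
    using assms(2,3) by (auto simp: abs_mult power_abs power_add mult.assoc
        intro!: mult_left_mono mult_mono power_mono)
  have "(\<lambda>x. norm (c x * h ^ fst x * k ^ snd x)) summable_on UNIV"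
    by (rule Infinite_Sum.abs_summable_on_comparison_test'[OF has_sum_imp_summable[OF c(1)] le])
  then obtain T where T: "((\<lambda>x. norm (c x * h ^ fst x * k ^ snd x)) has_sum T) UNIV"
    by (auto simp: summable_on_def)
  have "norm (f h k) \<le> T" by (rule norm_has_sum_bound[OF T c(3)])
  also have "T \<le> S" by (rule has_sum_mono[OF T c(1)]) (rule le)
  finally show ?thesis using c(2) by simp
qed

lemma power_bounded_nonneg: "power_bounded r C f \<Longrightarrow> 0 < r \<Longrightarrow> 0 \<le> C"
  using power_bounded_imp_bound[of r C f 0 0] by simp

lemma power_bounded_mono: "power_bounded r C f \<Longrightarrow> C \<le> D \<Longrightarrow> power_bounded r D f"
  by (fastforce simp: power_bounded_def)

lemma power_bounded_monom:
  assumes "0 < r" shows "power_bounded r (\<bar>a\<bar> * r ^ (m + n)) (\<lambda>h k. a * h ^ m * k ^ n)"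
  by (rule power_boundedI[where I = "{()}" and \<alpha> = "\<lambda>_. a" and p = "\<lambda>_. m" and q = "\<lambda>_. n", OF assms _ order_refl])
    (auto intro!: has_sum_finiteI)

text \<open>Completeness of the algebra. The sum of two elements is the case of the index type
  \<open>bool\<close>.\<close>

lemma power_bounded_infsum:
  fixes F :: "'i \<Rightarrow> real \<Rightarrow> real \<Rightarrow> real"
  assumes r: "0 < r" and F: "\<And>n. power_bounded r (B n) (F n)" and B: "(B has_sum C) UNIV"
    and f: "\<And>h k. \<bar>h\<bar> \<le> r \<Longrightarrow> \<bar>k\<bar> \<le> r \<Longrightarrow> ((\<lambda>n. F n h k) has_sum f h k) UNIV"
  shows "power_bounded r C f"
proof -
  let ?P = "\<lambda>n c S. ((\<lambda>x. \<bar>c x\<bar> * r ^ (fst x + snd x)) has_sum S) UNIV \<and> S \<le> B n \<and>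
    (\<forall>h k. \<bar>h\<bar> \<le> r \<longrightarrow> \<bar>k\<bar> \<le> r \<longrightarrow>
       ((\<lambda>x :: nat \<times> nat. c x * h ^ fst x * k ^ snd x) has_sum F n h k) UNIV)"
  have "\<forall>n. \<exists>c S. ?P n c S" using F unfolding power_bounded_def by blast
  from choice[OF this] obtain c where "\<forall>n. \<exists>S. ?P n (c n) S" ..
  from choice[OF this] obtain S where "\<forall>n. ?P n (c n) (S n)" ..
  then have c: "\<And>n. ((\<lambda>x. \<bar>c n x\<bar> * r ^ (fst x + snd x)) has_sum S n) UNIV" "\<And>n. S n \<le> B n"
    "\<And>n h k. \<bar>h\<bar> \<le> r \<Longrightarrow> \<bar>k\<bar> \<le> r \<Longrightarrow>
       ((\<lambda>x :: nat \<times> nat. c n x * h ^ fst x * k ^ snd x) has_sum F n h k) UNIV"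
    by blast+
  have S0: "0 \<le> S n" for n using c(1)[of n] by (rule has_sum_nonneg) (use r in auto)
  have "(\<lambda>n. norm (S n)) summable_on UNIV"
    by (rule Infinite_Sum.abs_summable_on_comparison_test'[OF has_sum_imp_summable[OF B]]) (use S0 c(2) in auto)
  then have "S summable_on UNIV" using S0 by simp
  then obtain T where T: "(S has_sum T) UNIV" by (auto simp: summable_on_def)
  have TC: "T \<le> C" by (rule has_sum_mono[OF T B]) (rule c(2))
  define A where "A = (\<lambda>y :: 'i \<times> (nat \<times> nat). \<bar>c (fst y) (snd y)\<bar> * r ^ (fst (snd y) + snd (snd y)))"
  have inner: "((\<lambda>z. A (x, z)) has_sum S x) UNIV" for x
    using c(1)[of x] by (simp add: A_def)
  have "A summable_on (Sigma UNIV (\<lambda>_. UNIV))"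
    by (rule summable_on_SigmaI[OF inner \<open>S summable_on UNIV\<close>]) (use r in \<open>simp add: A_def\<close>)
  then have A: "(A has_sum T) (Sigma UNIV (\<lambda>_. UNIV))"
    by (rule has_sum_SigmaI[OF inner T])
  show ?thesis
  proof (rule power_boundedI[OF r _ TC])
    show "((\<lambda>y. \<bar>c (fst y) (snd y)\<bar> * r ^ (fst (snd y) + snd (snd y))) has_sum T) (Sigma UNIV (\<lambda>_. UNIV))"
      using A by (simp add: A_def)
    fix h k :: real assume hk: "\<bar>h\<bar> \<le> r" "\<bar>k\<bar> \<le> r"
    let ?G = "\<lambda>y. c (fst y) (snd y) * h ^ fst (snd y) * k ^ snd (snd y)"
    have "norm (?G y) \<le> A y" for y
      using hk by (auto simp: A_def abs_mult power_abs power_add mult.assoc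
          intro!: mult_left_mono mult_mono power_mono)
    then have "(\<lambda>y. norm (?G y)) summable_on (Sigma UNIV (\<lambda>_. UNIV))"
      by (intro Infinite_Sum.abs_summable_on_comparison_test'[OF has_sum_imp_summable[OF A]])
    then have "?G summable_on (Sigma UNIV (\<lambda>_. UNIV))" by (rule abs_summable_summable)
    then show "(?G has_sum f h k) (Sigma UNIV (\<lambda>_. UNIV))"
      by (intro has_sum_SigmaI[OF _ f[OF hk]]) (simp_all add: c(3) hk)
  qed
qed

lemma power_bounded_add:
  assumes "0 < r" "power_bounded r C f" "power_bounded r D g"
  shows "power_bounded r (C + D) (\<lambda>h k. f h k + g h k)"
  by (rule power_bounded_infsum[where F = "\<lambda>b. if b then f else g" and B = "\<lambda>b. if b then C else D"])
    (use assms in \<open>auto intro!: has_sum_finiteI simp: UNIV_bool\<close>)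

lemma power_bounded_mult:
  assumes r: "0 < r" and f: "power_bounded r C f" and g: "power_bounded r D g"
  shows "power_bounded r (C * D) (\<lambda>h k. f h k * g h k)"
proof -
  obtain c S where c: "((\<lambda>x. \<bar>c x\<bar> * r ^ (fst x + snd x)) has_sum S) UNIV" "S \<le> C"
    "\<And>h k. \<bar>h\<bar> \<le> r \<Longrightarrow> \<bar>k\<bar> \<le> r \<Longrightarrow>
       ((\<lambda>x :: nat \<times> nat. c x * h ^ fst x * k ^ snd x) has_sum f h k) UNIV"
    using f by (auto simp: power_bounded_def)
  obtain d T where d: "((\<lambda>x. \<bar>d x\<bar> * r ^ (fst x + snd x)) has_sum T) UNIV" "T \<le> D"
    "\<And>h k. \<bar>h\<bar> \<le> r \<Longrightarrow> \<bar>k\<bar> \<le> r \<Longrightarrow>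
       ((\<lambda>x :: nat \<times> nat. d x * h ^ fst x * k ^ snd x) has_sum g h k) UNIV"
    using g by (auto simp: power_bounded_def)
  have "0 \<le> S" by (rule has_sum_nonneg[OF c(1)]) (use r in auto)
  moreover have "0 \<le> T" by (rule has_sum_nonneg[OF d(1)]) (use r in auto)
  ultimately have ST: "S * T \<le> C * D" using c(2) d(2) by (intro mult_mono) auto
  let ?I = "Sigma (UNIV :: (nat \<times> nat) set) (\<lambda>_. UNIV :: (nat \<times> nat) set)"
  let ?A = "\<lambda>y. \<bar>c (fst y) * d (snd y)\<bar> * r ^ ((fst (fst y) + fst (snd y)) + (snd (fst y) + snd (snd y)))"
  have inner: "((\<lambda>z. ?A (x, z)) has_sum (\<bar>c x\<bar> * r ^ (fst x + snd x)) * T) UNIV" for x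
    using has_sum_cmult_right[OF d(1), of "\<bar>c x\<bar> * r ^ (fst x + snd x)"]
    by (simp add: abs_mult power_add mult.assoc mult.left_commute)
  have outer: "((\<lambda>x. (\<bar>c x\<bar> * r ^ (fst x + snd x)) * T) has_sum S * T) UNIV"
    by (rule has_sum_cmult_left[OF c(1)])
  have summable: "?A summable_on ?I"
    by (rule summable_on_SigmaI[OF inner has_sum_imp_summable[OF outer]]) (use r in auto)
  have A: "(?A has_sum S * T) ?I"
    by (rule has_sum_SigmaI[OF inner outer summable])
  show ?thesis
  proof (rule power_boundedI[OF r A ST])
    fix h k :: real assume hk: "\<bar>h\<bar> \<le> r" "\<bar>k\<bar> \<le> r"
    let ?G = "\<lambda>y. c (fst y) * d (snd y) * h ^ (fst (fst y) + fst (snd y)) * k ^ (snd (fst y) + snd (snd y))"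
    have "norm (?G y) \<le> ?A y" for y
      using hk by (auto simp: abs_mult power_abs power_add[of _ "fst (fst y) + fst (snd y)"] mult.assoc
          intro!: mult_left_mono mult_mono power_mono)
    then have "(\<lambda>y. norm (?G y)) summable_on ?I"
      by (intro Infinite_Sum.abs_summable_on_comparison_test'[OF summable])
    then have s: "?G summable_on ?I" by (rule abs_summable_summable)
    show "(?G has_sum f h k * g h k) ?I"
    proof (rule has_sum_SigmaI[OF _ _ s])
      show "((\<lambda>z. ?G (x, z)) has_sum (c x * h ^ fst x * k ^ snd x) * g h k) UNIV" for x
        using has_sum_cmult_right[OF d(3)[OF hk], of "c x * h ^ fst x * k ^ snd x"]
        by (simp add: power_add algebra_simps)
      show "((\<lambda>x. (c x * h ^ fst x * k ^ snd x) * g h k) has_sum f h k * g h k) UNIV"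
        by (rule has_sum_cmult_left[OF c(3)[OF hk]])
    qed
  qed
qed

text \<open>On a smaller polydisc a series without constant term gains the factor \<open>s\<close>,
  as each of its monomials has degree at least one.\<close>

lemma power_bounded_shrink:
  assumes r: "0 < r" and f: "power_bounded r C f" and s: "0 < s" "s \<le> 1"
  shows "power_bounded (s * r) C f"
    and "f 0 0 = 0 \<Longrightarrow> power_bounded (s * r) (s * C) f"
proof -
  obtain c S where c: "((\<lambda>x. \<bar>c x\<bar> * r ^ (fst x + snd x)) has_sum S) UNIV" "S \<le> C"
    "\<And>h k. \<bar>h\<bar> \<le> r \<Longrightarrow> \<bar>k\<bar> \<le> r \<Longrightarrow>
       ((\<lambda>x :: nat \<times> nat. c x * h ^ fst x * k ^ snd x) has_sum f h k) UNIV"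
    using f by (auto simp: power_bounded_def)
  have sr: "s * r \<le> r" "0 < s * r" using r s by auto
  have *: "power_bounded (s * r) (t * C) f"
    if t: "0 \<le> t" "\<And>x. \<bar>c x\<bar> * (s * r) ^ (fst x + snd x) \<le> t * (\<bar>c x\<bar> * r ^ (fst x + snd x))" for t
  proof -
    have tS: "((\<lambda>x. t * (\<bar>c x\<bar> * r ^ (fst x + snd x))) has_sum t * S) UNIV"
      by (rule has_sum_cmult_right[OF c(1)])
    have "(\<lambda>x. norm (\<bar>c x\<bar> * (s * r) ^ (fst x + snd x))) summable_on UNIV"
      by (rule Infinite_Sum.abs_summable_on_comparison_test'[OF has_sum_imp_summable[OF tS]]) (use r s t in auto)
    then have "(\<lambda>x. \<bar>c x\<bar> * (s * r) ^ (fst x + snd x)) summable_on UNIV"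
      by (rule abs_summable_summable)
    then obtain S' where S': "((\<lambda>x. \<bar>c x\<bar> * (s * r) ^ (fst x + snd x)) has_sum S') UNIV"
      by (auto simp: summable_on_def)
    have "S' \<le> t * S" by (rule has_sum_mono[OF S' tS]) (rule t)
    also have "\<dots> \<le> t * C" using t c(2) by (intro mult_left_mono)
    finally show ?thesis
      unfolding power_bounded_def using S' c(3) sr by (intro exI[of _ c] exI[of _ S']) auto
  qed
  have p: "(s * r) ^ n \<le> r ^ n" for n using sr by (intro power_mono) auto
  show "power_bounded (s * r) C f" using *[of 1] p by (simp add: mult_left_mono)
  assume "f 0 0 = 0"
  have "c (0, 0) = 0"
  proof -
    have "((\<lambda>x. c x * 0 ^ fst x * 0 ^ snd x) has_sum f 0 0) UNIV" using c(3)[of 0 0] r by simp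
    moreover have "((\<lambda>x. c x * 0 ^ fst x * 0 ^ snd x) has_sum c (0, 0)) {(0, 0)}"
      by (rule has_sum_finiteI) auto
    then have "((\<lambda>x. c x * 0 ^ fst x * 0 ^ snd x) has_sum c (0, 0)) UNIV"
      by (rule iffD1[OF has_sum_cong_neutral, rotated -1]) (auto simp: power_0_left split: if_splits)
    ultimately show ?thesis using \<open>f 0 0 = 0\<close> has_sum_unique by fastforce
  qed
  have "\<bar>c x\<bar> * (s * r) ^ (fst x + snd x) \<le> s * (\<bar>c x\<bar> * r ^ (fst x + snd x))" for x
  proof (cases "fst x + snd x")
    case 0
    then have "x = (0, 0)" by (simp add: prod_eq_iff)
    then show ?thesis using \<open>c (0, 0) = 0\<close> by simp
  next
    case (Suc n)
    have "(s * r) ^ Suc n \<le> s * r ^ Suc n"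
      using p[of n] r s by (simp add: mult.assoc mult_left_mono)
    then have "\<bar>c x\<bar> * (s * r) ^ Suc n \<le> \<bar>c x\<bar> * (s * r ^ Suc n)" by (intro mult_left_mono) auto
    then show ?thesis by (simp add: Suc mult.left_commute)
  qed
  then show "power_bounded (s * r) (s * C) f" using * s by simp
qed

text \<open>Contraction principle in the Banach algebra: \<open>e0\<close> and \<open>e1\<close>
  vanish at the origin and become small on a small polydisc, while the quadratic and cubic terms are
  contracting on a small ball.\<close>

lemma power_series_cubic_root:
  assumes r0: "0 < r0" and e: "power_bounded r0 C e0" "power_bounded r0 C e1" "power_bounded r0 C e2" "power_bounded r0 C e3"
    and e0: "e0 0 0 = 0" "e1 0 0 = 0" and \<rho>: "0 < \<rho>"
  shows "\<exists>r t. 0 < r \<and> power_bounded r \<rho> t \<and> (\<forall>h k. \<bar>h\<bar> \<le> r \<longrightarrow> \<bar>k\<bar> \<le> r \<longrightarrow>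
     t h k = e0 h k + e1 h k * t h k + e2 h k * (t h k)\<^sup>2 + e3 h k * (t h k) ^ 3)"
proof -
  define D where "D = C + 1"
  have D: "1 \<le> D" "C \<le> D" using power_bounded_nonneg[OF e(1) r0] by (auto simp: D_def)
  \<comment> \<open>With \<open>D * \<delta> \<le> 1 / 20\<close> and
    \<open>\<delta> \<le> 1\<close> the Lipschitz bound
    \<open>\<delta> / 4 + 2 * D * \<delta> + 3 * D * \<delta>\<^sup>2\<close> is at most 1/4 + 1/10
    + 3/20 = 1/2.\<close>
  define \<delta> where "\<delta> = min \<rho> (1 / (20 * D))"
  have "1 / (20 * D) \<le> 1" using D by (simp add: field_simps)
  then have \<delta>: "0 < \<delta>" "\<delta> \<le> \<rho>" "\<delta> \<le> 1" "D * \<delta> \<le> 1 / 20"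
  proof -
    show "0 < \<delta>" "\<delta> \<le> \<rho>" using D \<rho> by (auto simp: \<delta>_def)
    show "\<delta> \<le> 1" unfolding \<delta>_def by (rule min.coboundedI2) fact
    have "D * \<delta> \<le> D * (1 / (20 * D))" using D by (intro mult_left_mono) (auto simp: \<delta>_def)
    then show "D * \<delta> \<le> 1 / 20" using D by simp
  qed
  \<comment> \<open>Shrinking by this factor takes the bound on \<open>e0\<close> and
    \<open>e1\<close> from \<open>D\<close> to \<open>\<delta> / 4\<close>.\<close>
  define s where "s = \<delta> / (4 * D)"
  have s: "0 < s" "s * D = \<delta> / 4" using D \<delta> by (auto simp: s_def)
  have s1: "s \<le> 1" using D \<delta> by (simp add: s_def field_simps)
  define r where "r = s * r0"
  have r: "0 < r" using s r0 by (simp add: r_def)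
  note e' = e[THEN power_bounded_mono, OF D(2)]
  have E: "power_bounded r (\<delta> / 4) e0" "power_bounded r (\<delta> / 4) e1" "power_bounded r D e2" "power_bounded r D e3"
    using power_bounded_shrink[OF r0 e'(1) s(1) s1] power_bounded_shrink[OF r0 e'(2) s(1) s1]
      power_bounded_shrink[OF r0 e'(3) s(1) s1] power_bounded_shrink[OF r0 e'(4) s(1) s1] e0 s(2)
    by (auto simp: r_def)
  define G where "G u h k = e0 h k + e1 h k * u h k + e2 h k * (u h k * u h k) + e3 h k * (u h k * (u h k * u h k))" for u h k
  define u where "u n = (G ^^ n) (\<lambda>_ _. 0)" for n
  have u0: "u 0 = (\<lambda>_ _. 0)" and uS: "u (Suc n) = G (u n)" for n by (simp_all add: u_def)
  have dd: "D * (\<delta> * \<delta>) \<le> \<delta> / 20" "D * (\<delta> * (\<delta> * \<delta>)) \<le> \<delta> / 20" "D * (\<delta> * \<delta>) \<le> 1 / 20"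
  proof -
    have "(D * \<delta>) * \<delta> \<le> 1 / 20 * \<delta>" using \<delta> by (intro mult_right_mono) auto
    then show 1: "D * (\<delta> * \<delta>) \<le> \<delta> / 20" by (simp add: mult.assoc)
    have "D * (\<delta> * \<delta>) * \<delta> \<le> D * (\<delta> * \<delta>) * 1" using \<delta> D by (intro mult_left_mono) auto
    then show "D * (\<delta> * (\<delta> * \<delta>)) \<le> \<delta> / 20" using 1 by (simp add: mult.assoc)
    show "D * (\<delta> * \<delta>) \<le> 1 / 20" using 1 \<delta>(3) by linarith
  qed
  have ub: "power_bounded r \<delta> (u n)" for n
  proof (induction n)
    case 0
    show ?case
      using power_bounded_mono[OF power_bounded_monom[OF r, of 0 0 0], of \<delta>] \<delta> by (simp add: u0)
  next
    case (Suc n)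
    note m = power_bounded_mult[OF r]
    have "power_bounded r (\<delta> / 4 + \<delta> / 4 * \<delta> + D * (\<delta> * \<delta>) + D * (\<delta> * (\<delta> * \<delta>))) (G (u n))"
      unfolding G_def by (intro power_bounded_add r m E Suc)
    moreover have "\<delta> / 4 * \<delta> \<le> \<delta> / 4 * 1" using \<delta> by (intro mult_left_mono) auto
    ultimately show ?case unfolding uS
      using dd \<delta> by (elim power_bounded_mono) linarith
  qed
  define v where "v n h k = u (Suc n) h k - u n h k" for n h k
  have vb: "power_bounded r (\<delta> / 4 * (1 / 2) ^ n) (v n)" for n
  proof (induction n)
    case 0
    have "v 0 = e0" by (intro ext) (simp add: v_def uS u0 G_def)
    then show ?case using E(1) by simp
  next
    case (Suc n)
    note m = power_bounded_mult[OF r]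
    \<comment> \<open>The divided difference of the cubic polynomial between consecutive
      iterates.\<close>
    define L where "L h k = e1 h k + e2 h k * (u (Suc n) h k + u n h k) + e3 h k *
      (u (Suc n) h k * u (Suc n) h k + u (Suc n) h k * u n h k + u n h k * u n h k)" for h k
    have "power_bounded r (\<delta> / 4 + D * (\<delta> + \<delta>) + D * (\<delta> * \<delta> + \<delta> * \<delta> + \<delta> * \<delta>)) L"
      unfolding L_def by (intro power_bounded_add r m E ub)
    moreover have "\<delta> / 4 + D * (\<delta> + \<delta>) + D * (\<delta> * \<delta> + \<delta> * \<delta> + \<delta> * \<delta>) \<le> 1 / 2"
      using dd \<delta> by (simp add: distrib_left)
    ultimately have "power_bounded r (1 / 2) L" by (rule power_bounded_mono)
    moreover have "v (Suc n) = (\<lambda>h k. v n h k * L h k)"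
      unfolding v_def uS[of "Suc n"] by (subst (2) uS) (auto simp: L_def G_def algebra_simps)
    ultimately show ?case using m[OF Suc, of "1 / 2" L] by simp
  qed
  \<comment> \<open>The limit of the iterates, written as a telescoping series so that
    \<open>power_bounded_infsum\<close> applies.\<close>
  define t where "t h k = infsum (\<lambda>n. v n h k) UNIV" for h k
  have geo: "(\<lambda>n. \<delta> / 4 * (1 / 2) ^ n) sums (\<delta> / 2)"
    using sums_mult[OF geometric_sums[of "1/2::real"], of "\<delta> / 4"] by simp
  then have B: "((\<lambda>n. \<delta> / 4 * (1 / 2) ^ n) has_sum (\<delta> / 2)) UNIV"
    by (rule sums_nonneg_imp_has_sum) (use \<delta> in auto)
  have vs: "((\<lambda>n. v n h k) has_sum t h k) UNIV" if hk: "\<bar>h\<bar> \<le> r" "\<bar>k\<bar> \<le> r" for h k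
  proof -
    have "(\<lambda>n. norm (v n h k)) summable_on UNIV"
      by (rule Infinite_Sum.abs_summable_on_comparison_test'[OF has_sum_imp_summable[OF B]])
        (use power_bounded_imp_bound[OF vb hk] in auto)
    then show ?thesis unfolding t_def by (rule has_sum_infsum[OF abs_summable_summable])
  qed
  have tb: "power_bounded r \<rho> t"
    by (rule power_bounded_mono[OF power_bounded_infsum[OF r vb B vs]]) (use \<delta> in auto)
  have "t h k = e0 h k + e1 h k * t h k + e2 h k * (t h k)\<^sup>2 + e3 h k * (t h k) ^ 3"
    if hk: "\<bar>h\<bar> \<le> r" "\<bar>k\<bar> \<le> r" for h k
  proof -
    have "(\<lambda>n. v n h k) sums t h k" using vs[OF hk] by (rule has_sum_imp_sums)
    moreover have "(\<Sum>i<n. v i h k) = u n h k" for n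
      by (induction n) (simp_all add: u0 v_def)
    ultimately have lim: "(\<lambda>n. u n h k) \<longlonglongrightarrow> t h k" by (simp add: sums_def)
    have "(\<lambda>n. G (u n) h k) \<longlonglongrightarrow> G t h k"
      unfolding G_def by (intro tendsto_intros lim)
    moreover have "(\<lambda>n. G (u n) h k) \<longlonglongrightarrow> t h k"
      using LIMSEQ_Suc[OF lim] by (simp add: uS)
    ultimately have "t h k = G t h k" using LIMSEQ_unique by blast
    then show ?thesis by (simp add: G_def power2_eq_square power3_eq_cube mult.assoc)
  qed
  then show ?thesis using r tb by blast
qed

lemma real_analytic2_onI:
  assumes "\<And>a b. (a, b) \<in> U \<Longrightarrow> \<exists>r C g. 0 < r \<and> power_bounded r C g \<and>
     (\<forall>h k. \<bar>h\<bar> < r \<longrightarrow> \<bar>k\<bar> < r \<longrightarrow> f (a + h, b + k) = g h k)"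
  shows "real_analytic2_on f U"
  unfolding real_analytic2_on_def
proof clarify
  fix a b assume "(a, b) \<in> U"
  from assms[OF this] obtain r C g where r: "0 < r" and g: "power_bounded r C g"
    and eq: "\<And>h k. \<bar>h\<bar> < r \<Longrightarrow> \<bar>k\<bar> < r \<Longrightarrow> f (a + h, b + k) = g h k" by blast
  obtain c where c: "\<And>h k. \<bar>h\<bar> \<le> r \<Longrightarrow> \<bar>k\<bar> \<le> r \<Longrightarrow>
       ((\<lambda>x :: nat \<times> nat. c x * h ^ fst x * k ^ snd x) has_sum g h k) UNIV"
    using g by (auto simp: power_bounded_def)
  have "((\<lambda>(m, n). c (m, n) * (x - a) ^ m * (y - b) ^ n) has_sum f (x, y)) UNIV"
    if "\<bar>x - a\<bar> < r" "\<bar>y - b\<bar> < r" for x y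
    using c[of "x - a" "y - b"] eq[OF that] that by (simp add: case_prod_beta')
  then show "\<exists>c r. 0 < r \<and> (\<forall>x y. \<bar>x - a\<bar> < r \<longrightarrow> \<bar>y - b\<bar> < r \<longrightarrow>
      ((\<lambda>(m, n). c m n * (x - a) ^ m * (y - b) ^ n) has_sum f (x, y)) UNIV)"
    using r by (intro exI[of _ "\<lambda>m n. c (m, n)"] exI[of _ r]) auto
qed

section \<open>Integer coordinates for the vertices\<close>

type_synonym golden_int = "int \<times> int"

definition gval :: "golden_int \<Rightarrow> real" where
  "gval a = of_int (fst a) + of_int (snd a) * golden_ratio"

definition gadd :: "golden_int \<Rightarrow> golden_int \<Rightarrow> golden_int" where
  "gadd a b = (fst a + fst b, snd a + snd b)"

definition gneg :: "golden_int \<Rightarrow> golden_int" where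
  "gneg a = (- fst a, - snd a)"

definition gphi :: "golden_int \<Rightarrow> golden_int" where
  "gphi a = (snd a, fst a + snd a)"

definition ghalf :: "golden_int \<Rightarrow> golden_int" where
  "ghalf a = (fst a div 2, snd a div 2)"

definition geven :: "golden_int \<Rightarrow> bool" where
  "geven a \<longleftrightarrow> fst a mod 2 = 0 \<and> snd a mod 2 = 0"

text \<open>The last two disjuncts are decided by the norm \<open>a\<^sup>2 + a b - b\<^sup>2\<close> of \<open>a + b \<phi>\<close>.\<close>

definition gnonneg :: "golden_int \<Rightarrow> bool" where
  "gnonneg x \<longleftrightarrow> (case x of (a, b) \<Rightarrow> 0 \<le> a \<and> 0 \<le> b
     \<or> a \<le> 0 \<and> 0 \<le> b \<and> a * a + a * b - b * b \<le> 0 \<or> 0 \<le> a \<and> b \<le> 0 \<and> 0 \<le> a * a + a * b - b * b)"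

lemma gval_add [simp]: "gval (gadd a b) = gval a + gval b"
  by (simp add: gval_def gadd_def algebra_simps)

lemma gval_neg [simp]: "gval (gneg a) = - gval a"
  by (simp add: gval_def gneg_def)

lemma gval_phi [simp]: "gval (gphi a) = golden_ratio * gval a"
proof -
  have "golden_ratio * gval a = of_int (fst a) * golden_ratio + of_int (snd a) * (golden_ratio * golden_ratio)"
    by (simp add: gval_def algebra_simps)
  then show ?thesis
    unfolding golden_ratio_props(1) by (simp add: gval_def gphi_def algebra_simps)
qed

lemma gval_half [simp]: "geven a \<Longrightarrow> gval (ghalf a) = gval a / 2"
  by (auto simp: gval_def ghalf_def geven_def elim!: evenE simp flip: even_iff_mod_2_eq_zero)

text \<open>The second factor is the Galois conjugate, since \<open>1 - golden_ratio\<close> is the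
  other root of the quadratic equation of \<open>golden_ratio\<close>.\<close>

lemma gval_norm:
  "gval (a, b) * (of_int a + of_int b * (1 - golden_ratio)) = of_int (a * a + a * b - b * b)"
proof -
  have "gval (a, b) * (of_int a + of_int b * (1 - golden_ratio)) = of_int a * of_int a + of_int a * of_int b
     + of_int b * of_int b * (golden_ratio - golden_ratio * golden_ratio)"
    by (simp add: gval_def algebra_simps)
  then show ?thesis by (simp add: golden_ratio_props)
qed

lemma gnonneg_sound:
  assumes "gnonneg x" shows "0 \<le> gval x"
proof -
  obtain a b where x: "x = (a, b)" by fastforce
  let ?c = "of_int a + of_int b * (1 - golden_ratio) :: real"
  note g = golden_ratio_props(3,4)
  consider "0 \<le> a" "0 \<le> b" | "a \<le> 0" "0 \<le> b" "a * a + a * b - b * b \<le> 0"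
    | "0 \<le> a" "b \<le> 0" "0 \<le> a * a + a * b - b * b"
    using assms by (auto simp: gnonneg_def x)
  then show ?thesis
  proof cases
    case 1 then show ?thesis using g by (simp add: gval_def x)
  next
    case 2
    then have "of_int b * (1 - golden_ratio) \<le> 0" using g by (simp add: mult_le_0_iff)
    then have c: "?c \<le> 0" using 2 by (metis add_nonpos_nonpos of_int_le_0_iff)
    have "gval (a, b) * ?c \<le> 0" unfolding gval_norm using 2 by linarith
    then have "0 \<le> gval (a, b) \<or> ?c = 0" using c by (auto simp: mult_le_0_iff)
    moreover have "a = 0 \<and> b = 0" if "?c = 0"
      using that 2 g \<open>of_int b * (1 - golden_ratio) \<le> 0\<close>
      by (smt (verit) mult_eq_0_iff of_int_0_eq_iff of_int_le_0_iff)
    ultimately show ?thesis by (auto simp: x gval_def)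
  next
    case 3
    then have "0 \<le> of_int b * (1 - golden_ratio)" using g by (simp add: zero_le_mult_iff)
    then have c: "0 \<le> ?c" using 3 by (metis add_nonneg_nonneg of_int_0_le_iff)
    have "0 \<le> gval (a, b) * ?c" unfolding gval_norm using 3 by linarith
    then have "0 \<le> gval (a, b) \<or> ?c = 0" using c by (auto simp: zero_le_mult_iff)
    moreover have "a = 0 \<and> b = 0" if "?c = 0"
      using that 3 g \<open>0 \<le> of_int b * (1 - golden_ratio)\<close>
      by (smt (verit) mult_eq_0_iff of_int_0_eq_iff of_int_0_le_iff)
    ultimately show ?thesis by (auto simp: x gval_def)
  qed
qed

text \<open>If \<open>b\<close> were nonzero, the exponent of 5 would be even on the left and odd on
  the right.\<close>

lemma five_mul_square_not_square:
  fixes b c :: int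
  assumes "c * c = 5 * (b * b)" shows "b = 0"
proof (rule ccontr)
  assume b: "b \<noteq> 0"
  then have c: "c \<noteq> 0" using assms by auto
  have p: "prime_elem (5::int)" by (intro prime_imp_prime_elem) (simp add: prime_int_numeral_eq)
  have "multiplicity 5 (c * c) = 2 * multiplicity 5 c"
    using prime_elem_multiplicity_mult_distrib[OF p c c] by simp
  moreover have "multiplicity 5 (5 * (b * b)) = Suc (2 * multiplicity 5 b)"
    using prime_elem_multiplicity_mult_distrib[OF p, of 5 "b * b"]
      prime_elem_multiplicity_mult_distrib[OF p b b] b p by simp
  ultimately have "2 * multiplicity 5 c = Suc (2 * multiplicity 5 b)" using assms by simp
  then show False by presburger
qed

text \<open>Four times the norm of x + y phi is (2 x + y)^2 - 5 y^2. It follows that equality of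
  vertices can be decided on integer coordinates.\<close>

lemma gval_eq_0: "gval a = 0 \<longleftrightarrow> a = (0, 0)"
proof
  obtain x y where a: "a = (x, y)" by fastforce
  assume "gval a = 0"
  then have "real_of_int (x * x + x * y - y * y) = 0" using gval_norm[of x y] by (simp add: a)
  then have N: "x * x + x * y - y * y = 0" by linarith
  then have "(2 * x + y) * (2 * x + y) = 5 * (y * y)" by (simp add: algebra_simps)
  then have "y = 0" by (rule five_mul_square_not_square)
  then show "a = (0, 0)" using N by (simp add: a)
qed (simp add: gval_def)

lemma gval_eq: "gval a = gval b \<longleftrightarrow> a = b"
proof -
  have "gval a = gval b \<longleftrightarrow> gval (gadd a (gneg b)) = 0" by simp
  also have "\<dots> \<longleftrightarrow> a = b" unfolding gval_eq_0 by (auto simp: gadd_def gneg_def prod_eq_iff)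
  finally show ?thesis .
qed

type_synonym golden_vec = "golden_int \<times> golden_int \<times> golden_int"

definition gvec :: "golden_vec \<Rightarrow> real^3" where
  "gvec v = (case v of (a, b, c) \<Rightarrow> vector [gval a, gval b, gval c])"

lemma gvec_nth [simp]:
  "gvec (a, b, c) $ 1 = gval a" "gvec (a, b, c) $ 2 = gval b" "gvec (a, b, c) $ 3 = gval c"
  by (simp_all add: gvec_def)

lemma gvec_eq: "gvec v = gvec w \<longleftrightarrow> v = w"
  by (cases v; cases w) (simp add: vec_eq_iff forall_3 gval_eq)

definition signed_cyclic_list :: "golden_int \<Rightarrow> golden_int \<Rightarrow> golden_int \<Rightarrow> golden_vec list" where
  "signed_cyclic_list a b c =
     concat (map (\<lambda>a'. concat (map (\<lambda>b'. concat (map (\<lambda>c'.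
       [(a', b', c'), (b', c', a'), (c', a', b')])
       [c, gneg c])) [b, gneg b])) [a, gneg a])"

definition vertex_list :: "golden_vec list" where
  "vertex_list =
       signed_cyclic_list (-1, 1) (-1, 1) (3, 1)
     @ signed_cyclic_list (-2, 2) (0, 1) (1, 2)
     @ signed_cyclic_list (-1, 1) (1, 1) (-1, 3)
     @ signed_cyclic_list (-1, 2) (2, 0) (2, 1)
     @ signed_cyclic_list (0, 1) (3, 0) (0, 2)"

lemma signed_cyclic_list:
  "signed_cyclic (gval a) (gval b) (gval c) = gvec ` set (signed_cyclic_list a b c)"
proof -
  have pm: "{gval x, - gval x} = gval ` set [x, gneg x]" for x by simp
  show ?thesis
    unfolding signed_cyclic_def signed_cyclic_list_def pm
    by (simp only: set_concat set_map image_Union image_UN image_image list.set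
        image_insert image_empty gvec_def prod.case)
qed

lemma solid_points_eq: "solid_points = gvec ` set vertex_list"
proof -
  have "gval (-1, 1) = 1 / golden_ratio" "gval (-2, 2) = 2 / golden_ratio"
    "gval (1, 1) = golden_ratio\<^sup>2" "gval (-1, 2) = 2 * golden_ratio - 1" 
    "gval (-1, 3) = 3 * golden_ratio - 1" "gval (3, 1) = 3 + golden_ratio"
    "gval (0, 1) = golden_ratio" "gval (1, 2) = 1 + 2 * golden_ratio"
    "gval (2, 0) = 2" "gval (2, 1) = 2 + golden_ratio" "gval (3, 0) = 3" "gval (0, 2) = 2 * golden_ratio"
    using golden_ratio_props(2,3,5) by (simp_all add: gval_def field_simps)
  then show ?thesis
    unfolding solid_points_def Let_def vertex_list_def set_append image_Un
    by (simp only: Un_assoc flip: signed_cyclic_list)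
qed

text \<open>The reflection in \<open>simple_root Kz\<close> below: \<open>t\<close> is the inner
  product with this root, and \<open>greflectable\<close> says that its halving is exact.\<close>

definition greflect :: "golden_vec \<Rightarrow> golden_vec" where
  "greflect v = (case v of (a, b, c) \<Rightarrow>
     (let t = ghalf (gadd (gneg (gadd a (gphi b))) (gadd (gphi c) (gneg c)))
      in (gadd a t, gadd b (gphi t), gadd c (gadd t (gneg (gphi t))))))"

definition greflectable :: "golden_vec \<Rightarrow> bool" where
  "greflectable v = (case v of (a, b, c) \<Rightarrow>
     geven (gadd (gneg (gadd a (gphi b))) (gadd (gphi c) (gneg c))))"

lemma greflect_vertex_list:
  "list_all (\<lambda>v. greflectable v \<and> List.member vertex_list (greflect v)) vertex_list"
  by code_simp

text \<open>Inner products with the vectors \<open>weight\<close> below, the third one divided by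
  \<open>2 * golden_ratio\<close> so that it has integer coordinates.\<close>

definition gweight :: "nat \<Rightarrow> golden_vec \<Rightarrow> golden_int" where
  "gweight k v = (case v of (a, b, c) \<Rightarrow>
     if k = 0 then gadd a (gphi c) else if k = 1 then gadd b (gphi (gphi c)) else c)"

lemma gweight_max:
  "list_all (\<lambda>v. list_all (\<lambda>k. gnonneg (gadd (gweight k ((-1, 1), (-1, 1), (3, 1))) (gneg (gweight k v)))) [0, 1, 2])
     vertex_list"
  by code_simp

lemma distinct_vertex_list: "distinct vertex_list"
  by code_simp

text \<open>The numbers of vertices of the decagon, the hexagon and the square at the vertex
  \<open>rho\<close>.\<close>

lemma gweight_max_count:
  "map (\<lambda>k. length (filter (\<lambda>v. gweight k v = gweight k ((-1, 1), (-1, 1), (3, 1))) vertex_list)) [0, 1, 2]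
     = [10, 6, 4]"
  by code_simp

section \<open>Simple roots and the vertex set\<close>

datatype kind = Kx | Ky | Kz

lemma UNIV_kind: "UNIV = {Kx, Ky, Kz}"
  using kind.exhaust by auto

lemma ex_kind: "(\<exists>k. Q k) \<longleftrightarrow> Q Kx \<or> Q Ky \<or> Q Kz"
  by (metis kind.exhaust)

instance kind :: finite
  by standard (simp add: UNIV_kind)

fun simple_root :: "kind \<Rightarrow> real^3" where
  "simple_root Kx = vector [1, 0, 0]"
| "simple_root Ky = vector [0, 1, 0]"
| "simple_root Kz = vector [- 1 / 2, - golden_ratio / 2, (golden_ratio - 1) / 2]"

text \<open>The basis dual to the simple roots, see \<open>weight_root\<close>. These are the outer
  normals of the three facets at \<open>rho\<close>.\<close>

fun weight :: "kind \<Rightarrow> real^3" where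
  "weight Kx = vector [1, 0, golden_ratio]"
| "weight Ky = vector [0, 1, golden_ratio + 1]"
| "weight Kz = vector [0, 0, 2 * golden_ratio]"

text \<open>The negated Gram matrix of the simple roots: off the diagonal cos (pi / n), where n = 2,
  3, 5 is the order of the product of the two reflections.\<close>

fun bond :: "kind \<Rightarrow> kind \<Rightarrow> real" where
  "bond Kx Kz = 1 / 2" | "bond Kz Kx = 1 / 2"
| "bond Ky Kz = golden_ratio / 2" | "bond Kz Ky = golden_ratio / 2"
| "bond Kx Ky = 0" | "bond Ky Kx = 0"
| "bond Kx Kx = - 1" | "bond Ky Ky = - 1" | "bond Kz Kz = - 1"

lemmas root_coords = simple_root.simps weight.simps
declare root_coords [simp del]

definition rho :: "real^3" where
  "rho = vector [golden_ratio - 1, golden_ratio - 1, 3 + golden_ratio]"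

lemma inner_3: "(a::real^3) \<bullet> b = a $ 1 * b $ 1 + a $ 2 * b $ 2 + a $ 3 * b $ 3"
  by (simp add: inner_vec_def sum_3)

lemma vec_eq_3: "(a::real^3) = b \<longleftrightarrow> a $ 1 = b $ 1 \<and> a $ 2 = b $ 2 \<and> a $ 3 = b $ 3"
  by (simp add: vec_eq_iff forall_3)

lemma golden_mult: "golden_ratio * (golden_ratio * a) = golden_ratio * a + a"
  by (simp add: mult.assoc[symmetric] golden_ratio_props distrib_right)

lemma root_inner: "simple_root j \<bullet> simple_root k = - bond j k"
  by (cases j; cases k) (simp_all add: root_coords inner_3 field_simps golden_ratio_props golden_mult)

lemma root_unit [simp]: "simple_root k \<bullet> simple_root k = 1"
  by (cases k) (simp_all add: root_inner)

lemma weight_root: "weight j \<bullet> simple_root k = (if j = k then 1 else 0)"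
  by (cases j; cases k) (simp_all add: root_coords inner_3 field_simps golden_ratio_props golden_mult)

lemma root_expansion: "v = (\<Sum>k\<in>UNIV. (weight k \<bullet> v) *\<^sub>R simple_root k)"
  by (simp add: UNIV_kind root_coords vec_eq_3 inner_3 field_simps golden_ratio_props golden_mult)

lemma weight_expansion: "v = (\<Sum>k\<in>UNIV. (simple_root k \<bullet> v) *\<^sub>R weight k)"
  by (simp add: UNIV_kind root_coords vec_eq_3 inner_3 field_simps golden_ratio_props golden_mult)

text \<open>The equal heights over the three walls make all edges at \<open>rho\<close> equally
  long.\<close>

lemma rho_root: "simple_root k \<bullet> rho = golden_ratio - 1"
  by (cases k) (simp_all add: root_coords rho_def inner_3 field_simps golden_ratio_props golden_mult)

lemma rho_gvec: "rho = gvec ((-1, 1), (-1, 1), (3, 1))"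
  by (simp add: rho_def gvec_def gval_def)

lemma weight_gweight:
  "weight Kx \<bullet> gvec v = gval (gweight 0 v)"
  "weight Ky \<bullet> gvec v = gval (gweight 1 v)"
  "weight Kz \<bullet> gvec v = 2 * golden_ratio * gval (gweight 2 v)"
  by (cases v; simp add: root_coords gweight_def inner_3 algebra_simps golden_mult golden_ratio_props)+

lemma weight_max:
  assumes "v \<in> solid_points" shows "weight k \<bullet> v \<le> weight k \<bullet> rho"
proof -
  obtain u where u: "u \<in> set vertex_list" "v = gvec u" using assms by (auto simp: solid_points_eq)
  have "gval (gweight j u) \<le> gval (gweight j ((-1, 1), (-1, 1), (3, 1)))" if "j \<in> {0, 1, 2}" for j
    using gweight_max u(1) that gnonneg_sound[of "gadd (gweight j ((-1, 1), (-1, 1), (3, 1))) (gneg (gweight j u))"]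
    by (auto simp: list_all_iff)
  then show ?thesis
    unfolding rho_gvec u(2) using golden_ratio_props(3)
    by (cases k) (simp_all add: weight_gweight)
qed

fun facet_size :: "kind \<Rightarrow> nat" where
  "facet_size Kx = 10" | "facet_size Ky = 6" | "facet_size Kz = 4"

lemma card_weight_max: "card {v \<in> solid_points. weight k \<bullet> v = weight k \<bullet> rho} = facet_size k"
proof -
  define r :: golden_vec where "r = ((-1, 1), (-1, 1), (3, 1))"
  have *: "card {v \<in> solid_points. w \<bullet> v = w \<bullet> rho} = length (filter (\<lambda>v. gweight j v = gweight j r) vertex_list)"
    if "\<And>v. w \<bullet> gvec v = c * gval (gweight j v)" "c \<noteq> 0" for w j c
  proof -
    have "{v \<in> solid_points. w \<bullet> v = w \<bullet> rho} = gvec ` set (filter (\<lambda>v. gweight j v = gweight j r) vertex_list)"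
      using that by (auto simp: solid_points_eq rho_gvec gval_eq r_def)
    moreover have "inj_on gvec A" for A by (simp add: inj_on_def gvec_eq)
    ultimately show ?thesis
      by (simp add: card_image distinct_card distinct_vertex_list del: set_filter)
  qed
  show ?thesis
    using *[of "weight Kx" 1 0] *[of "weight Ky" 1 1] *[of "weight Kz" "2 * golden_ratio" 2]
      gweight_max_count golden_ratio_props(3)
    by (cases k) (simp_all add: weight_gweight r_def)
qed

lemma norm_solid_points:
  assumes "v \<in> solid_points" shows "v \<bullet> v = rho \<bullet> rho"
proof -
  have *: "v \<bullet> v = a * a + b * b + c * c" if "v \<in> signed_cyclic a b c" for v a b c
    using that by (auto simp: signed_cyclic_def inner_3)
  have g: "1 / golden_ratio = golden_ratio - 1" "2 / golden_ratio = 2 * (golden_ratio - 1)"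
    using golden_ratio_props(5) by (simp_all add: field_simps)
  have g4: "golden_ratio ^ 4 = 2 + golden_ratio * 3"
    by (simp add: power4_eq_xxxx algebra_simps golden_ratio_props golden_mult)
  show ?thesis
    using assms unfolding solid_points_def Let_def g
    by (auto dest!: *) (simp_all add: rho_def inner_3 algebra_simps golden_ratio_props golden_mult g4)
qed

definition reflection :: "'a::real_inner \<Rightarrow> 'a \<Rightarrow> 'a" where
  "reflection a v = v - (2 * (a \<bullet> v)) *\<^sub>R a"

lemma orthogonal_reflection:
  fixes a :: "'a::euclidean_space"
  assumes "a \<bullet> a = 1" shows "orthogonal_transformation (reflection a)"
proof -
  have "linear (reflection a)"
    by (rule linearI) (simp_all add: reflection_def inner_add_right algebra_simps)
  then show ?thesis
    by (simp add: orthogonal_transformation_def reflection_def inner_diff_left inner_diff_right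
        assms inner_commute)
qed

lemma reflection_involution: "a \<bullet> a = 1 \<Longrightarrow> reflection a (reflection a v) = v"
  by (simp add: reflection_def inner_diff_right algebra_simps)

abbreviation refl_by :: "kind \<Rightarrow> real^3 \<Rightarrow> real^3" where
  "refl_by k \<equiv> reflection (simple_root k)"

lemma signed_cyclic_sym:
  assumes "v \<in> signed_cyclic a b c"
  shows "vector [- v $ 1, v $ 2, v $ 3] \<in> signed_cyclic a b c"
    "vector [v $ 1, - v $ 2, v $ 3] \<in> signed_cyclic a b c"
    "vector [v $ 2, v $ 3, v $ 1] \<in> signed_cyclic a b c"
  using assms unfolding signed_cyclic_def by (elim UN_E insertE emptyE; simp)+

lemma solid_points_sym:
  assumes "v \<in> solid_points"
  shows "vector [- v $ 1, v $ 2, v $ 3] \<in> solid_points"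
    "vector [v $ 1, - v $ 2, v $ 3] \<in> solid_points"
    "vector [v $ 2, v $ 3, v $ 1] \<in> solid_points"
  using assms unfolding solid_points_def Let_def by (auto intro: signed_cyclic_sym)

lemma refl_by_gvec:
  assumes "greflectable v" shows "refl_by Kz (gvec v) = gvec (greflect v)"
  using assms
  by (cases v) (simp add: greflectable_def greflect_def Let_def vec_eq_3 reflection_def root_coords inner_3
      field_simps golden_mult golden_ratio_props)

lemma refl_by_solid:
  assumes "v \<in> solid_points" shows "refl_by k v \<in> solid_points"
proof (cases k)
  case Kx
  have "refl_by Kx v = vector [- v $ 1, v $ 2, v $ 3]"
    by (simp add: reflection_def root_coords vec_eq_3 inner_3)
  then show ?thesis using solid_points_sym[OF assms] Kx by simp
next
  case Ky
  have "refl_by Ky v = vector [v $ 1, - v $ 2, v $ 3]"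
    by (simp add: reflection_def root_coords vec_eq_3 inner_3)
  then show ?thesis using solid_points_sym[OF assms] Ky by simp
next
  case Kz
  obtain u where u: "u \<in> set vertex_list" "v = gvec u" using assms by (auto simp: solid_points_eq)
  then have "greflectable u" "greflect u \<in> set vertex_list"
    using greflect_vertex_list by (auto simp: list_all_iff)
  then show ?thesis using u Kz by (simp add: refl_by_gvec solid_points_eq)
qed

lemma rho_solid: "rho \<in> solid_points"
  using golden_ratio_props(5) by (auto simp: solid_points_def Let_def signed_cyclic_def rho_def add.commute)

text \<open>Equal norms give \<open>(rho - v) \<bullet> (rho + v) = 0\<close>. Here
  \<open>rho - v\<close> is a nonnegative combination of simple roots, because \<open>rho\<close>
  maximises all weights, and each root has positive inner product with \<open>rho + v\<close>; so
  all coefficients vanish.\<close>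

lemma chamber_point_unique:
  assumes v: "v \<in> solid_points" and pos: "\<And>k. 0 \<le> simple_root k \<bullet> v"
  shows "v = rho"
proof -
  define c where "c k = weight k \<bullet> (rho - v)" for k
  have c: "0 \<le> c k" for k using weight_max[OF v, of k] by (simp add: c_def inner_diff_right)
  have d: "rho - v = (\<Sum>k\<in>UNIV. c k *\<^sub>R simple_root k)" unfolding c_def by (rule root_expansion)
  have p: "0 < simple_root k \<bullet> (rho + v)" for k
    using pos[of k] golden_ratio_props(3) by (simp add: inner_add_right rho_root)
  have "(rho - v) \<bullet> (rho + v) = 0"
    using norm_solid_points[OF v] by (simp add: inner_diff_left inner_add_right inner_commute[of v rho])
  then have "(\<Sum>k\<in>UNIV. c k * (simple_root k \<bullet> (rho + v))) = 0"
    unfolding d by (simp add: inner_sum_left)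
  then have "c k * (simple_root k \<bullet> (rho + v)) = 0" for k
    using c p by (subst (asm) sum_nonneg_eq_0_iff) (simp_all add: less_imp_le)
  then have "c k = 0" for k using p[of k] by (metis less_irrefl mult_eq_0_iff)
  then show ?thesis using d by simp
qed

section \<open>Symmetries and faces of the solid\<close>

definition symmetries :: "(real^3 \<Rightarrow> real^3) set" where
  "symmetries = {w. orthogonal_transformation w \<and> w ` solid_points = solid_points}"

lemma symmetriesI:
  assumes "orthogonal_transformation w" "\<And>v. v \<in> solid_points \<Longrightarrow> w v \<in> solid_points"
  shows "w \<in> symmetries"
proof -
  have "inj_on w solid_points"
    using orthogonal_transformation_inj[OF assms(1)] by (rule inj_on_subset) simp
  then have "w ` solid_points = solid_points"
    using assms(2) by (intro endo_inj_surj finite_solid_points) auto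
  then show ?thesis using assms(1) by (simp add: symmetries_def)
qed

lemma symmetries_orth: "w \<in> symmetries \<Longrightarrow> orthogonal_transformation w"
  and symmetries_solid: "w \<in> symmetries \<Longrightarrow> v \<in> solid_points \<Longrightarrow> w v \<in> solid_points"
  by (auto simp: symmetries_def)

lemma refl_by_symmetries: "refl_by k \<in> symmetries"
  by (rule symmetriesI) (simp_all add: orthogonal_reflection refl_by_solid)

lemma symmetries_comp: "w \<in> symmetries \<Longrightarrow> w' \<in> symmetries \<Longrightarrow> w \<circ> w' \<in> symmetries"
  by (rule symmetriesI)
    (simp_all add: orthogonal_transformation_compose symmetries_orth symmetries_solid)

lemma symmetries_inv:
  assumes "w \<in> symmetries" shows "inv w \<in> symmetries"
proof -
  have w: "orthogonal_transformation w" "w ` solid_points = solid_points"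
    using assms by (auto simp: symmetries_def)
  have "inv w ` (w ` solid_points) = solid_points"
    by (rule image_inv_f_f) (rule orthogonal_transformation_inj[OF w(1)])
  then show ?thesis
    using orthogonal_transformation_inv[OF w(1)] unfolding w(2) by (simp add: symmetries_def)
qed

fun word :: "kind list \<Rightarrow> real^3 \<Rightarrow> real^3" where
  "word [] v = v"
| "word (k # ks) v = refl_by k (word ks v)"

lemma word_append: "word (ks @ ls) v = word ks (word ls v)"
  by (induction ks) auto

lemma word_rev: "word (rev ks) (word ks v) = v"
  by (induction ks) (auto simp: word_append reflection_involution)

lemma word_solid: "v \<in> solid_points \<Longrightarrow> word ks v \<in> solid_points"
  by (induction ks) (auto intro: refl_by_solid)

text \<open>In the orbit of \<open>v\<close> under words, a point with the largest inner product
  with \<open>rho\<close> cannot be improved by a simple reflection. It therefore lies in the closed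
  chamber and equals \<open>rho\<close>.\<close>

lemma solid_points_word:
  assumes v: "v \<in> solid_points" shows "\<exists>ks. v = word ks rho"
proof -
  define A where "A = range (\<lambda>ks. word ks v)"
  have "A \<subseteq> solid_points" using word_solid[OF v] by (auto simp: A_def)
  then have fin: "finite A" "A \<noteq> {}" using finite_solid_points finite_subset by (auto simp: A_def)
  obtain u where u: "u \<in> A" and max: "\<And>u'. u' \<in> A \<Longrightarrow> u' \<bullet> rho \<le> u \<bullet> rho"
  proof -
    have "Max ((\<lambda>u. u \<bullet> rho) ` A) \<in> (\<lambda>u. u \<bullet> rho) ` A" using fin by (intro Max_in) auto
    then obtain u where "u \<in> A" "Max ((\<lambda>u. u \<bullet> rho) ` A) = u \<bullet> rho" by blast
    then show ?thesis using that fin by (metis Max_ge finite_imageI imageI)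
  qed
  have "0 \<le> simple_root k \<bullet> u" for k
  proof -
    obtain ks where "u = word ks v" using u by (auto simp: A_def)
    then have "refl_by k u = word (k # ks) v" by simp
    then have "refl_by k u \<in> A" unfolding A_def by blast
    then have "refl_by k u \<bullet> rho \<le> u \<bullet> rho" by (rule max)
    then have "0 \<le> (simple_root k \<bullet> u) * (simple_root k \<bullet> rho)"
      by (simp add: reflection_def inner_diff_left mult.commute)
    then show ?thesis using golden_ratio_props(3) by (simp add: rho_root zero_le_mult_iff)
  qed
  then have "u = rho" using chamber_point_unique u \<open>A \<subseteq> solid_points\<close> by blast
  then obtain ks where "rho = word ks v" using u by (auto simp: A_def)
  then have "v = word (rev ks) rho" by (metis word_rev)
  then show ?thesis by blast
qed

lemma symmetries_image_solid:
  assumes "w \<in> symmetries" shows "w ` solid = solid"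
proof -
  have "linear w" using symmetries_orth[OF assms] by (rule orthogonal_transformation_linear)
  then have "w ` solid = convex hull (w ` solid_points)"
    by (simp add: solid_def convex_hull_linear_image)
  then show ?thesis using assms by (simp add: symmetries_def solid_def)
qed

lemma solid_points_subset: "solid_points \<subseteq> solid"
  by (simp add: solid_def hull_subset)

lemma convex_solid: "convex solid" by (simp add: solid_def)

lemma solid_weight:
  assumes "u \<in> solid" shows "weight k \<bullet> u \<le> weight k \<bullet> rho"
proof -
  have "solid \<subseteq> {u. weight k \<bullet> u \<le> weight k \<bullet> rho}"
    unfolding solid_def by (rule hull_minimal) (auto simp: weight_max convex_halfspace_le)
  then show ?thesis using assms by auto
qed

text \<open>The face through \<open>rho\<close> whose edges at \<open>rho\<close> are those of the
  kinds outside \<open>J\<close>. By \<open>face_at_rho\<close> every face containing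
  \<open>rho\<close> arises in this way.\<close>

definition corner_face :: "kind set \<Rightarrow> (real^3) set" where
  "corner_face J = {u \<in> solid. \<forall>k\<in>J. weight k \<bullet> u = weight k \<bullet> rho}"

lemma refl_rho: "refl_by k rho = rho - (2 * (golden_ratio - 1)) *\<^sub>R simple_root k"
  by (simp add: reflection_def rho_root)

lemma weight_refl_rho:
  "weight j \<bullet> refl_by k rho = weight j \<bullet> rho - (if j = k then 2 * (golden_ratio - 1) else 0)"
  by (simp add: refl_rho inner_diff_right weight_root)

lemma refl_rho_corner_face: "refl_by k rho \<in> corner_face J \<longleftrightarrow> k \<notin> J"
  using refl_by_solid[OF rho_solid, of k] solid_points_subset golden_ratio_props(3)
  by (auto simp: corner_face_def weight_refl_rho split: if_splits)

lemma rho_corner_face: "rho \<in> corner_face J"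
  using rho_solid solid_points_subset by (auto simp: corner_face_def)

lemma corner_face_of: "corner_face J face_of solid"
proof -
  let ?a = "\<Sum>k\<in>J. weight k"
  have "corner_face J = solid \<inter> {u. ?a \<bullet> u = ?a \<bullet> rho}"
  proof -
    have "(\<forall>k\<in>J. weight k \<bullet> u = weight k \<bullet> rho) \<longleftrightarrow> ?a \<bullet> u = ?a \<bullet> rho" if "u \<in> solid" for u
    proof -
      have "?a \<bullet> u = ?a \<bullet> rho \<longleftrightarrow> (\<Sum>k\<in>J. weight k \<bullet> rho - weight k \<bullet> u) = 0"
        by (auto simp: inner_sum_left sum_subtractf)
      also have "\<dots> \<longleftrightarrow> (\<forall>k\<in>J. weight k \<bullet> rho - weight k \<bullet> u = 0)"
        using solid_weight[OF that] by (intro sum_nonneg_eq_0_iff) auto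
      finally show ?thesis by auto
    qed
    then show ?thesis by (auto simp: corner_face_def)
  qed
  moreover have "?a \<bullet> u \<le> ?a \<bullet> rho" if "u \<in> solid" for u
    using solid_weight[OF that] by (simp add: inner_sum_left sum_mono)
  ultimately show ?thesis
    using face_of_Int_supporting_hyperplane_le[OF convex_solid, of ?a] by simp
qed

text \<open>A functional \<open>a\<close> exposing the face cannot grow from \<open>rho\<close> to
  its mirror images, so it is nonnegative on the simple roots. Hence
  \<open>a \<bullet> (rho - u)\<close> is a sum of nonnegative terms, and it vanishes iff the
  weights of the roots with \<open>a \<bullet> simple_root k \<noteq> 0\<close> are maximal at
  \<open>u\<close>.\<close>

lemma face_at_rho:
  assumes F: "F face_of solid" and rho: "rho \<in> F"
  shows "\<exists>J. F = corner_face J"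
proof -
  have "polyhedron solid"
    by (simp add: solid_def polytope_imp_polyhedron polytope_convex_hull finite_solid_points)
  then have "F exposed_face_of solid" using F exposed_face_of_polyhedron by blast
  then obtain a b where ab: "solid \<subseteq> {x. a \<bullet> x \<le> b}" "F = solid \<inter> {x. a \<bullet> x = b}"
    by (auto simp: exposed_face_of_def)
  have b: "b = a \<bullet> rho" using rho ab by simp
  have nn: "0 \<le> a \<bullet> simple_root k" for k
  proof -
    have "a \<bullet> refl_by k rho \<le> a \<bullet> rho"
      using ab(1) refl_by_solid[OF rho_solid] solid_points_subset by (auto simp: b)
    then show ?thesis using golden_ratio_props(3) by (simp add: refl_rho inner_diff_right zero_le_mult_iff)
  qed
  have "a \<bullet> u = b \<longleftrightarrow> (\<forall>k\<in>{k. a \<bullet> simple_root k \<noteq> 0}. weight k \<bullet> u = weight k \<bullet> rho)" if u: "u \<in> solid" for u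
  proof -
    have "a \<bullet> (rho - u) = (\<Sum>k\<in>UNIV. (weight k \<bullet> (rho - u)) * (a \<bullet> simple_root k))"
      by (subst root_expansion[of "rho - u"]) (simp add: inner_sum_right)
    moreover have "\<dots> = 0 \<longleftrightarrow> (\<forall>k\<in>UNIV. (weight k \<bullet> (rho - u)) * (a \<bullet> simple_root k) = 0)"
      using nn solid_weight[OF u]
      by (intro sum_nonneg_eq_0_iff) (auto intro!: mult_nonneg_nonneg simp: inner_diff_right)
    moreover have "a \<bullet> u = b \<longleftrightarrow> a \<bullet> (rho - u) = 0" by (auto simp: b inner_diff_right)
    moreover have "(weight k \<bullet> (rho - u)) * (a \<bullet> simple_root k) = 0 \<longleftrightarrow>
        (a \<bullet> simple_root k \<noteq> 0 \<longrightarrow> weight k \<bullet> u = weight k \<bullet> rho)" for k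
      by (auto simp: inner_diff_right)
    ultimately show ?thesis by simp
  qed
  then have "F = corner_face {k. a \<bullet> simple_root k \<noteq> 0}"
    unfolding ab(2) corner_face_def by auto
  then show ?thesis by blast
qed

text \<open>Translated by \<open>- rho\<close>, the face contains a nonzero multiple of each simple
  root outside \<open>J\<close> and lies in their span.\<close>

lemma aff_dim_corner_face: "aff_dim (corner_face J) = int (card (- J))"
proof -
  define c where "c = - (2 * (golden_ratio - 1))"
  have c: "c \<noteq> 0" using golden_ratio_props(3) by (simp add: c_def)
  define b where "b k = c *\<^sub>R simple_root k" for k
  let ?V = "(+) (- rho) ` corner_face J"
  have inj: "inj b"
  proof (rule injI)
    fix j k assume "b j = b k"
    then have "weight j \<bullet> simple_root j = weight j \<bullet> simple_root k" using c by (simp add: b_def)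
    then show "j = k" by (auto simp: weight_root split: if_splits)
  qed
  have sp: "simple_root k \<in> span (b ` A)" if "k \<in> A" for k A
  proof -
    have "(1 / c) *\<^sub>R b k \<in> span (b ` A)" using that by (intro span_scale span_base) simp
    then show ?thesis using c by (simp add: b_def)
  qed
  have "independent (range b)"
  proof (rule card_le_dim_spanning[of _ UNIV])
    have "v \<in> span (range b)" for v
      by (subst root_expansion[of v]) (intro span_sum span_scale sp, simp)
    then show "UNIV \<subseteq> span (range b)" by auto
    have "card (range b) = card {Kx, Ky, Kz}" using inj by (simp add: card_image UNIV_kind[symmetric])
    then show "card (range b) \<le> dim (UNIV :: (real^3) set)" by simp
  qed auto
  then have ind: "independent (b ` (- J))" by (rule independent_mono) auto
  have "dim ?V = card (- J)"
  proof (rule dim_unique[OF _ _ ind])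
    show "b ` (- J) \<subseteq> ?V"
    proof
      fix x assume "x \<in> b ` (- J)"
      then obtain k where k: "k \<notin> J" "x = b k" by auto
      then have "x = - rho + refl_by k rho"
        unfolding b_def c_def refl_rho scaleR_minus_left by simp
      then show "x \<in> ?V" using k refl_rho_corner_face by blast
    qed
    show "?V \<subseteq> span (b ` (- J))"
    proof
      fix x assume "x \<in> ?V"
      then obtain u where u: "x = u - rho" "u \<in> corner_face J" by auto
      have "(weight k \<bullet> x) *\<^sub>R simple_root k \<in> span (b ` (- J))" for k
      proof (cases "k \<in> J")
        case True
        then have "weight k \<bullet> x = 0" using u by (simp add: corner_face_def inner_diff_right)
        then show ?thesis by (simp add: span_zero)
      next
        case False
        then show ?thesis by (intro span_scale sp) simp
      qed
      then show "x \<in> span (b ` (- J))"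
        by (subst root_expansion[of x]) (intro span_sum)
    qed
    show "card (b ` (- J)) = card (- J)"
      using inj by (intro card_image) (auto simp: inj_on_def)
  qed
  moreover have "rho \<in> affine hull corner_face J" by (simp add: hull_inc rho_corner_face)
  ultimately show ?thesis by (simp add: aff_dim_eq_dim)
qed

lemma card_kind: "card (UNIV :: kind set) = 3" by (simp add: UNIV_kind)

lemma facet_at_rho:
  assumes F: "rho \<in> F" shows "F facet_of solid \<longleftrightarrow> (\<exists>k. F = corner_face {k})"
proof -
  have solid: "aff_dim solid = 3"
    using aff_dim_corner_face[of "{}"] by (simp add: corner_face_def card_kind)
  have c: "card (- J) = 3 - card J" for J :: "kind set"
    by (simp add: Compl_eq_Diff_UNIV card_Diff_subset card_kind)
  show ?thesis
  proof
    assume "F facet_of solid"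
    then have "F face_of solid" "aff_dim F = 2" using solid by (auto simp: facet_of_def)
    then obtain J where J: "F = corner_face J" "card (- J) = 2"
      using face_at_rho F aff_dim_corner_face by fastforce
    then have "card J = 1" by (simp add: c)
    then show "\<exists>k. F = corner_face {k}" using J(1) by (metis card_1_singletonE)
  next
    assume "\<exists>k. F = corner_face {k}"
    then show "F facet_of solid"
      using F by (auto simp: facet_of_def corner_face_of aff_dim_corner_face solid c)
  qed
qed

lemma extreme_point_rho: "rho extreme_point_of solid"
proof -
  have "corner_face UNIV = {rho}"
  proof -
    have "u = rho" if "\<And>k. weight k \<bullet> u = weight k \<bullet> rho" for u
      using root_expansion[of u] root_expansion[of rho] that by simp
    then show ?thesis using rho_corner_face[of UNIV] by (auto simp: corner_face_def)
  qed
  then show ?thesis using corner_face_of[of UNIV] by (simp add: face_of_singleton)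
qed

lemma symmetries_word: "word ks \<in> symmetries"
proof (induction ks)
  case Nil
  have "word [] = id" by auto
  then show ?case by (simp add: symmetries_def)
next
  case (Cons k ks)
  have "word (k # ks) = refl_by k \<circ> word ks" by auto
  then show ?case using Cons refl_by_symmetries symmetries_comp by metis
qed

lemma extreme_point_symmetry:
  assumes w: "w \<in> symmetries" shows "w v extreme_point_of w ` F \<longleftrightarrow> v extreme_point_of F"
proof -
  have "linear w" "inj w"
    using symmetries_orth[OF w] orthogonal_transformation_linear orthogonal_transformation_inj by blast+
  from face_of_linear_image[OF this, of "{v}" F] show ?thesis by (simp add: face_of_singleton)
qed

lemma extreme_points_solid: "v extreme_point_of solid \<longleftrightarrow> v \<in> solid_points"
proof
  assume "v \<in> solid_points"
  then obtain ks where "v = word ks rho" using solid_points_word by blast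
  then show "v extreme_point_of solid"
    using extreme_point_symmetry[OF symmetries_word, of ks rho solid] extreme_point_rho
    by (simp add: symmetries_image_solid symmetries_word)
qed (auto simp: solid_def dest: extreme_point_of_convex_hull)

lemma ngon_facet_rho:
  assumes "rho \<in> F" shows "ngon_facet m F \<longleftrightarrow> (\<exists>k. m = facet_size k \<and> F = corner_face {k})"
proof -
  have "card {v. v extreme_point_of corner_face {k}} = facet_size k" for k
  proof -
    have "{v. v extreme_point_of corner_face {k}} = {v \<in> solid_points. weight k \<bullet> v = weight k \<bullet> rho}"
      using solid_points_subset
      by (auto simp: extreme_point_of_face[OF corner_face_of] extreme_points_solid) (auto simp: corner_face_def)
    then show ?thesis using card_weight_max by simp
  qed
  then show ?thesis using facet_at_rho[OF assms] by (auto simp: ngon_facet_def)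
qed

lemma separates_rho:
  "(\<exists>F F'. ngon_facet m F \<and> ngon_facet n F' \<and> closed_segment rho (refl_by k rho) \<subseteq> F \<inter> F') \<longleftrightarrow>
   (\<exists>i j. i \<noteq> k \<and> j \<noteq> k \<and> m = facet_size i \<and> n = facet_size j)" (is "?L \<longleftrightarrow> ?R")
proof
  assume ?L
  then obtain F F' where F: "ngon_facet m F" "ngon_facet n F'" "closed_segment rho (refl_by k rho) \<subseteq> F \<inter> F'"
    by blast
  then have "rho \<in> F" "rho \<in> F'" "refl_by k rho \<in> F" "refl_by k rho \<in> F'" by auto
  then obtain i j where "m = facet_size i" "F = corner_face {i}" "n = facet_size j" "F' = corner_face {j}"
    using F by (auto simp: ngon_facet_rho)
  moreover from this have "i \<noteq> k" "j \<noteq> k"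
    using \<open>refl_by k rho \<in> F\<close> \<open>refl_by k rho \<in> F'\<close> by (auto simp: refl_rho_corner_face)
  ultimately show ?R by blast
next
  assume ?R
  then obtain i j where ij: "i \<noteq> k" "j \<noteq> k" "m = facet_size i" "n = facet_size j" by blast
  have "closed_segment rho (refl_by k rho) \<subseteq> corner_face {i}" if "i \<noteq> k" for i
    using that face_of_imp_convex[OF corner_face_of]
    by (intro closed_segment_subset) (auto simp: rho_corner_face refl_rho_corner_face)
  then show ?L
    using ij by (intro exI[of _ "corner_face {i}"] exI[of _ "corner_face {j}"])
      (auto simp: ngon_facet_rho rho_corner_face)
qed

lemma edge_at_rho:
  assumes v: "v \<in> solid_points"
  shows "closed_segment rho v edge_of solid \<longleftrightarrow> (\<exists>k. v = refl_by k rho)"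
proof
  assume "closed_segment rho v edge_of solid"
  then have e: "closed_segment rho v face_of solid" "aff_dim (closed_segment rho v) = 1"
    by (auto simp: edge_of_def)
  then obtain J where J: "closed_segment rho v = corner_face J"
    using face_at_rho[OF e(1)] by auto
  then have "card (- J) = 1" using e(2) aff_dim_corner_face[of J] by simp
  then obtain k where "- J = {k}" by (metis card_1_singletonE)
  then have "k \<notin> J" by auto
  then have "refl_by k rho \<in> closed_segment rho v" using J refl_rho_corner_face by simp
  moreover have "refl_by k rho extreme_point_of solid"
    by (simp add: extreme_points_solid refl_by_solid rho_solid)
  ultimately have "refl_by k rho extreme_point_of closed_segment rho v"
    by (simp add: extreme_point_of_face[OF e(1)])
  then have "refl_by k rho = rho \<or> refl_by k rho = v" by (simp add: extreme_point_of_segment)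
  moreover have "refl_by k rho \<noteq> rho"
    using weight_refl_rho[of k k] golden_ratio_props(3) by auto
  ultimately show "\<exists>k. v = refl_by k rho" by auto
next
  assume "\<exists>k. v = refl_by k rho"
  then obtain k where k: "v = refl_by k rho" by blast
  define F where "F = corner_face (- {k})"
  have F: "F face_of solid" unfolding F_def by (rule corner_face_of)
  have ext: "{u. u extreme_point_of F} = {rho, v}"
  proof -
    \<comment> \<open>Such a vertex lies on the line through \<open>rho\<close> in the direction of
      \<open>simple_root k\<close>, which meets the common sphere of the vertices only in
      \<open>rho\<close> and \<open>v\<close>.\<close>
    have "u = rho \<or> u = v" if u: "u \<in> solid_points" "u \<in> F" for u
    proof -
      have "(\<Sum>j\<in>UNIV. (weight j \<bullet> (rho - u)) *\<^sub>R simple_root j)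
          = (\<Sum>j\<in>UNIV. if j = k then (weight k \<bullet> (rho - u)) *\<^sub>R simple_root k else 0)"
        by (rule sum.cong) (use u in \<open>auto simp: F_def corner_face_def inner_diff_right\<close>)
      then have "rho - u = (weight k \<bullet> (rho - u)) *\<^sub>R simple_root k"
        by (subst root_expansion) simp
      then obtain c where c: "u = rho - c *\<^sub>R simple_root k" by (metis add.commute diff_diff_eq2 diff_add_cancel)
      have "c * c = 2 * c * (golden_ratio - 1)"
        using norm_solid_points[OF u(1)] rho_root[of k]
        by (simp add: c inner_diff_left inner_diff_right inner_commute[of rho "simple_root k"] algebra_simps)
      then have "c * (c - 2 * (golden_ratio - 1)) = 0" by (simp add: algebra_simps)
      then have "c = 0 \<or> c = 2 * (golden_ratio - 1)" by simp
      then show ?thesis by (auto simp: c k refl_rho)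
    qed
    moreover have "rho \<in> F" "v \<in> F" by (auto simp: F_def k rho_corner_face refl_rho_corner_face)
    ultimately show ?thesis
      using v rho_solid by (auto simp: extreme_point_of_face[OF F] extreme_points_solid)
  qed
  have "compact solid" by (simp add: solid_def finite_imp_compact_convex_hull finite_solid_points)
  then have "F = convex hull {rho, v}"
    using Krein_Milman_Minkowski[of F] face_of_imp_compact[OF convex_solid _ F] face_of_imp_convex[OF F] ext
    by simp
  then have "closed_segment rho v = F" by (simp add: segment_convex_hull)
  then show "closed_segment rho v edge_of solid"
    using F aff_dim_corner_face[of "- {k}"] by (simp add: edge_of_def F_def)
qed

lemma symmetry_edge:
  assumes w: "w \<in> symmetries"
  shows "closed_segment (w a) (w b) edge_of solid \<longleftrightarrow> closed_segment a b edge_of solid"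
proof -
  have lin: "linear w" "inj w"
    using symmetries_orth[OF w] orthogonal_transformation_linear orthogonal_transformation_inj by blast+
  have "closed_segment (w a) (w b) = w ` closed_segment a b"
    by (simp add: closed_segment_linear_image lin)
  then show ?thesis
    using face_of_linear_image[OF lin, of "closed_segment a b" solid] lin
    by (simp add: edge_of_def symmetries_image_solid[OF w] aff_dim_injective_linear_image)
qed

lemma symmetry_ngon_facet:
  assumes w: "w \<in> symmetries"
  shows "ngon_facet m (w ` F) \<longleftrightarrow> ngon_facet m F"
proof -
  have lin: "linear w" "inj w" "surj w"
    using symmetries_orth[OF w] orthogonal_transformation_linear orthogonal_transformation_inj
      orthogonal_transformation_surj by blast+
  have "{v. v extreme_point_of w ` F} = w ` {v. v extreme_point_of F}"
  proof (intro equalityI subsetI)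
    fix v assume v: "v \<in> {v. v extreme_point_of w ` F}"
    obtain u where "v = w u" using lin(3) by (rule surjE)
    then show "v \<in> w ` {v. v extreme_point_of F}" using v extreme_point_symmetry[OF w] by simp
  qed (auto simp: extreme_point_symmetry[OF w])
  then have "card {v. v extreme_point_of w ` F} = card {v. v extreme_point_of F}"
    using lin(2) by (simp add: card_image inj_on_subset)
  then show ?thesis
    using face_of_linear_image[OF lin(1,2), of F solid] lin
    by (simp add: ngon_facet_def facet_of_def symmetries_image_solid[OF w] aff_dim_injective_linear_image)
qed

text \<open>Such a symmetry permutes the edges at \<open>rho\<close>, hence the simple roots, and
  preserves their Gram matrix. The three off-diagonal entries are different, so no root
  moves.\<close>

lemma symmetry_fixing_rho:
  assumes w: "w \<in> symmetries" and fixed: "w rho = rho" shows "w = id"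
proof -
  have orth: "w a \<bullet> w b = a \<bullet> b" for a b
    using symmetries_orth[OF w] by (simp add: orthogonal_transformation_def)
  have lin: "linear w" using symmetries_orth[OF w] by (rule orthogonal_transformation_linear)
  have "\<exists>j. w (simple_root k) = simple_root j" for k
  proof -
    have "closed_segment rho (refl_by k rho) edge_of solid"
      by (subst edge_at_rho) (auto intro: refl_by_solid rho_solid)
    then have "closed_segment rho (w (refl_by k rho)) edge_of solid"
      using symmetry_edge[OF w, of rho] fixed by simp
    then obtain j where j: "w (refl_by k rho) = refl_by j rho"
      by (subst (asm) edge_at_rho) (auto intro: refl_by_solid rho_solid symmetries_solid[OF w])
    then show ?thesis
      using golden_ratio_props(3) by (auto simp: refl_rho linear_diff[OF lin] linear_cmul[OF lin] fixed)
  qed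
  then obtain p where p: "\<And>k. w (simple_root k) = simple_root (p k)" by metis
  have b: "bond (p j) (p k) = bond j k" for j k
    using orth[of "simple_root j" "simple_root k"] by (simp add: p root_inner)
  have "p k = k" for k
    using b[of Kx Ky] b[of Kx Kz] b[of Ky Kz] golden_ratio_props(3)
    by (cases "p Kx"; cases "p Ky"; cases "p Kz"; cases k; simp)
  then have "w v = v" for v
    using p by (subst (1 2) root_expansion[of v]) (simp add: linear_sum[OF lin] linear_cmul[OF lin])
  then show ?thesis by auto
qed

lemma symmetries_eqI:
  assumes "w \<in> symmetries" "w' \<in> symmetries" "w rho = w' rho" shows "w = w'"
proof -
  have bij: "bij w'" using symmetries_orth[OF assms(2)] by (rule orthogonal_transformation_bij)
  have "inv w' \<circ> w = id"
    by (rule symmetry_fixing_rho)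
      (use assms bij in \<open>auto intro: symmetries_comp symmetries_inv simp: bij_is_inj\<close>)
  then show ?thesis using bij by (metis bij_is_surj comp_assoc comp_id id_comp surj_iff)
qed

section \<open>The skeleton as a Cayley graph\<close>

lemma pos_solid [simp]: "pos i \<in> solid_points"
  using pos[of i] by (simp add: extreme_points_solid)

lemma pos_Abs [simp]: "v \<in> solid_points \<Longrightarrow> pos (Abs_vertex v) = v"
  by (simp add: Abs_vertex_inverse extreme_points_solid)

lemma symmetries_bij: "w \<in> symmetries \<Longrightarrow> bij w"
  using symmetries_orth orthogonal_transformation_bij by blast

lemma symmetries_trans: "v \<in> solid_points \<Longrightarrow> \<exists>w\<in>symmetries. w rho = v"
  using solid_points_word symmetries_word by metis

text \<open>Vertices are identified with symmetries. The description is proper by simple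
  transitivity, see \<open>symmetries_trans\<close> and \<open>symmetries_eqI\<close>.\<close>

definition frame :: "vertex \<Rightarrow> real^3 \<Rightarrow> real^3" where
  "frame i = (THE w. w \<in> symmetries \<and> w rho = pos i)"

lemma frame_eq: "w \<in> symmetries \<Longrightarrow> w rho = pos i \<Longrightarrow> frame i = w"
  unfolding frame_def by (rule the_equality) (auto intro: symmetries_eqI)

lemma frame: "frame i \<in> symmetries" "frame i rho = pos i"
  using symmetries_trans[OF pos_solid, of i] frame_eq by auto

text \<open>Right multiplication by a simple reflection, see \<open>frame_nbr\<close>. It commutes
  with all symmetries, which multiply from the left, so the kind of an edge is invariant.\<close>

definition nbr :: "kind \<Rightarrow> vertex \<Rightarrow> vertex" where
  "nbr k i = Abs_vertex (frame i (refl_by k rho))"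

lemma refl_rho_solid [simp]: "refl_by k rho \<in> solid_points"
  by (simp add: refl_by_solid rho_solid)

lemma pos_nbr: "pos (nbr k i) = frame i (refl_by k rho)"
  by (simp add: nbr_def symmetries_solid frame)

lemma frame_nbr: "frame (nbr k i) = frame i \<circ> refl_by k"
  by (rule frame_eq) (simp_all add: symmetries_comp frame refl_by_symmetries pos_nbr)

fun walk :: "kind list \<Rightarrow> vertex \<Rightarrow> vertex" where
  "walk [] i = i"
| "walk (k # ks) i = walk ks (nbr k i)"

text \<open>Steps multiply from the right: the first step of a walk is the outermost reflection of
  the word.\<close>

lemma frame_walk: "frame (walk ks i) v = frame i (word ks v)"
  by (induction ks arbitrary: i) (simp_all add: frame_nbr)

lemma pos_walk: "pos (walk ks i) = frame i (word ks rho)"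
  by (metis frame(2) frame_walk)

lemma walk_eq: "walk ks i = walk ls i \<longleftrightarrow> word ks rho = word ls rho"
  using bij_is_inj[OF symmetries_bij[OF frame(1), of i]]
  by (simp add: pos_inject[symmetric] pos_walk inj_eq)

lemma walk_surj: "\<exists>ks. j = walk ks i"
proof -
  have b: "bij (frame i)" by (rule symmetries_bij[OF frame(1)])
  have "inv (frame i) (pos j) \<in> solid_points"
    by (simp add: symmetries_solid symmetries_inv frame)
  then obtain ks where "inv (frame i) (pos j) = word ks rho" using solid_points_word by blast
  then have "pos j = frame i (word ks rho)" using b by (metis bij_inv_eq_iff)
  then show ?thesis by (auto simp: pos_inject[symmetric] pos_walk)
qed

lemma vertex_connected:
  assumes "Q i" "\<And>j k. Q j \<Longrightarrow> Q (nbr k j)" shows "Q j"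
proof -
  have "Q i \<Longrightarrow> Q (walk ks i)" for ks i
    by (induction ks arbitrary: i) (auto intro: assms)
  then show ?thesis using walk_surj assms(1) by metis
qed

section \<open>Exact computation with words\<close>

definition gword_rho :: golden_vec where
  "gword_rho = ((-1, 1), (-1, 1), (3, 1))"

fun gword :: "kind list \<Rightarrow> golden_vec" where
  "gword [] = gword_rho"
| "gword (k # ks) = (case k of
      Kx \<Rightarrow> (case gword ks of (a, b, c) \<Rightarrow> (gneg a, b, c))
    | Ky \<Rightarrow> (case gword ks of (a, b, c) \<Rightarrow> (a, gneg b, c))
    | Kz \<Rightarrow> greflect (gword ks))"

lemma word_gword: "word ks rho = gvec (gword ks)"
proof (induction ks)
  case Nil
  then show ?case by (simp add: rho_gvec gword_rho_def)
next
  case (Cons k ks)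
  obtain a b c where abc: "gword ks = (a, b, c)" by (metis prod_cases3)
  have "gvec (gword ks) \<in> solid_points" using Cons word_solid[OF rho_solid] by metis
  then have "greflectable (gword ks)"
    using greflect_vertex_list by (auto simp: solid_points_eq gvec_eq list_all_iff)
  then show ?case
    using Cons by (cases k) (simp_all add: refl_by_gvec abc, simp_all add: vec_eq_3 reflection_def inner_3 root_coords)
qed

text \<open>Whether two walks meet does not depend on the start, so one computation at
  \<open>rho\<close> proves a relation at every vertex.\<close>

lemma walk_eq_gword: "walk ks i = walk ls i \<longleftrightarrow> gword ks = gword ls"
  by (simp add: walk_eq word_gword gvec_eq)

lemma gword_relations:
  "gword [Kx, Kx] = gword []" "gword [Ky, Ky] = gword []" "gword [Kz, Kz] = gword []"
  "gword [Kx, Ky] = gword [Ky, Kx]"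
  "gword [Kx, Kz, Kx] = gword [Kz, Kx, Kz]"
  "gword [Ky, Kz, Ky, Kz, Ky] = gword [Kz, Ky, Kz, Ky, Kz]"
  by code_simp+

text \<open>No edge of kind \<open>Kz\<close> lies on a 4-cycle: in a cycle through it, the
  neighbouring steps \<open>p\<close> and \<open>r\<close> are of another kind, since otherwise the
  walk would backtrack.\<close>

lemma gword_no_square:
  "list_all (\<lambda>p. list_all (\<lambda>q. list_all (\<lambda>r. gword [Kz, p, q, r] \<noteq> gword []) [Kx, Ky]) [Kx, Ky, Kz]) [Kx, Ky]"
  by code_simp

lemma gword_no_hexagon:
  "list_all (\<lambda>p. list_all (\<lambda>q. gword [Ky, Kz, p, Kz, q, Kz] \<noteq> gword []) [Kx, Ky]) [Kx, Ky]"
  by code_simp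

lemma nbr_nbr [simp]: "nbr k (nbr k i) = i"
  using walk_eq_gword[of "[k, k]" i "[]"] gword_relations by (cases k) simp_all

lemma nbr_commute: "nbr Ky (nbr Kx i) = nbr Kx (nbr Ky i)"
  using walk_eq_gword[of "[Kx, Ky]" i "[Ky, Kx]"] gword_relations(4) by simp

lemma nbr_braid3: "nbr Kx (nbr Kz (nbr Kx i)) = nbr Kz (nbr Kx (nbr Kz i))"
  using walk_eq_gword[of "[Kx, Kz, Kx]" i "[Kz, Kx, Kz]"] gword_relations(5) by simp

lemma nbr_braid5: "nbr Ky (nbr Kz (nbr Ky (nbr Kz (nbr Ky i)))) = nbr Kz (nbr Ky (nbr Kz (nbr Ky (nbr Kz i))))"
  using walk_eq_gword[of "[Ky, Kz, Ky, Kz, Ky]" i "[Kz, Ky, Kz, Ky, Kz]"] gword_relations(6) by simp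

lemma nbr_inject: "nbr j i = nbr k i \<longleftrightarrow> j = k"
proof
  assume "nbr j i = nbr k i"
  then have "word [j] rho = word [k] rho" by (metis walk.simps walk_eq)
  then have "weight j \<bullet> refl_by j rho = weight j \<bullet> refl_by k rho" by simp
  then show "j = k" using golden_ratio_props(3) by (auto simp: weight_refl_rho split: if_splits)
qed simp

lemma nbr_neq: "nbr k i \<noteq> i"
proof
  assume "nbr k i = i"
  then have "word [k] rho = word [] rho" by (metis walk.simps walk_eq)
  then have "weight k \<bullet> refl_by k rho = weight k \<bullet> rho" by simp
  then show False using golden_ratio_props(3) by (simp add: weight_refl_rho)
qed

lemma nbr_nbr_neq: "j \<noteq> k \<Longrightarrow> nbr j (nbr k i) \<noteq> i"
  by (metis nbr_inject nbr_nbr)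

lemma skeleton_edge_iff: "{i, j} \<in> skeleton_edges \<longleftrightarrow> (\<exists>k. j = nbr k i)"
proof -
  let ?w = "inv (frame i)"
  have b: "bij (frame i)" by (rule symmetries_bij[OF frame(1)])
  have w: "?w \<in> symmetries" by (rule symmetries_inv[OF frame(1)])
  have wi: "?w (pos i) = rho" using b frame(2)[of i] by (metis bij_inv_eq_iff)
  have "{i, j} \<in> skeleton_edges \<longleftrightarrow> closed_segment (pos i) (pos j) edge_of solid"
    by (auto simp: skeleton_edges_def doubleton_eq_iff closed_segment_commute)
  also have "\<dots> \<longleftrightarrow> closed_segment rho (?w (pos j)) edge_of solid"
    using symmetry_edge[OF w, of "pos i" "pos j"] by (simp add: wi)
  also have "\<dots> \<longleftrightarrow> (\<exists>k. ?w (pos j) = refl_by k rho)"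
    by (rule edge_at_rho) (simp add: symmetries_solid w)
  also have "\<dots> \<longleftrightarrow> (\<exists>k. j = nbr k i)"
    using b by (simp add: pos_inject[symmetric] pos_nbr) (metis bij_inv_eq_iff)
  finally show ?thesis .
qed

lemma separates_nbr:
  "separates m n i (nbr k i) \<longleftrightarrow> (\<exists>a b. a \<noteq> k \<and> b \<noteq> k \<and> m = facet_size a \<and> n = facet_size b)"
proof -
  define sep where "sep u v \<longleftrightarrow> (\<exists>F F'. ngon_facet m F \<and> ngon_facet n F' \<and> closed_segment u v \<subseteq> F \<inter> F')" for u v
  have sep_sym: "sep (w u) (w v)" if w: "w \<in> symmetries" and s: "sep u v" for w u v
  proof -
    obtain F F' where "ngon_facet m F" "ngon_facet n F'" "closed_segment u v \<subseteq> F \<inter> F'"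
      using s by (auto simp: sep_def)
    moreover have "closed_segment (w u) (w v) = w ` closed_segment u v"
      using symmetries_orth[OF w]
      by (intro closed_segment_linear_image orthogonal_transformation_linear)
    ultimately show ?thesis unfolding sep_def
      by (intro exI[of _ "w ` F"] exI[of _ "w ` F'"]) (auto simp: symmetry_ngon_facet[OF w])
  qed
  let ?w = "inv (frame i)"
  have b: "inv (frame i) (frame i v) = v" for v
    by (simp add: symmetries_bij[OF frame(1)] bij_is_inj)
  have "separates m n i (nbr k i) \<longleftrightarrow> sep (frame i rho) (frame i (refl_by k rho))"
    by (simp add: separates_def sep_def pos_nbr frame(2))
  also have "\<dots> \<longleftrightarrow> sep rho (refl_by k rho)"
    using sep_sym[OF frame(1)] sep_sym[OF symmetries_inv[OF frame(1)], of "frame i rho" "frame i (refl_by k rho)" i]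
    by (auto simp: b)
  finally show ?thesis unfolding sep_def separates_rho .
qed

fun edge_weight :: "real \<times> real \<times> real \<Rightarrow> kind \<Rightarrow> real" where
  "edge_weight (x, y, z) Kx = x"
| "edge_weight (x, y, z) Ky = y"
| "edge_weight (x, y, z) Kz = z"

lemma transition_matrix_nbr: "transition_matrix X $ i $ nbr k i = edge_weight X k"
proof (cases X)
  case (fields x y z)
  have "{i, nbr k i} \<in> skeleton_edges" by (auto simp: skeleton_edge_iff)
  then show ?thesis
    unfolding fields by (cases k) (simp_all add: separates_nbr ex_kind)
qed

lemma transition_matrix_nonedge: "(\<And>k. j \<noteq> nbr k i) \<Longrightarrow> transition_matrix X $ i $ j = 0"
  by (cases X) (simp add: skeleton_edge_iff)

declare transition_matrix.simps [simp del]

lemma transition_matrix_nth: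
  "transition_matrix X $ i $ j = (\<Sum>k\<in>UNIV. if j = nbr k i then edge_weight X k else 0)"
proof (cases "\<exists>k. j = nbr k i")
  case True
  then obtain k where k: "j = nbr k i" by blast
  then show ?thesis by (simp add: transition_matrix_nbr nbr_inject)
next
  case False
  then show ?thesis by (simp add: transition_matrix_nonedge)
qed

lemma transition_matrix_apply:
  "(transition_matrix X *v f) $ i = (\<Sum>k\<in>UNIV. edge_weight X k * f $ nbr k i)"
proof -
  have "(transition_matrix X *v f) $ i
      = (\<Sum>j\<in>UNIV. \<Sum>k\<in>UNIV. if j = nbr k i then edge_weight X k * f $ j else 0)"
    unfolding matrix_vector_mult_def transition_matrix_nth vec_lambda_beta sum_distrib_right
    by (intro sum.cong refl) auto
  also have "\<dots> = (\<Sum>k\<in>UNIV. \<Sum>j\<in>UNIV. if j = nbr k i then edge_weight X k * f $ j else 0)"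
    by (rule sum.swap)
  finally show ?thesis by simp
qed

lemma nbr_flip: "j = nbr k i \<longleftrightarrow> i = nbr k j" by (metis nbr_nbr)

lemma transition_matrix_symmetric: "transition_matrix X $ i $ j = transition_matrix X $ j $ i"
  by (simp add: transition_matrix_nth nbr_flip[of j])

lemma sum_edge_weight: "(\<Sum>k\<in>UNIV. edge_weight (x, y, z) k) = x + y + z"
  by (simp add: UNIV_kind)

lemma transition_matrix_stochastic:
  assumes "X \<in> prob_simplex" shows "transition_matrix X \<in> sym_stochastic skeleton_edges"
proof -
  obtain x y z where X: "X = (x, y, z)" by (cases X)
  have nn: "0 \<le> edge_weight X k" for k using assms by (cases k) (auto simp: X prob_simplex_def)
  have "(\<Sum>j\<in>UNIV. transition_matrix X $ i $ j) = 1" for i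
  proof -
    have "(\<Sum>j\<in>UNIV. transition_matrix X $ i $ j) = (transition_matrix X *v 1) $ i"
      by (simp add: matrix_vector_mult_def)
    also have "\<dots> = 1" using assms by (simp add: transition_matrix_apply sum_edge_weight X prob_simplex_def)
    finally show ?thesis .
  qed
  moreover have "0 \<le> transition_matrix X $ i $ j" for i j
    by (simp add: transition_matrix_nth nn sum_nonneg)
  ultimately show ?thesis
    by (auto simp: sym_stochastic_def skeleton_edge_iff transition_matrix_nonedge
        intro: transition_matrix_symmetric)
qed

section \<open>Edge classes recognised from the graph alone\<close>

definition adj :: "vertex \<Rightarrow> vertex \<Rightarrow> bool" where
  "adj i j \<longleftrightarrow> (\<exists>k. j = nbr k i)"

text \<open>The right-hand side uses adjacency only and is thus preserved by every automorphism:
  edges between a 6-gon and a 10-gon are those on no 4-cycle.\<close>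

lemma nbr_Kz_iff:
  "j = nbr Kz i \<longleftrightarrow> adj i j \<and> \<not> (\<exists>a b. adj j a \<and> adj a b \<and> adj b i \<and> a \<noteq> i \<and> b \<noteq> j)"
proof
  assume j: "j = nbr Kz i"
  have False if ab: "adj j a" "adj a b" "adj b i" "a \<noteq> i" "b \<noteq> j" for a b
  proof -
    obtain p q r where pqr: "a = nbr p j" "b = nbr q a" "i = nbr r b"
      using ab(1-3) by (auto simp: adj_def)
    have "p \<noteq> Kz" using ab(4) pqr(1) j nbr_nbr by metis
    have "r \<noteq> Kz" using ab(5) pqr(3) j nbr_nbr by metis
    have "walk [Kz, p, q, r] i = walk [] i" by (simp flip: j pqr)
    then have "gword [Kz, p, q, r] = gword []" by (simp only: walk_eq_gword)
    then show False using gword_no_square \<open>p \<noteq> Kz\<close> \<open>r \<noteq> Kz\<close>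
      by (cases p; cases q; cases r; simp del: gword.simps)
  qed
  then show "adj i j \<and> \<not> (\<exists>a b. adj j a \<and> adj a b \<and> adj b i \<and> a \<noteq> i \<and> b \<noteq> j)"
    using j by (auto simp: adj_def)
next
  assume *: "adj i j \<and> \<not> (\<exists>a b. adj j a \<and> adj a b \<and> adj b i \<and> a \<noteq> i \<and> b \<noteq> j)"
  then obtain k where k: "j = nbr k i" by (auto simp: adj_def)
  show "j = nbr Kz i"
  proof (rule ccontr)
    assume "j \<noteq> nbr Kz i"
    then have kz: "k \<noteq> Kz" using k by auto
    define l where "l = (if k = Kx then Ky else Kx)"
    have l: "l \<noteq> k" "nbr k (nbr l (nbr k i)) = nbr l i"
      using kz nbr_commute nbr_nbr by (cases k; simp add: l_def)+
    then have "adj j (nbr l j)" "adj (nbr l j) (nbr l i)" "adj (nbr l i) i" "nbr l j \<noteq> i" "nbr l i \<noteq> j"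
      by (auto simp: adj_def k nbr_nbr_neq nbr_inject intro: nbr_flip[THEN iffD1]) (metis nbr_nbr)+
    then show False using * by blast
  qed
qed

text \<open>Once the \<open>Kz\<close> edges are known, the \<open>Kx\<close> edges are the other
  edges through which a closed walk of length six alternates with \<open>Kz\<close> edges, around a
  hexagon. By \<open>gword_no_hexagon\<close> a \<open>Ky\<close> edge admits no such walk.\<close>

lemma nbr_Kx_iff:
  "j = nbr Kx i \<longleftrightarrow> adj i j \<and> j \<noteq> nbr Kz i \<and>
     (\<exists>a b. adj (nbr Kz j) a \<and> a \<noteq> j \<and> adj (nbr Kz a) b \<and> b \<noteq> a \<and> nbr Kz b = i)"
proof
  assume j: "j = nbr Kx i"
  have "nbr Kz (nbr Kx (nbr Kz (nbr Kx (nbr Kz j)))) = i"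
    by (metis j nbr_braid3 nbr_nbr)
  moreover have "nbr Kx (nbr Kz a) \<noteq> a" for a by (simp add: nbr_nbr_neq)
  ultimately show "adj i j \<and> j \<noteq> nbr Kz i \<and>
     (\<exists>a b. adj (nbr Kz j) a \<and> a \<noteq> j \<and> adj (nbr Kz a) b \<and> b \<noteq> a \<and> nbr Kz b = i)"
    using j by (auto simp: adj_def nbr_inject)
next
  assume *: "adj i j \<and> j \<noteq> nbr Kz i \<and>
     (\<exists>a b. adj (nbr Kz j) a \<and> a \<noteq> j \<and> adj (nbr Kz a) b \<and> b \<noteq> a \<and> nbr Kz b = i)"
  then obtain k a b p q where k: "j = nbr k i" "j \<noteq> nbr Kz i" "a = nbr p (nbr Kz j)" "a \<noteq> j"
    "b = nbr q (nbr Kz a)" "b \<noteq> a" "nbr Kz b = i"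
    by (auto simp: adj_def)
  have "p \<noteq> Kz" using k(3,4) nbr_nbr by metis
  have "q \<noteq> Kz" using k(5,6) nbr_nbr by metis
  have "k \<noteq> Kz" using k(1,2) by auto
  have "walk [k, Kz, p, Kz, q, Kz] i = walk [] i" using k(7) by (simp flip: k(1,3,5))
  then have "gword [k, Kz, p, Kz, q, Kz] = gword []" by (simp only: walk_eq_gword)
  then have "k \<noteq> Ky" using gword_no_hexagon \<open>p \<noteq> Kz\<close> \<open>q \<noteq> Kz\<close>
    by (cases p; cases q; auto simp del: gword.simps)
  then have "k = Kx" using \<open>k \<noteq> Kz\<close> by (cases k) auto
  then show "j = nbr Kx i" using k by simp
qed

lemma nbr_Ky_iff: "j = nbr Ky i \<longleftrightarrow> adj i j \<and> j \<noteq> nbr Kx i \<and> j \<noteq> nbr Kz i"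
  by (auto simp: adj_def nbr_inject) (metis kind.exhaust)

lemma graph_aut_nbr:
  assumes s: "\<sigma> \<in> graph_aut skeleton_edges" shows "\<sigma> (nbr k i) = nbr k (\<sigma> i)"
proof -
  have bij: "bij \<sigma>" and adj: "\<And>i j. adj (\<sigma> i) (\<sigma> j) \<longleftrightarrow> adj i j"
    using s by (auto simp: graph_aut_def adj_def skeleton_edge_iff)
  have eq: "\<sigma> a = \<sigma> b \<longleftrightarrow> a = b" for a b using bij by (meson bij_is_inj inj_eq)
  \<comment> \<open>By surjectivity the quantified vertices may be taken as images, which transfers
    the graph descriptions from \<open>i\<close> to \<open>\<sigma> i\<close>.\<close>
  have ex: "(\<exists>a. Q a) \<longleftrightarrow> (\<exists>a. Q (\<sigma> a))" for Q using bij by (metis bij_pointE)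
  have z: "\<sigma> (nbr Kz i) = nbr Kz (\<sigma> i)" for i
    unfolding nbr_Kz_iff[of "\<sigma> (nbr Kz i)" "\<sigma> i"]
    using nbr_Kz_iff[of "nbr Kz i" i] by (subst ex, subst (2) ex) (simp add: adj eq)
  have x: "\<sigma> (nbr Kx i) = nbr Kx (\<sigma> i)" for i
    unfolding nbr_Kx_iff[of "\<sigma> (nbr Kx i)" "\<sigma> i"] z[symmetric]
    using nbr_Kx_iff[of "nbr Kx i" i]
    by (subst ex, subst (2) ex) (simp add: adj eq z[symmetric])
  have y: "\<sigma> (nbr Ky i) = nbr Ky (\<sigma> i)" for i
    unfolding nbr_Ky_iff[of "\<sigma> (nbr Ky i)" "\<sigma> i"] z[symmetric] x[symmetric]
    using nbr_Ky_iff[of "nbr Ky i" i] by (simp add: adj eq)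
  show ?thesis by (cases k) (simp_all add: x y z)
qed

lemma graph_aut_transitive:
  "\<exists>\<sigma>\<in>graph_aut skeleton_edges. \<sigma> i = j"
proof -
  define w where "w = frame j \<circ> inv (frame i)"
  have w: "w \<in> symmetries" by (simp add: w_def symmetries_comp symmetries_inv frame)
  have wi: "w (pos i) = pos j"
    using symmetries_bij[OF frame(1), of i] by (simp add: w_def bij_is_inj flip: frame(2))
  define \<sigma> where "\<sigma> a = Abs_vertex (w (pos a))" for a
  have pos_s: "pos (\<sigma> a) = w (pos a)" for a by (simp add: \<sigma>_def symmetries_solid w)
  have "inj \<sigma>"
    using bij_is_inj[OF symmetries_bij[OF w]]
    by (intro injI) (metis inj_eq pos_inject pos_s)
  then have bij: "bij \<sigma>" by (simp add: bij_def finite_UNIV_inj_surj)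
  have "frame (\<sigma> a) = w \<circ> frame a" for a
    by (rule frame_eq) (simp_all add: symmetries_comp w frame pos_s)
  then have n: "nbr k (\<sigma> a) = \<sigma> (nbr k a)" for k a
    by (simp add: pos_inject[symmetric] pos_nbr pos_s)
  have "\<sigma> \<in> graph_aut skeleton_edges"
    using bij by (auto simp: graph_aut_def skeleton_edge_iff n bij_is_inj inj_eq)
  moreover have "\<sigma> i = j" by (simp add: pos_inject[symmetric] pos_s wi)
  ultimately show ?thesis by blast
qed

text \<open>Automorphisms preserve the kinds of edges and act transitively, so an invariant matrix
  is determined by its three entries at a single vertex.\<close>

lemma transition_matrix_bij:
  "bij_betw transition_matrix prob_simplex (invariant_transitions skeleton_edges)"
proof (rule bij_betwI')
  fix X Y
  show "(transition_matrix X = transition_matrix Y) = (X = Y)"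
  proof
    assume eq: "transition_matrix X = transition_matrix Y"
    have "edge_weight X k = edge_weight Y k" for k
      using transition_matrix_nbr[of X undefined k] transition_matrix_nbr[of Y undefined k] eq by simp
    from this[of Kx] this[of Ky] this[of Kz] show "X = Y" by (cases X; cases Y) simp
  qed simp
next
  fix X assume X: "X \<in> prob_simplex"
  have "transition_matrix X $ i $ i = 0" for i
    by (rule transition_matrix_nonedge) (metis nbr_neq)
  moreover have "transition_matrix X $ \<sigma> i $ \<sigma> j = transition_matrix X $ i $ j"
    if s: "\<sigma> \<in> graph_aut skeleton_edges" for \<sigma> i j
  proof -
    have "inj \<sigma>" using s by (auto simp: graph_aut_def bij_is_inj)
    then show ?thesis by (simp add: transition_matrix_nth inj_eq flip: graph_aut_nbr[OF s])
  qed
  ultimately show "transition_matrix X \<in> invariant_transitions skeleton_edges"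
    by (simp add: invariant_transitions_def transition_matrix_stochastic[OF X])
next
  fix P assume "P \<in> invariant_transitions skeleton_edges"
  then have P: "P \<in> sym_stochastic skeleton_edges" and diag: "\<And>i. P $ i $ i = 0"
    and inv: "\<And>\<sigma> i j. \<sigma> \<in> graph_aut skeleton_edges \<Longrightarrow> P $ \<sigma> i $ \<sigma> j = P $ i $ j"
    by (auto simp: invariant_transitions_def)
  define i0 where "i0 = (undefined :: vertex)"
  define X where "X = (P $ i0 $ nbr Kx i0, P $ i0 $ nbr Ky i0, P $ i0 $ nbr Kz i0)"
  have ew: "edge_weight X k = P $ i0 $ nbr k i0" for k by (cases k) (simp_all add: X_def)
  have n: "P $ i $ nbr k i = edge_weight X k" for i k
  proof -
    obtain \<sigma> where s: "\<sigma> \<in> graph_aut skeleton_edges" "\<sigma> i0 = i" using graph_aut_transitive by blast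
    then show ?thesis using inv[OF s(1), of i0 "nbr k i0"] graph_aut_nbr[OF s(1), of k i0] by (simp add: ew)
  qed
  have eq: "P = transition_matrix X"
  proof (simp only: vec_eq_iff, intro allI)
    fix i j
    show "P $ i $ j = transition_matrix X $ i $ j"
    proof (cases "\<exists>k. j = nbr k i")
      case True
      then show ?thesis by (auto simp: n transition_matrix_nbr)
    next
      case False
      then have "P $ i $ j = 0"
        using P diag by (cases "i = j") (auto simp: sym_stochastic_def skeleton_edge_iff)
      then show ?thesis using False by (simp add: transition_matrix_nonedge)
    qed
  qed
  have "(\<Sum>k\<in>UNIV. edge_weight X k) = (P *v 1) $ i0"
    unfolding eq by (simp add: transition_matrix_apply)
  also have "\<dots> = 1" by (simp add: stochastic_one[OF P])
  finally have "X \<in> prob_simplex"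
    using P by (simp add: UNIV_kind prob_simplex_def X_def sym_stochastic_def)
  then show "\<exists>X\<in>prob_simplex. P = transition_matrix X" using eq by blast
qed

section \<open>The second eigenvalue on the open simplex\<close>

definition shift :: "kind \<Rightarrow> real^vertex \<Rightarrow> real^vertex" where
  "shift k f = (\<chi> i. f $ nbr k i)"

lemma shift_nth [simp]: "shift k f $ i = f $ nbr k i"
  by (simp add: shift_def)

lemma inner_involution_shift: "inner_involution (shift k)"
proof -
  have "linear (shift k)" by (rule linearI) (simp_all add: vec_eq_iff)
  moreover have "shift k f \<bullet> g = f \<bullet> shift k g" for f g
    unfolding inner_vec_def
    by (rule sum.reindex_bij_witness[of _ "nbr k" "nbr k"]) simp_all
  ultimately show ?thesis by (simp add: inner_involution_def vec_eq_iff)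
qed

lemma angle_bound_shift:
  "angle_bound 0 (shift Kx) (shift Ky)" "angle_bound 0 (shift Ky) (shift Kx)"
  "angle_bound (1 / 2) (shift Kx) (shift Kz)" "angle_bound (1 / 2) (shift Kz) (shift Kx)"
  "angle_bound (golden_ratio / 2) (shift Ky) (shift Kz)"
  "angle_bound (golden_ratio / 2) (shift Kz) (shift Ky)"
  by (intro angle_bound_2 angle_bound_3 angle_bound_5 inner_involution_shift;
      simp add: vec_eq_iff nbr_commute nbr_braid3 nbr_braid5)+

lemma transition_matrix_shift:
  "transition_matrix (x, y, z) *v f = x *\<^sub>R shift Kx f + y *\<^sub>R shift Ky f + z *\<^sub>R shift Kz f"
  by (simp add: vec_eq_iff transition_matrix_apply UNIV_kind)

lemma shift_invariant_const:
  assumes "\<And>k. shift k f = f" shows "f = (f $ i) *\<^sub>R 1"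
proof -
  have "f $ nbr k j = f $ j" for k j using assms[of k] by (metis shift_nth)
  then have "f $ j = f $ i" for j
    by (rule_tac vertex_connected[of "\<lambda>j. f $ j = f $ i" i]) auto
  then show ?thesis by (simp add: vec_eq_iff)
qed

lemma frame_linear: "linear (frame i)"
  using symmetries_orth[OF frame(1)] by (rule orthogonal_transformation_linear)

lemma frame_surj: "surj (frame i)"
  using symmetries_bij[OF frame(1)] by (rule bij_is_surj)

lemma vec_eq_root_inner:
  assumes "\<And>k. simple_root k \<bullet> u = simple_root k \<bullet> v" shows "u = v"
  using weight_expansion[of u] weight_expansion[of v] assms by simp

text \<open>A positive eigenvector of the weighted Gram matrix of the simple roots: \<open>(kx, ky, kz)\<close> are
  the heights of a point of the open chamber over the three walls, and the spectral representation
  for the eigenvalue \<open>1 - 2 m\<close> maps the vertices to the orbit of this point.\<close>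

locale perron =
  fixes x y z m kx ky kz :: real
  assumes pos: "0 < x" "0 < y" "0 < z" "0 < kx" "0 < ky" "0 < kz" "0 < m"
    and sum: "x + y + z = 1"
    and eqx: "x * kx - z * kz / 2 = m * kx"
    and eqy: "y * ky - golden_ratio * z * kz / 2 = m * ky"
    and eqz: "z * kz - x * kx / 2 - golden_ratio * y * ky / 2 = m * kz"
begin

abbreviation P :: "real^vertex^vertex" where "P \<equiv> transition_matrix (x, y, z)"

fun height :: "kind \<Rightarrow> real" where
  "height Kx = kx" | "height Ky = ky" | "height Kz = kz"

definition \<xi> :: "real^3" where "\<xi> = (\<Sum>k\<in>UNIV. height k *\<^sub>R weight k)"

definition \<psi> :: "real^3 \<Rightarrow> real^vertex" where "\<psi> u = (\<chi> i. u \<bullet> frame i \<xi>)"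

lemma height_pos: "0 < height k" using pos by (cases k) auto

lemma root_\<xi>: "simple_root k \<bullet> \<xi> = height k"
proof -
  have "simple_root k \<bullet> \<xi> = (\<Sum>j\<in>UNIV. height j * (weight j \<bullet> simple_root k))"
    by (simp add: \<xi>_def inner_sum_right inner_commute)
  also have "\<dots> = height k" by (simp add: weight_root if_distrib cong: if_cong)
  finally show ?thesis .
qed

text \<open>The equations \<open>eqx\<close>, \<open>eqy\<close>, \<open>eqz\<close> are this vector
  identity paired with the three simple roots.\<close>

lemma sum_root_\<xi>: "(\<Sum>k\<in>UNIV. (edge_weight (x, y, z) k * height k) *\<^sub>R simple_root k) = m *\<^sub>R \<xi>"
proof (rule vec_eq_root_inner)
  fix j
  have "(\<Sum>k\<in>UNIV. edge_weight (x, y, z) k * height k * - bond j k) = m * height j"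
  proof (cases j)
    case Kx then show ?thesis using eqx by (simp add: UNIV_kind algebra_simps)
  next
    case Ky then show ?thesis using eqy by (simp add: UNIV_kind algebra_simps)
  next
    case Kz then show ?thesis using eqz by (simp add: UNIV_kind algebra_simps)
  qed
  then show "simple_root j \<bullet> (\<Sum>k\<in>UNIV. (edge_weight (x, y, z) k * height k) *\<^sub>R simple_root k) = simple_root j \<bullet> (m *\<^sub>R \<xi>)"
    by (simp add: inner_sum_right root_inner root_\<xi>)
qed

text \<open>The weights \<open>X\<close> are independent of the heights behind
  \<open>\<psi>\<close>, because these functions also serve as test functions for other transition
  matrices.\<close>

lemma transition_\<psi>:
  assumes "(\<Sum>k\<in>UNIV. edge_weight X k) = 1"
  shows "(transition_matrix X *v \<psi> u) $ i
    = u \<bullet> frame i (\<xi> - 2 *\<^sub>R (\<Sum>k\<in>UNIV. (edge_weight X k * height k) *\<^sub>R simple_root k))"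
proof -
  have "(\<Sum>k\<in>UNIV. edge_weight X k *\<^sub>R refl_by k \<xi>)
    = (\<Sum>k\<in>UNIV. edge_weight X k *\<^sub>R \<xi> - 2 *\<^sub>R ((edge_weight X k * height k) *\<^sub>R simple_root k))"
    by (rule sum.cong) (simp_all add: reflection_def root_\<xi> scaleR_diff_right algebra_simps)
  also have "\<dots> = \<xi> - 2 *\<^sub>R (\<Sum>k\<in>UNIV. (edge_weight X k * height k) *\<^sub>R simple_root k)"
    using assms by (simp add: sum_subtractf scaleR_sum_right flip: scaleR_sum_left)
  finally have *: "(\<Sum>k\<in>UNIV. edge_weight X k *\<^sub>R refl_by k \<xi>) = \<dots>" .
  have "(transition_matrix X *v \<psi> u) $ i = u \<bullet> frame i (\<Sum>k\<in>UNIV. edge_weight X k *\<^sub>R refl_by k \<xi>)"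
    by (simp add: transition_matrix_apply \<psi>_def frame_nbr linear_sum[OF frame_linear]
        linear_cmul[OF frame_linear] inner_sum_right)
  then show ?thesis unfolding * .
qed

lemma sum_weight: "(\<Sum>k\<in>UNIV. edge_weight (x, y, z) k) = 1"
  using sum by (simp add: sum_edge_weight)

lemma P_\<psi>: "P *v \<psi> u = (1 - 2 * m) *\<^sub>R \<psi> u"
proof -
  have "\<xi> - 2 *\<^sub>R (m *\<^sub>R \<xi>) = (1 - 2 * m) *\<^sub>R \<xi>" by (simp add: algebra_simps)
  then have "(P *v \<psi> u) $ i = ((1 - 2 * m) *\<^sub>R \<psi> u) $ i" for i
    unfolding transition_\<psi>[OF sum_weight] sum_root_\<xi>
    by (simp only:) (simp add: \<psi>_def linear_cmul[OF frame_linear])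
  then show ?thesis by (subst vec_eq_iff) blast
qed

text \<open>The source of both uniqueness arguments, in the strict convexity and for the minimiser:
  pairing with the dual weights recovers each transition probability from \<open>\<xi>\<close> and
  the factor \<open>c\<close>.\<close>

lemma \<psi>_eigen_determines_weights:
  assumes one: "(\<Sum>k\<in>UNIV. edge_weight X k) = 1"
    and eig: "\<And>u. transition_matrix X *v \<psi> u = (1 - 2 * c) *\<^sub>R \<psi> u"
  shows "edge_weight X k * height k = c * (weight k \<bullet> \<xi>)"
proof -
  let ?S = "\<Sum>k\<in>UNIV. (edge_weight X k * height k) *\<^sub>R simple_root k"
  define i where "i = (undefined :: vertex)"
  define a b where "a = frame i (\<xi> - 2 *\<^sub>R ?S)" and "b = frame i ((1 - 2 * c) *\<^sub>R \<xi>)"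
  have "u \<bullet> a = u \<bullet> b" for u
    using eig[of u] transition_\<psi>[OF one, of u i]
    by (simp add: a_def b_def \<psi>_def linear_cmul[OF frame_linear])
  then have "a = b" using vector_eq_ldot[of a b] by blast
  then have "frame i (\<xi> - 2 *\<^sub>R ?S) = frame i ((1 - 2 * c) *\<^sub>R \<xi>)" by (simp only: a_def b_def)
  then have "\<xi> - 2 *\<^sub>R ?S = (1 - 2 * c) *\<^sub>R \<xi>"
    using symmetries_bij[OF frame(1)] by (meson bij_is_inj inj_eq)
  then have "2 *\<^sub>R ?S = 2 *\<^sub>R (c *\<^sub>R \<xi>)" by (simp add: algebra_simps)
  then have S: "?S = c *\<^sub>R \<xi>" by (simp only: scaleR_cancel_left) simp
  have "weight k \<bullet> ?S = edge_weight X k * height k"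
    by (simp add: inner_sum_right weight_root if_distrib cong: if_cong)
  then show ?thesis by (simp add: S)
qed

lemma linear_\<psi>: "linear \<psi>"
  by (rule linearI) (simp_all add: \<psi>_def vec_eq_iff inner_add_left)

text \<open>The difference of the orbit points at adjacent vertices is a nonzero multiple of a moved
  simple root, and these roots span the space.\<close>

lemma inj_\<psi>: "inj \<psi>"
  unfolding linear_injective_0[OF linear_\<psi>]
proof (intro allI impI)
  fix u assume "\<psi> u = 0"
  then have 0: "u \<bullet> frame i \<xi> = 0" for i by (metis \<psi>_def vec_lambda_beta zero_index)
  define i where "i = (undefined :: vertex)"
  have r: "u \<bullet> frame i (simple_root k) = 0" for k
  proof -
    have "u \<bullet> frame i (refl_by k \<xi>) = 0" using 0[of "nbr k i"] by (simp add: frame_nbr)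
    then have "2 * height k * (u \<bullet> frame i (simple_root k)) = 0"
      using 0[of i] by (simp add: reflection_def root_\<xi> linear_diff[OF frame_linear]
          linear_cmul[OF frame_linear] inner_diff_right)
    then show ?thesis using height_pos[of k] by simp
  qed
  have "u \<bullet> frame i v = 0" for v
    by (subst root_expansion[of v])
      (simp add: linear_sum[OF frame_linear] linear_cmul[OF frame_linear] inner_sum_right r)
  then have "u \<bullet> v = 0" for v using frame_surj[of i] by (metis surjD)
  then show "u = 0" by (metis inner_eq_zero_iff)
qed

lemma stochastic: "P \<in> sym_stochastic skeleton_edges"
  using pos sum by (intro transition_matrix_stochastic) (simp add: prob_simplex_def)

lemma eigenvector_gap:
  assumes f: "P *v f = l *\<^sub>R f"
  shows "x *\<^sub>R (f - shift Kx f) + y *\<^sub>R (f - shift Ky f) + z *\<^sub>R (f - shift Kz f) = (1 - l) *\<^sub>R f"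
proof -
  have "x *\<^sub>R (f - shift Kx f) + y *\<^sub>R (f - shift Ky f) + z *\<^sub>R (f - shift Kz f)
      = (x + y + z) *\<^sub>R f - P *v f"
    by (simp add: transition_matrix_shift algebra_simps)
  then show ?thesis by (simp add: sum f scaleR_diff_left)
qed

lemmas gap = spectral_gap[OF inner_involution_shift[of Kx] inner_involution_shift[of Ky]
    inner_involution_shift[of Kz] angle_bound_shift pos eqx eqy eqz eigenvector_gap]

lemma eigenvalue_nonconst:
  assumes "P *v f = l *\<^sub>R f" "shift k f \<noteq> f" shows "l \<le> 1 - 2 * m"
proof -
  have "\<not> (shift Kx f = f \<and> shift Ky f = f \<and> shift Kz f = f)"
    using assms(2) by (cases k) auto
  from gap(1)[OF assms(1) this] show ?thesis by simp
qed

lemma eigenvalue_const: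
  assumes "P *v f = l *\<^sub>R f" "f \<noteq> 0" "\<And>k. shift k f = f" shows "l = 1"
proof -
  have "(1 - l) *\<^sub>R f = 0" using eigenvector_gap[OF assms(1)] assms(3) by simp
  then show ?thesis using assms(2) by simp
qed

lemma multiplicity_one: "multiplicity_of P 1 = 1"
proof -
  have "eigenspace P 1 = span {1}"
  proof
    show "eigenspace P 1 \<subseteq> span {1}"
    proof
      fix f assume "f \<in> eigenspace P 1"
      then have f: "P *v f = 1 *\<^sub>R f" by (simp add: eigenspace_def)
      have "shift k f = f" for k using eigenvalue_nonconst[OF f, of k] pos by auto
      then show "f \<in> span {1}" using shift_invariant_const by (metis span_breakdown_eq span_empty
            singletonI span_base span_scale)
    qed
    show "span {1} \<subseteq> eigenspace P 1"
      using stochastic_one[OF stochastic]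
      by (intro span_minimal subspace_eigenspace) (simp add: eigenspace_def)
  qed
  moreover have "(1 :: real^vertex) \<noteq> 0" by (simp add: vec_eq_iff)
  ultimately show ?thesis by (simp add: multiplicity_of_def dim_span_eq_card_independent)
qed

text \<open>For an eigenfunction the equality case expresses each difference
  \<open>f - shift k f\<close> at a neighbour by the differences at the vertex itself. If the three
  differences vanish at one vertex they vanish everywhere, so \<open>T\<close>, which records them
  at \<open>i\<close>, is injective on the eigenspace.\<close>

lemma dim_eigenspace_le: "dim (eigenspace P (1 - 2 * m)) \<le> 3"
proof -
  let ?E = "eigenspace P (1 - 2 * m)"
  define i where "i = (undefined :: vertex)"
  define T :: "real^vertex \<Rightarrow> real^3" where
    "T f = (\<Sum>k\<in>UNIV. ((f - shift k f) $ i) *\<^sub>R weight k)" for f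
  have lin: "linear T"
    by (rule linearI) (simp_all add: T_def scaleR_sum_right sum_subtractf sum.distrib algebra_simps)
  have root_T: "simple_root k \<bullet> T f = (f - shift k f) $ i" for k f
  proof -
    have "simple_root k \<bullet> T f = (\<Sum>j\<in>UNIV. (f - shift j f) $ i * (weight j \<bullet> simple_root k))"
      by (simp add: T_def inner_sum_right inner_commute)
    also have "\<dots> = (f - shift k f) $ i" by (simp add: weight_root if_distrib cong: if_cong)
    finally show ?thesis .
  qed
  have "f = 0" if f: "f \<in> ?E" and T0: "T f = 0" for f
  proof (rule ccontr)
    assume "f \<noteq> 0"
    have eig: "P *v f = (1 - 2 * m) *\<^sub>R f" using f by (simp add: eigenspace_def)
    have "\<not> (shift Kx f = f \<and> shift Ky f = f \<and> shift Kz f = f)"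
    proof
      assume "shift Kx f = f \<and> shift Ky f = f \<and> shift Kz f = f"
      then have "shift k f = f" for k by (cases k) auto
      then show False using eigenvalue_const[OF eig \<open>f \<noteq> 0\<close>] pos by simp
    qed
    note rel = gap(2)[OF eig this]
    define d where "d k = f - shift k f" for k
    have "\<exists>c. shift j (d k) = d k + c *\<^sub>R d j" for j k
    proof (cases "j = k")
      case True
      have "shift k (d k) = d k + (- 2) *\<^sub>R d k" by (simp add: d_def vec_eq_iff)
      then show ?thesis using True by blast
    next
      case False
      have "\<exists>c. d k = d k + c *\<^sub>R d j" by (rule exI[of _ 0]) simp
      then show ?thesis using rel False unfolding d_def
        by (cases j; cases k) auto
    qed
    then obtain c where c: "shift j (d k) = d k + c j k *\<^sub>R d j" for j k by metis
    have "\<forall>k. d k $ j = 0" for j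
    proof (rule vertex_connected[of "\<lambda>j. \<forall>k. d k $ j = 0" i])
      show "\<forall>k. d k $ i = 0" using root_T[of _ f] T0 by (simp add: d_def)
      fix j l assume *: "\<forall>k. d k $ j = 0"
      show "\<forall>k. d k $ nbr l j = 0"
      proof
        fix k
        have "d k $ nbr l j = shift l (d k) $ j" by simp
        also have "\<dots> = 0" unfolding c using * by simp
        finally show "d k $ nbr l j = 0" .
      qed
    qed
    then have "shift k f = f" for k by (metis d_def eq_iff_diff_eq_0 vec_eq_iff zero_index)
    then show False using eigenvalue_const[OF eig \<open>f \<noteq> 0\<close>] pos by simp
  qed
  then have inj: "inj_on T ?E"
    using linear_inj_on_iff_eq_0[OF lin subspace_eigenspace, of P "1 - 2 * m"] by simp
  have span: "span ?E = ?E" by (rule span_eq_iff[THEN iffD2]) (rule subspace_eigenspace)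
  have "inj_on T (span ?E)" unfolding span by (rule inj)
  then have "dim ?E = dim (T ` ?E)" using dim_image_eq[OF lin] by metis
  also have "\<dots> \<le> 3" using dim_subset_UNIV[of "T ` ?E"] by simp
  finally show ?thesis .
qed

lemma eigenspace_eq: "eigenspace P (1 - 2 * m) = range \<psi>"
  and multiplicity_eq: "multiplicity_of P (1 - 2 * m) = 3"
proof -
  have "dim (range \<psi>) = 3" using dim_image_eq[OF linear_\<psi>, of UNIV] inj_\<psi> by simp
  moreover have sub: "range \<psi> \<subseteq> eigenspace P (1 - 2 * m)" by (auto simp: eigenspace_def P_\<psi>)
  moreover have "subspace (range \<psi>)" using linear_subspace_image[OF linear_\<psi> subspace_UNIV] .
  ultimately show eq: "eigenspace P (1 - 2 * m) = range \<psi>"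
    using subspace_dim_equal[of "range \<psi>" "eigenspace P (1 - 2 * m)"] subspace_eigenspace dim_eigenspace_le
    by metis
  show "multiplicity_of P (1 - 2 * m) = 3"
    unfolding multiplicity_of_def eq by fact
qed

lemma \<psi>_orth_one: "\<psi> u \<bullet> 1 = 0"
proof -
  have "(P *v \<psi> u) \<bullet> 1 = \<psi> u \<bullet> (P *v 1)"
    by (rule inner_symmetric_matrix) (rule transition_matrix_symmetric)
  then have "m * (\<psi> u \<bullet> 1) = 0" by (simp add: P_\<psi> stochastic_one[OF stochastic] algebra_simps)
  then show ?thesis using pos by simp
qed

lemma \<psi>_nonzero: "\<psi> (axis 1 1) \<noteq> 0"
  using linear_injective_0[OF linear_\<psi>] inj_\<psi> by (metis axis_eq_0_iff one_neq_zero)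

lemma eigval_eq: "eigval P 1 = 1 - 2 * m"
proof (rule antisym)
  show "eigval P 1 \<le> 1 - 2 * m"
  proof (rule eigval_1_le[OF _ multiplicity_one _ P_\<psi> \<psi>_nonzero])
    show "P $ i $ j = P $ j $ i" for i j by (rule transition_matrix_symmetric)
    show "1 - 2 * m \<noteq> 1" using pos by simp
    show "l \<le> 1 - 2 * m" if "P *v f = l *\<^sub>R f" "f \<noteq> 0" "l \<noteq> 1" for l f
      using eigenvalue_nonconst eigenvalue_const that by metis
  qed
  show "1 - 2 * m \<le> eigval P 1"
  proof (rule eigval_1_ge[OF _ stochastic_one[OF stochastic] P_\<psi> \<psi>_nonzero \<psi>_orth_one])
    show "P $ i $ j = P $ j $ i" for i j by (rule transition_matrix_symmetric)
  qed (use pos in simp)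
qed

end

section \<open>The characteristic polynomial of the weighted Gram matrix\<close>

definition char_poly3 :: "real \<Rightarrow> real \<Rightarrow> real \<Rightarrow> real \<Rightarrow> real" where
  "char_poly3 x y z m =
     (z - m) * (x - m) * (y - m) - z / 4 * (x * (y - m) + (golden_ratio + 1) * y * (x - m))"

text \<open>With \<open>kz = 1\<close> the first two eigenvector equations give the other entries,
  positive because \<open>m < x\<close> and \<open>m < y\<close>, and the third is the condition on
  the root.\<close>

lemma perron_of_root:
  assumes xyz: "0 < x" "0 < y" "0 < z" "x + y + z = 1" and m: "0 < m" "m < x" "m < y"
    and root: "char_poly3 x y z m = 0"
  shows "perron x y z m (z / (2 * (x - m))) (golden_ratio * z / (2 * (y - m))) 1"
proof
  define a b where "a = x - m" and "b = y - m"
  have ab: "0 < a" "0 < b" "x = m + a" "y = m + b" using m by (auto simp: a_def b_def)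
  show "0 < z / (2 * (x - m))" "0 < golden_ratio * z / (2 * (y - m))"
    using xyz m golden_ratio_props(3) by simp_all
  show "x * (z / (2 * (x - m))) - z * 1 / 2 = m * (z / (2 * (x - m)))"
    using ab unfolding a_def[symmetric] by (simp add: field_simps)
  show "y * (golden_ratio * z / (2 * (y - m))) - golden_ratio * z * 1 / 2 = m * (golden_ratio * z / (2 * (y - m)))"
    using ab unfolding b_def[symmetric] by (simp add: field_simps)
  have r: "(z - m) * a * b = z / 4 * (x * b + (golden_ratio + 1) * y * a)"
    using root by (simp add: char_poly3_def a_def b_def)
  have "z - x * z / (4 * a) - (golden_ratio * golden_ratio) * y * z / (4 * b) - m
    = ((z - m) * a * b - z / 4 * (x * b + (golden_ratio + 1) * y * a)) / (a * b)"
    using ab(1,2) unfolding golden_ratio_props(1) by (simp add: field_simps)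
  also have "\<dots> = 0" by (simp add: r)
  finally show "z * 1 - x * (z / (2 * (x - m))) / 2 - golden_ratio * y * (golden_ratio * z / (2 * (y - m))) / 2 = m * 1"
    unfolding a_def[symmetric] b_def[symmetric] by (simp add: mult.assoc mult.left_commute)
qed (use assms in auto)

text \<open>Intermediate values: the polynomial is positive at 0, as
  \<open>golden_ratio < 2\<close>, and negative at the smaller of \<open>x\<close> and
  \<open>y\<close> if these differ.\<close>

lemma char_poly3_root_exists:
  assumes xyz: "0 < x" "0 < y" "0 < z"
  shows "\<exists>m. 0 < m \<and> m < x \<and> m < y \<and> char_poly3 x y z m = 0"
proof -
  note g = golden_ratio_props(3,4)
  have "char_poly3 x y z 0 = z * x * y * (2 - golden_ratio) / 4"
    by (simp add: char_poly3_def field_simps)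
  moreover have "0 < z * x * y * (2 - golden_ratio)" using xyz g by simp
  ultimately have p0: "0 < char_poly3 x y z 0" by simp
  have cont: "continuous_on S (char_poly3 x y z)" for S
    unfolding char_poly3_def by (intro continuous_intros)
  have *: ?thesis if b: "0 < b" "b \<le> x" "b \<le> y" "char_poly3 x y z b < 0" for b
  proof -
    obtain m where "0 \<le> m" "m \<le> b" "char_poly3 x y z m = 0"
      using IVT2'[of "char_poly3 x y z" b 0 0] p0 b cont by auto
    moreover from this have "m \<noteq> 0" "m \<noteq> b" using p0 b by auto
    ultimately show ?thesis using b by (intro exI[of _ m]) auto
  qed
  consider "x < y" | "y < x" | "x = y" by linarith
  then show ?thesis
  proof cases
    case 1
    have "char_poly3 x y z x = - (z / 4 * (x * (y - x)))" by (simp add: char_poly3_def)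
    then show ?thesis using * [of x] 1 xyz by simp
  next
    case 2
    have "char_poly3 x y z y = - (z / 4 * ((golden_ratio + 1) * y * (x - y)))" by (simp add: char_poly3_def)
    then show ?thesis using * [of y] 2 xyz g by simp
  next
    case 3
    \<comment> \<open>For \<open>x = y\<close> the polynomial vanishes at \<open>x\<close> itself,
      so its quadratic cofactor after removing \<open>x - m\<close> is used.\<close>
    define q where "q m = (z - m) * (x - m) - z / 4 * ((golden_ratio + 2) * x)" for m
    have "q 0 = z * x * (2 - golden_ratio) / 4" by (simp add: q_def field_simps)
    moreover have "0 < z * x * (2 - golden_ratio)" using xyz g by simp
  ultimately have q0: "0 < q 0" by simp
    have qx: "q x < 0" using xyz g by (simp add: q_def)
    have "continuous_on {0..x} q" unfolding q_def by (intro continuous_intros)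
    then obtain m where m: "0 \<le> m" "m \<le> x" "q m = 0"
      using IVT2'[of q x 0 0] q0 qx xyz by auto
    then have "m \<noteq> 0" "m \<noteq> x" using q0 qx by auto
    moreover have "char_poly3 x y z m = (x - m) * q m" by (simp add: char_poly3_def q_def 3 algebra_simps add_divide_distrib diff_divide_distrib)
    ultimately show ?thesis using m 3 by (intro exI[of _ m]) auto
  qed
qed

lemma perron_exists:
  assumes "X \<in> int_prob_simplex"
  obtains x y z m kx ky kz where "X = (x, y, z)" "perron x y z m kx ky kz"
proof -
  obtain x y z where X: "X = (x, y, z)" "0 < x" "0 < y" "0 < z" "x + y + z = 1"
    using assms by (auto simp: int_prob_simplex_def prob_simplex_def)
  obtain m where "0 < m" "m < x" "m < y" "char_poly3 x y z m = 0"
    using char_poly3_root_exists X by blast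
  then show ?thesis using that X perron_of_root by blast
qed

section \<open>Strict convexity and analyticity\<close>

lemma edge_weight_convex:
  "edge_weight ((1 - t) *\<^sub>R X + t *\<^sub>R Y) k = (1 - t) * edge_weight X k + t * edge_weight Y k"
  by (cases X; cases Y; cases k) simp_all

lemma transition_matrix_convex:
  "transition_matrix ((1 - t) *\<^sub>R X + t *\<^sub>R Y) *v f
     = (1 - t) *\<^sub>R (transition_matrix X *v f) + t *\<^sub>R (transition_matrix Y *v f)"
  by (simp add: vec_eq_iff transition_matrix_apply edge_weight_convex UNIV_kind) (simp add: algebra_simps)

lemma edge_weight_inject: "(\<And>k. edge_weight X k = edge_weight Y k) \<Longrightarrow> X = Y"
  by (cases X; cases Y) (metis edge_weight.simps)

lemma int_prob_simplexD:
  assumes "X \<in> int_prob_simplex"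
  shows "X \<in> prob_simplex" "(\<Sum>k\<in>UNIV. edge_weight X k) = 1" "0 < edge_weight X k"
  using assms by (cases X; cases k; auto simp: int_prob_simplex_def prob_simplex_def sum_edge_weight)+

lemma convex_int_prob_simplex: "convex int_prob_simplex"
proof (rule convexI)
  fix X Y :: "real \<times> real \<times> real" and u v :: real
  assume X: "X \<in> int_prob_simplex" "Y \<in> int_prob_simplex" and uv: "0 \<le> u" "0 \<le> v" "u + v = 1"
  obtain x y z x' y' z' where eq: "X = (x, y, z)" "Y = (x', y', z')" by (metis prod_cases3)
  have pos: "0 < u * s + v * t" if "0 < s" "0 < t" for s t
  proof (cases "u = 0")
    case True
    then show ?thesis using uv that by simp
  next
    case False
    then have "0 < u * s" using uv that by simp
    moreover have "0 \<le> v * t" using uv that by simp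
    ultimately show ?thesis by linarith
  qed
  have "u * x + v * x' + (u * y + v * y') + (u * z + v * z') = u * (x + y + z) + v * (x' + y' + z')"
    by (simp add: algebra_simps)
  then show "u *\<^sub>R X + v *\<^sub>R Y \<in> int_prob_simplex"
    using X uv pos unfolding eq
    by (auto simp: int_prob_simplex_def prob_simplex_def intro!: less_imp_le[OF pos])
qed

text \<open>The eigenfunctions \<open>\<psi> u\<close> at the intermediate point are test functions
  at both ends, which gives convexity. Equality makes them eigenfunctions at both ends, so the
  weights of \<open>X\<close> and \<open>Y\<close> are proportional, and equal since both sum to
  1.\<close>

lemma eigval_strictly_convex:
  "strictly_convex_on int_prob_simplex (\<lambda>X. eigval (transition_matrix X) 1)"
  unfolding strictly_convex_on_def
proof (intro conjI ballI allI impI convex_int_prob_simplex)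
  fix X Y :: "real \<times> real \<times> real" and t :: real
  assume X: "X \<in> int_prob_simplex" and Y: "Y \<in> int_prob_simplex" and "X \<noteq> Y" and t: "0 < t" "t < 1"
  define W where "W = (1 - t) *\<^sub>R X + t *\<^sub>R Y"
  have "W \<in> int_prob_simplex"
    unfolding W_def using t by (intro convexD[OF convex_int_prob_simplex X Y]) auto
  then obtain x y z m kx ky kz where W: "W = (x, y, z)" and per: "perron x y z m kx ky kz"
    by (rule perron_exists)
  interpret perron x y z m kx ky kz by fact
  define lx ly where "lx = eigval (transition_matrix X) 1" and "ly = eigval (transition_matrix Y) 1"
  have SX: "transition_matrix X \<in> sym_stochastic skeleton_edges"
    and SY: "transition_matrix Y \<in> sym_stochastic skeleton_edges"
    using X Y by (auto intro: transition_matrix_stochastic int_prob_simplexD)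
  have RX: "\<psi> u \<bullet> (transition_matrix X *v \<psi> u) \<le> lx * (\<psi> u \<bullet> \<psi> u)" for u
    unfolding lx_def by (rule rayleigh_le_eigval_1[OF SX \<psi>_orth_one])
  have RY: "\<psi> u \<bullet> (transition_matrix Y *v \<psi> u) \<le> ly * (\<psi> u \<bullet> \<psi> u)" for u
    unfolding ly_def by (rule rayleigh_le_eigval_1[OF SY \<psi>_orth_one])
  have split: "(1 - 2 * m) * (\<psi> u \<bullet> \<psi> u)
    = (1 - t) * (\<psi> u \<bullet> (transition_matrix X *v \<psi> u)) + t * (\<psi> u \<bullet> (transition_matrix Y *v \<psi> u))" for u
  proof -
    have "\<psi> u \<bullet> (P *v \<psi> u) = (1 - 2 * m) * (\<psi> u \<bullet> \<psi> u)" by (simp add: P_\<psi>)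
    then show ?thesis unfolding W[symmetric] W_def transition_matrix_convex
      by (simp add: inner_add_right)
  qed
  have eigW: "eigval (transition_matrix W) 1 = 1 - 2 * m" unfolding W by (rule eigval_eq)
  have "1 - 2 * m < (1 - t) * lx + t * ly"
  proof (rule ccontr)
    assume "\<not> 1 - 2 * m < (1 - t) * lx + t * ly"
    then have le: "(1 - t) * lx + t * ly \<le> 1 - 2 * m" by simp
    have eq: "\<psi> u \<bullet> (transition_matrix X *v \<psi> u) = lx * (\<psi> u \<bullet> \<psi> u)
      \<and> \<psi> u \<bullet> (transition_matrix Y *v \<psi> u) = ly * (\<psi> u \<bullet> \<psi> u)" for u
    proof -
      define n a b where "n = \<psi> u \<bullet> \<psi> u" and "a = lx * n - \<psi> u \<bullet> (transition_matrix X *v \<psi> u)"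
        and "b = ly * n - \<psi> u \<bullet> (transition_matrix Y *v \<psi> u)"
      have ab: "0 \<le> a" "0 \<le> b" using RX[of u] RY[of u] by (simp_all add: a_def b_def n_def)
      have "((1 - t) * lx + t * ly) * n \<le> (1 - 2 * m) * n"
        using le by (intro mult_right_mono) (simp_all add: n_def)
      also have "\<dots> = (1 - t) * (lx * n - a) + t * (ly * n - b)"
        using split[of u] by (simp add: a_def b_def n_def)
      finally have "(1 - t) * a + t * b \<le> 0" by (simp add: algebra_simps)
      moreover have "0 \<le> (1 - t) * a" "0 \<le> t * b" using t ab by simp_all
      ultimately have "(1 - t) * a = 0" "t * b = 0" by linarith+
      then show ?thesis using t by (simp add: a_def b_def n_def)
    qed
    have half: "1 - 2 * ((1 - l) / 2) = l" for l :: real by (simp add: field_simps)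
    have EX: "transition_matrix X *v \<psi> u = (1 - 2 * ((1 - lx) / 2)) *\<^sub>R \<psi> u" for u
      unfolding half using rayleigh_le_eigval_1(2)[OF SX \<psi>_orth_one] eq[of u] by (simp only: lx_def)
    have EY: "transition_matrix Y *v \<psi> u = (1 - 2 * ((1 - ly) / 2)) *\<^sub>R \<psi> u" for u
      unfolding half using rayleigh_le_eigval_1(2)[OF SY \<psi>_orth_one] eq[of u] by (simp only: ly_def)
    define cx cy where "cx = (1 - lx) / 2" and "cy = (1 - ly) / 2"
    have wx: "edge_weight X k * height k = cx * (weight k \<bullet> \<xi>)" for k
      unfolding cx_def by (rule \<psi>_eigen_determines_weights[OF int_prob_simplexD(2)[OF X] EX])
    have wy: "edge_weight Y k * height k = cy * (weight k \<bullet> \<xi>)" for k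
      unfolding cy_def by (rule \<psi>_eigen_determines_weights[OF int_prob_simplexD(2)[OF Y] EY])
    have "(cy * edge_weight X k) * height k = (cx * edge_weight Y k) * height k" for k
      using wx[of k] wy[of k] by (simp add: mult.assoc)
    then have ratio: "cy * edge_weight X k = cx * edge_weight Y k" for k
      using height_pos[of k] by (metis less_irrefl mult_right_cancel)
    then have "(\<Sum>k\<in>UNIV. cy * edge_weight X k) = (\<Sum>k\<in>UNIV. cx * edge_weight Y k)" by simp
    then have "cy = cx"
      by (simp add: int_prob_simplexD(2)[OF X] int_prob_simplexD(2)[OF Y] flip: sum_distrib_left)
    moreover have "cx \<noteq> 0"
      using wx[of Kx] height_pos[of Kx] int_prob_simplexD(3)[OF X, of Kx] by auto
    ultimately have "edge_weight X k = edge_weight Y k" for k using ratio[of k] by simp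
    then show False using edge_weight_inject \<open>X \<noteq> Y\<close> by blast
  qed
  then show "eigval (transition_matrix ((1 - t) *\<^sub>R X + t *\<^sub>R Y)) 1
      < (1 - t) * eigval (transition_matrix X) 1 + t * eigval (transition_matrix Y) 1"
    unfolding W_def[symmetric] eigW lx_def ly_def .
qed

section \<open>Analyticity of the second eigenvalue\<close>

definition power_rep :: "(real \<Rightarrow> real \<Rightarrow> real) \<Rightarrow> bool" where
  "power_rep f \<longleftrightarrow> (\<exists>C. power_bounded 1 C f)"

lemma power_rep_intros:
  "power_rep (\<lambda>h k. a)" "power_rep (\<lambda>h k. h)" "power_rep (\<lambda>h k. k)"
  "power_rep f \<Longrightarrow> power_rep g \<Longrightarrow> power_rep (\<lambda>h k. f h k + g h k)"
  "power_rep f \<Longrightarrow> power_rep g \<Longrightarrow> power_rep (\<lambda>h k. f h k * g h k)"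
proof -
  show c: "power_rep (\<lambda>h k. a)" for a
    using power_bounded_monom[of 1 a 0 0] by (auto simp: power_rep_def)
  show "power_rep (\<lambda>h k. h)" using power_bounded_monom[of 1 1 1 0] by (auto simp: power_rep_def)
  show "power_rep (\<lambda>h k. k)" using power_bounded_monom[of 1 1 0 1] by (auto simp: power_rep_def)
  show "power_rep f \<Longrightarrow> power_rep g \<Longrightarrow> power_rep (\<lambda>h k. f h k + g h k)" for f g
    using power_bounded_add[of 1] by (fastforce simp: power_rep_def)
  show "power_rep f \<Longrightarrow> power_rep g \<Longrightarrow> power_rep (\<lambda>h k. f h k * g h k)" for f g
    using power_bounded_mult[of 1] by (fastforce simp: power_rep_def)
qed

lemma power_rep_diff:
  assumes "power_rep f" "power_rep g" shows "power_rep (\<lambda>h k. f h k - g h k)"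
proof -
  have "power_rep (\<lambda>h k. f h k + (- 1) * g h k)" by (intro power_rep_intros assms)
  then show ?thesis by simp
qed

text \<open>The root is perturbed as \<open>m + t h k\<close>, with \<open>t\<close> a power series.
  Uniqueness of the root is not an issue: by \<open>perron_of_root\<close> and
  \<open>perron.eigval_eq\<close> any root with \<open>0 < m\<close>, \<open>m < x\<close>,
  \<open>m < y\<close> yields the eigenvalue.\<close>

lemma eigval_analytic: "analytic_on_int_simplex (\<lambda>X. eigval (transition_matrix X) 1)"
  unfolding analytic_on_int_simplex_def
proof (rule real_analytic2_onI)
  fix a b assume "(a, b) \<in> {(x, y). (x, y, 1 - x - y) \<in> int_prob_simplex}"
  then have ab: "0 < a" "0 < b" "0 < 1 - a - b" by (auto simp: int_prob_simplex_def)
  define c where "c = 1 - a - b"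
  let ?g = "golden_ratio + 1"
  have g: "0 < golden_ratio" using golden_ratio_props(3) by simp
  obtain m where m: "0 < m" "m < a" "m < b" "char_poly3 a b c m = 0"
    using char_poly3_root_exists[of a b c] ab by (auto simp: c_def)
  define c0 where "c0 h k = char_poly3 (a + h) (b + k) (c - h - k) m" for h k
  define c1 where "c1 h k = (c - h - k) / 4 * ((a + h) + ?g * (b + k))
    - ((a + h - m) * (b + k - m) + (a + h - m) * (c - h - k - m) + (b + k - m) * (c - h - k - m))" for h k
  define c2 where "c2 h k = (a + h - m) + (b + k - m) + (c - h - k - m)" for h k :: real
  have expand: "char_poly3 (a + h) (b + k) (c - h - k) (m + t) = c0 h k + c1 h k * t + c2 h k * t\<^sup>2 - t ^ 3" for h k t
  proof -
    have *: "(Z - t) * (X - t) * (Y - t) - z / 4 * (x * (Y - t) + G * y * (X - t))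
      = (Z * X * Y - z / 4 * (x * Y + G * y * X)) + (z / 4 * (x + G * y) - X * Y - X * Z - Y * Z) * t
        + (X + Y + Z) * t\<^sup>2 - t ^ 3" for X Y Z x y z G :: real
      by (simp add: field_simps power2_eq_square power3_eq_cube)
    show ?thesis
      unfolding char_poly3_def c0_def c1_def c2_def diff_diff_eq[symmetric] by (rule *)
  qed
  define d where "d = c1 0 0"
  \<comment> \<open>\<open>d\<close> is the derivative of the polynomial in \<open>m\<close>, so the
    root is simple. To see the sign, it is multiplied by \<open>A * B\<close>, and the root equation
    replaces \<open>(c - m) * (A * B)\<close>.\<close>
  have "d < 0"
  proof -
    define A B where "A = a - m" and "B = b - m"
    have AB: "0 < A" "0 < B" using m by (simp_all add: A_def B_def)
    have root: "(c - m) * (A * B) = c / 4 * (a * B + ?g * b * A)"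
      using m(4) by (simp add: char_poly3_def A_def B_def)
    have "0 < c / 4 * (a * B + ?g * b * A)" using AB ab g by (simp add: c_def add_pos_pos)
    moreover have "0 < A * B" using AB by simp
    ultimately have cm: "0 < c - m" unfolding root[symmetric] by (metis zero_less_mult_pos2)
    have "(A * B) * (c / 4 * (a + ?g * b)) < (A * B) * (A * B + A * (c - m) + B * (c - m))"
    proof -
      have "(A * B) * (A * B + A * (c - m) + B * (c - m)) = (A * B) * (A * B) + (A + B) * (c / 4 * (a * B + ?g * b * A))"
        unfolding root[symmetric] by (simp add: algebra_simps)
      also have "\<dots> = (A * B) * (c / 4 * (a + ?g * b)) + ((A * B) * (A * B) + c / 4 * (a * B * B + ?g * b * A * A))"
        by (simp add: field_simps)
      finally have "(A * B) * (A * B + A * (c - m) + B * (c - m)) = \<dots>" .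
      moreover have "0 < (A * B) * (A * B) + c / 4 * (a * B * B + ?g * b * A * A)"
        using AB ab g by (simp add: c_def add_pos_pos)
      ultimately show ?thesis by linarith
    qed
    then have "c / 4 * (a + ?g * b) < A * B + A * (c - m) + B * (c - m)"
      using AB by (simp add: mult_less_cancel_left_pos)
    then show ?thesis by (simp add: d_def c1_def A_def B_def)
  qed
  then have d0: "d \<noteq> 0" by simp
  \<comment> \<open>The root equation solved for the linear term \<open>d * t\<close>. Both
    \<open>e0\<close> and \<open>e1\<close> vanish at the origin.\<close>
  define e0 e1 e2 e3 where "e0 h k = (- 1 / d) * c0 h k" and "e1 h k = (- 1 / d) * (c1 h k - d)"
    and "e2 h k = (- 1 / d) * c2 h k" and "e3 h k = 1 / d" for h k :: real
  have rep: "power_rep c0" "power_rep c1" "power_rep c2"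
    unfolding c0_def c1_def c2_def char_poly3_def divide_inverse
    by (intro power_rep_intros power_rep_diff)+
  have "power_rep e0" "power_rep e1" "power_rep e2" "power_rep e3"
    unfolding e0_def e1_def e2_def e3_def
    by (intro power_rep_intros power_rep_diff rep)+
  then obtain C0 C1 C2 C3 where C: "power_bounded 1 C0 e0" "power_bounded 1 C1 e1"
    "power_bounded 1 C2 e2" "power_bounded 1 C3 e3" by (auto simp: power_rep_def)
  define C where "C = max (max C0 C1) (max C2 C3)"
  have C': "power_bounded 1 C e0" "power_bounded 1 C e1" "power_bounded 1 C e2" "power_bounded 1 C e3"
    by (rule power_bounded_mono, rule C, simp add: C_def)+
  \<comment> \<open>A third of each margin, because \<open>h\<close>, \<open>k\<close> and
    \<open>t h k\<close> may each use up \<open>\<rho>\<close> without violating the inequalities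
    for the root.\<close>
  define \<rho> where "\<rho> = min (min m (a - m)) (min (b - m) c) / 3"
  have \<rho>: "0 < \<rho>" "3 * \<rho> \<le> m" "3 * \<rho> \<le> a - m" "3 * \<rho> \<le> b - m" "3 * \<rho> \<le> c"
    using m ab by (auto simp: \<rho>_def c_def)
  have "e0 0 0 = 0" "e1 0 0 = 0" using m(4) by (simp_all add: e0_def e1_def c0_def d_def)
  from power_series_cubic_root[OF zero_less_one C' this \<rho>(1)]
  obtain r t where r: "0 < r" and t: "power_bounded r \<rho> t"
    and fp: "\<And>h k. \<bar>h\<bar> \<le> r \<Longrightarrow> \<bar>k\<bar> \<le> r \<Longrightarrow>
       t h k = e0 h k + e1 h k * t h k + e2 h k * (t h k)\<^sup>2 + e3 h k * (t h k) ^ 3" by blast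
  define s where "s = min 1 (\<rho> / r)"
  have s: "0 < s" "s \<le> 1" "s * r \<le> \<rho>" "0 < s * r" "s * r \<le> r"
    using r \<rho>(1) by (auto simp: s_def min_def field_simps)
  have ts: "power_bounded (s * r) \<rho> t" by (rule power_bounded_shrink(1)[OF r t s(1,2)])
  have "power_bounded (s * r) (\<bar>1 - 2 * m\<bar> * (s * r) ^ (0 + 0) + \<bar>- 2\<bar> * (s * r) ^ (0 + 0) * \<rho>)
      (\<lambda>h k. (1 - 2 * m) * h ^ 0 * k ^ 0 + (- 2) * h ^ 0 * k ^ 0 * t h k)"
    by (intro power_bounded_add power_bounded_mult power_bounded_monom ts s(4))
  moreover have "eigval (transition_matrix (a + h, b + k, 1 - (a + h) - (b + k))) 1 = 1 - 2 * (m + t h k)"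
    if hk: "\<bar>h\<bar> < s * r" "\<bar>k\<bar> < s * r" for h k
  proof -
    have hk': "\<bar>h\<bar> \<le> \<rho>" "\<bar>k\<bar> \<le> \<rho>" "\<bar>h\<bar> \<le> r" "\<bar>k\<bar> \<le> r" using hk s by auto
    have tb: "\<bar>t h k\<bar> \<le> \<rho>" using hk' by (intro power_bounded_imp_bound[OF t]) auto
    have z: "c - h - k = 1 - (a + h) - (b + k)" by (simp add: c_def)
    have "d * t h k = d * (e0 h k + e1 h k * t h k + e2 h k * (t h k)\<^sup>2 + e3 h k * (t h k) ^ 3)"
      using fp[OF hk'(3,4)] by simp
    also have "\<dots> = (d * e0 h k) + (d * e1 h k) * t h k + (d * e2 h k) * (t h k)\<^sup>2 + (d * e3 h k) * (t h k) ^ 3"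
      by (simp add: distrib_left mult.assoc)
    also have "d * e0 h k = - c0 h k" using d0 by (simp add: e0_def)
    also have "d * e1 h k = - (c1 h k - d)" using d0 by (simp add: e1_def field_simps)
    also have "d * e2 h k = - c2 h k" using d0 by (simp add: e2_def)
    also have "d * e3 h k = 1" using d0 by (simp add: e3_def)
    finally have "char_poly3 (a + h) (b + k) (c - h - k) (m + t h k) = 0"
      unfolding expand by (simp add: algebra_simps)
    moreover have "- \<rho> \<le> h" "h \<le> \<rho>" "- \<rho> \<le> k" "k \<le> \<rho>" "- \<rho> \<le> t h k" "t h k \<le> \<rho>"
      using hk'(1,2) tb by (simp_all add: abs_le_iff)
    then have "0 < a + h" "0 < b + k" "0 < c - h - k" "0 < m + t h k" "m + t h k < a + h" "m + t h k < b + k"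
      using \<rho> m by linarith+
    moreover have "(a + h) + (b + k) + (c - h - k) = 1" by (simp add: c_def)
    ultimately have "perron (a + h) (b + k) (c - h - k) (m + t h k) ((c - h - k) / (2 * (a + h - (m + t h k))))
      (golden_ratio * (c - h - k) / (2 * (b + k - (m + t h k)))) 1"
      by (intro perron_of_root)
    from perron.eigval_eq[OF this] show ?thesis by (simp add: z)
  qed
  ultimately show "\<exists>r C g. 0 < r \<and> power_bounded r C g \<and> (\<forall>h k. \<bar>h\<bar> < r \<longrightarrow> \<bar>k\<bar> < r \<longrightarrow>
      (case (a + h, b + k) of (x, y) \<Rightarrow> eigval (transition_matrix (x, y, 1 - x - y)) 1) = g h k)"
    using s(4) by (intro exI[of _ "s * r"] exI conjI) (assumption | simp)+
qed

section \<open>Second moments of the vertex set\<close>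

lemma sum_pos_vertices: "(\<Sum>i\<in>UNIV. F (pos i)) = sum F solid_points"
proof -
  have "bij_betw pos UNIV solid_points"
    by (rule bij_betwI[where g = Abs_vertex]) (auto simp: pos_inverse)
  then show ?thesis by (rule sum.reindex_bij_betw)
qed

lemma sum_solid_points_reindex:
  assumes "\<And>v. v \<in> solid_points \<Longrightarrow> g v \<in> solid_points" "inj g"
  shows "sum (\<lambda>v. F (g v)) solid_points = sum F solid_points"
proof -
  have inj: "inj_on g solid_points" using assms(2) by (rule inj_on_subset) simp
  then have "g ` solid_points = solid_points"
    using assms(1) by (intro endo_inj_surj finite_solid_points) auto
  then show ?thesis using sum.reindex[OF inj, of F] by simp
qed

text \<open>Sign changes of coordinates kill the mixed moments and the cyclic permutation makes the
  three pure ones equal.\<close>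

lemma solid_points_second_moment:
  "\<exists>\<tau>>0. \<forall>u w. (\<Sum>i\<in>UNIV. (u \<bullet> pos i) * (w \<bullet> pos i)) = \<tau> * (u \<bullet> w)"
proof -
  define M where "M a b = (\<Sum>v\<in>solid_points. v $ a * v $ b)" for a b :: 3
  let ?g1 = "\<lambda>v :: real^3. vector [- v $ 1, v $ 2, v $ 3] :: real^3"
  let ?g2 = "\<lambda>v :: real^3. vector [v $ 1, - v $ 2, v $ 3] :: real^3"
  let ?g3 = "\<lambda>v :: real^3. vector [v $ 2, v $ 3, v $ 1] :: real^3"
  have inj: "inj ?g1" "inj ?g2" "inj ?g3"
    by (auto intro!: injI simp: vec_eq_3)
  note r1 = sum_solid_points_reindex[OF solid_points_sym(1) inj(1)]
  note r2 = sum_solid_points_reindex[OF solid_points_sym(2) inj(2)]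
  note r3 = sum_solid_points_reindex[OF solid_points_sym(3) inj(3)]
  have z: "M 1 2 = 0" "M 1 3 = 0" "M 2 3 = 0"
    using r1[of "\<lambda>v. v $ 1 * v $ 2"] r1[of "\<lambda>v. v $ 1 * v $ 3"] r2[of "\<lambda>v. v $ 2 * v $ 3"]
    by (simp_all add: M_def sum_negf)
  have e: "M 2 2 = M 1 1" "M 3 3 = M 1 1"
    using r3[of "\<lambda>v. v $ 1 * v $ 1"] r3[of "\<lambda>v. v $ 2 * v $ 2"] by (simp_all add: M_def)
  have sym: "M a b = M b a" for a b by (simp add: M_def mult.commute)
  have "(rho $ 1 * rho $ 1) \<le> M 1 1"
    unfolding M_def by (rule member_le_sum) (auto simp: rho_solid finite_solid_points)
  moreover have "0 < rho $ 1 * rho $ 1" using golden_ratio_props(3) by (simp add: rho_def)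
  ultimately have "0 < M 1 1" by linarith
  moreover have "(\<Sum>i\<in>UNIV. (u \<bullet> pos i) * (w \<bullet> pos i)) = M 1 1 * (u \<bullet> w)" for u w
  proof -
    have "(\<Sum>i\<in>UNIV. (u \<bullet> pos i) * (w \<bullet> pos i)) = (\<Sum>v\<in>solid_points. (u \<bullet> v) * (w \<bullet> v))"
      by (rule sum_pos_vertices)
    also have "\<dots> = (\<Sum>v\<in>solid_points. (\<Sum>a\<in>UNIV. \<Sum>b\<in>UNIV. u $ a * w $ b * (v $ a * v $ b)))"
      by (rule sum.cong) (simp_all add: inner_3 sum_3 algebra_simps)
    also have "\<dots> = (\<Sum>a\<in>UNIV. \<Sum>b\<in>UNIV. u $ a * w $ b * M a b)"
      by (simp add: M_def sum_distrib_left sum.swap[of _ _ solid_points])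
    also have "\<dots> = M 1 1 * (u \<bullet> w)"
      by (simp add: sum_3 z e sym[of 2 1] sym[of 3 1] sym[of 3 2] inner_3 algebra_simps)
    finally show ?thesis .
  qed
  ultimately show ?thesis by blast
qed

section \<open>The optimal transition matrix\<close>

definition coord :: "real^3 \<Rightarrow> real^vertex" where
  "coord u = (\<chi> i. u \<bullet> pos i)"

lemma coord_nth [simp]: "coord u $ i = u \<bullet> pos i" by (simp add: coord_def)

lemma linear_coord: "linear coord"
  by (rule linearI) (simp_all add: vec_eq_iff inner_add_left)

definition optimal_scale :: real where
  "optimal_scale = 1 / (14 + 5 * golden_ratio)"

abbreviation optimal_m :: real where
  "optimal_m \<equiv> optimal_scale * (2 - golden_ratio)"

definition optimal_weights :: "real \<times> real \<times> real" where
  "optimal_weights = (optimal_scale * 5, optimal_scale * (3 + 3 * golden_ratio),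
     optimal_scale * (6 + 2 * golden_ratio))"

interpretation optimal: perron "optimal_scale * 5" "optimal_scale * (3 + 3 * golden_ratio)"
  "optimal_scale * (6 + 2 * golden_ratio)" optimal_m 1 1 1
proof
  have s: "0 < optimal_scale" "optimal_scale * (14 + 5 * golden_ratio) = 1"
    using golden_ratio_props(3) by (simp_all add: optimal_scale_def)
  show "0 < optimal_scale * 5" "0 < optimal_scale * (3 + 3 * golden_ratio)"
    "0 < optimal_scale * (6 + 2 * golden_ratio)" "0 < optimal_m"
    using s(1) golden_ratio_props(3,4) by simp_all
  show "optimal_scale * 5 + optimal_scale * (3 + 3 * golden_ratio) + optimal_scale * (6 + 2 * golden_ratio) = 1"
    using s(2) by (simp add: algebra_simps)
qed (simp_all add: algebra_simps add_divide_distrib diff_divide_distrib golden_mult golden_ratio_props)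

definition optimal_eigval :: real where
  "optimal_eigval = (10 + 7 * golden_ratio) / (14 + 5 * golden_ratio)"

lemma optimal_eigval_eq: "1 - 2 * optimal_m = optimal_eigval"
  using golden_ratio_props(3) by (simp add: optimal_eigval_def optimal_scale_def field_simps)

abbreviation optimal_matrix :: "real^vertex^vertex" where
  "optimal_matrix \<equiv> transition_matrix optimal_weights"

lemma optimal_eigval_1: "eigval optimal_matrix 1 = optimal_eigval"
  using optimal.eigval_eq unfolding optimal_eigval_eq optimal_weights_def .

lemma optimal_\<xi>: "(golden_ratio - 1) *\<^sub>R optimal.\<xi> = rho"
proof (rule vec_eq_root_inner)
  show "simple_root k \<bullet> ((golden_ratio - 1) *\<^sub>R optimal.\<xi>) = simple_root k \<bullet> rho" for k
    by (cases k) (simp_all add: optimal.root_\<xi> rho_root)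
qed

lemma coord_eq_\<psi>: "coord u = (golden_ratio - 1) *\<^sub>R optimal.\<psi> u"
proof -
  have "coord u $ i = (golden_ratio - 1) * optimal.\<psi> u $ i" for i
    by (simp add: optimal.\<psi>_def frame(2)[symmetric] optimal_\<xi>[symmetric] linear_cmul[OF frame_linear]
        del: frame)
  then show ?thesis by (simp add: vec_eq_iff)
qed

lemma optimal_coord: "optimal_matrix *v coord u = optimal_eigval *\<^sub>R coord u"
  unfolding coord_eq_\<psi> matrix_vector_mult_scaleR optimal_weights_def optimal.P_\<psi> optimal_eigval_eq
  by simp

lemma coord_orth_one: "coord u \<bullet> 1 = 0"
  by (simp add: coord_eq_\<psi> optimal.\<psi>_orth_one)

lemma optimal_eigenspace: "eigenspace optimal_matrix optimal_eigval = range coord"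
proof -
  have c: "golden_ratio - 1 \<noteq> 0" using golden_ratio_props(3) by simp
  have "optimal.\<psi> u = coord ((1 / (golden_ratio - 1)) *\<^sub>R u)" for u
    using c by (simp add: coord_eq_\<psi> linear_cmul[OF optimal.linear_\<psi>])
  moreover have "coord u = optimal.\<psi> ((golden_ratio - 1) *\<^sub>R u)" for u
    by (simp add: coord_eq_\<psi> linear_cmul[OF optimal.linear_\<psi>])
  ultimately have "range optimal.\<psi> = range coord" by (metis (no_types, lifting) image_cong rangeI image_subset_iff subset_antisym)
  then show ?thesis
    using optimal.eigenspace_eq unfolding optimal_eigval_eq optimal_weights_def by simp
qed

lemma optimal_weights_int: "optimal_weights \<in> int_prob_simplex"
  using optimal.pos optimal.sum
  by (simp add: optimal_weights_def int_prob_simplex_def prob_simplex_def less_imp_le)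

lemma pos_inner_nbr: "pos i \<bullet> pos (nbr k i) = rho \<bullet> rho - 2 * (golden_ratio - 1)\<^sup>2"
proof -
  have "pos i \<bullet> pos (nbr k i) = frame i rho \<bullet> frame i (refl_by k rho)"
    by (simp add: pos_nbr frame(2))
  also have "\<dots> = rho \<bullet> refl_by k rho"
    using symmetries_orth[OF frame(1)] by (simp add: orthogonal_transformation_def)
  also have "\<dots> = rho \<bullet> rho - 2 * (golden_ratio - 1)\<^sup>2"
    by (simp add: refl_rho inner_diff_right inner_commute[of rho "simple_root k"] rho_root power2_eq_square)
  finally show ?thesis .
qed

text \<open>Summation over the coordinates produces inner products of vertex positions, which are
  the same for all edges.\<close>

lemma sum_coord_energy:
  "(\<Sum>a\<in>UNIV. coord (axis a 1) \<bullet> (P *v coord (axis a 1)))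
    = (\<Sum>i\<in>UNIV. \<Sum>j\<in>UNIV. P $ i $ j * (pos i \<bullet> pos j))"
proof -
  have "(\<Sum>a\<in>UNIV. coord (axis a 1) \<bullet> (P *v coord (axis a 1)))
     = (\<Sum>a\<in>UNIV. \<Sum>i\<in>UNIV. \<Sum>j\<in>UNIV. P $ i $ j * (pos i $ a * pos j $ a))"
    by (simp add: inner_vec_def[where 'b = vertex] matrix_vector_mult_def inner_axis' sum_distrib_left
        algebra_simps)
  also have "\<dots> = (\<Sum>i\<in>UNIV. \<Sum>a\<in>UNIV. \<Sum>j\<in>UNIV. P $ i $ j * (pos i $ a * pos j $ a))"
    by (rule sum.swap)
  also have "\<dots> = (\<Sum>i\<in>UNIV. \<Sum>j\<in>UNIV. \<Sum>a\<in>UNIV. P $ i $ j * (pos i $ a * pos j $ a))"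
    by (intro sum.cong refl sum.swap)
  also have "\<dots> = (\<Sum>i\<in>UNIV. \<Sum>j\<in>UNIV. P $ i $ j * (pos i \<bullet> pos j))"
    by (simp add: inner_vec_def sum_distrib_left)
  finally show ?thesis .
qed

lemma sum_coord_norm:
  "(\<Sum>a\<in>UNIV. coord (axis a 1) \<bullet> coord (axis a 1)) = real CARD(vertex) * (rho \<bullet> rho)"
proof -
  have "(\<Sum>a\<in>UNIV. coord (axis a 1) \<bullet> coord (axis a 1)) = (\<Sum>a\<in>UNIV. \<Sum>i\<in>UNIV. pos i $ a * pos i $ a)"
    by (simp add: inner_vec_def[where 'b = vertex] inner_axis')
  also have "\<dots> = (\<Sum>i\<in>UNIV. pos i \<bullet> pos i)"
    by (subst sum.swap) (simp add: inner_vec_def)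
  also have "\<dots> = real CARD(vertex) * (rho \<bullet> rho)" by (simp add: norm_solid_points)
  finally show ?thesis .
qed

lemma stochastic_sum_const:
  fixes P :: "real^'v::finite^'v"
  assumes "P \<in> sym_stochastic E"
  shows "(\<Sum>i\<in>UNIV. \<Sum>j\<in>UNIV. P $ i $ j * c) = real CARD('v) * c"
  using assms by (simp add: sym_stochastic_def flip: sum_distrib_right)

text \<open>Since \<open>pos\<close> is equilateral and \<open>pos i \<bullet> pos j\<close> is largest for \<open>i = j\<close>, the total energy of the
  coordinate functions is minimised by the matrices with vanishing diagonal.\<close>

lemma sum_coord_energy_ge:
  assumes P: "P \<in> sym_stochastic skeleton_edges"
  shows "optimal_eigval * (real CARD(vertex) * (rho \<bullet> rho))
    \<le> (\<Sum>a\<in>UNIV. coord (axis a 1) \<bullet> (P *v coord (axis a 1)))"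
proof -
  define c where "c = rho \<bullet> rho - 2 * (golden_ratio - 1)\<^sup>2"
  have "optimal_eigval * (real CARD(vertex) * (rho \<bullet> rho))
      = (\<Sum>a\<in>UNIV. coord (axis a 1) \<bullet> (optimal_matrix *v coord (axis a 1)))"
    by (simp add: optimal_coord sum_coord_norm flip: sum_distrib_left)
  also have "\<dots> = (\<Sum>i\<in>UNIV. \<Sum>j\<in>UNIV. optimal_matrix $ i $ j * c)"
    unfolding sum_coord_energy
  proof (intro sum.cong refl)
    fix i j
    show "optimal_matrix $ i $ j * (pos i \<bullet> pos j) = optimal_matrix $ i $ j * c"
    proof (cases "\<exists>k. j = nbr k i")
      case True
      then show ?thesis by (auto simp: pos_inner_nbr c_def)
    next
      case False
      then show ?thesis by (simp add: transition_matrix_nonedge)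
    qed
  qed
  also have "\<dots> = (\<Sum>i\<in>UNIV. \<Sum>j\<in>UNIV. P $ i $ j * c)"
    using stochastic_sum_const[OF P, of c]
      stochastic_sum_const[OF transition_matrix_stochastic[OF int_prob_simplexD(1)[OF optimal_weights_int]], of c]
    by simp
  also have "\<dots> \<le> (\<Sum>i\<in>UNIV. \<Sum>j\<in>UNIV. P $ i $ j * (pos i \<bullet> pos j))"
  proof (intro sum_mono)
    fix i j
    have P0: "0 \<le> P $ i $ j" using P by (simp add: sym_stochastic_def)
    consider "\<exists>k. j = nbr k i" | "j = i" | "j \<noteq> i" "\<nexists>k. j = nbr k i" by blast
    then show "P $ i $ j * c \<le> P $ i $ j * (pos i \<bullet> pos j)"
    proof cases
      case 1
      then show ?thesis by (auto simp: pos_inner_nbr c_def)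
    next
      case 2
      have "c \<le> pos i \<bullet> pos i" by (simp add: norm_solid_points c_def)
      then show ?thesis using 2 P0 by (auto intro: mult_left_mono)
    next
      case 3
      then have "P $ i $ j = 0" using P by (auto simp: sym_stochastic_def skeleton_edge_iff)
      then show ?thesis by simp
    qed
  qed
  also have "\<dots> = (\<Sum>a\<in>UNIV. coord (axis a 1) \<bullet> (P *v coord (axis a 1)))"
    by (rule sum_coord_energy[symmetric])
  finally show ?thesis .
qed

lemma rho_inner_pos: "0 < rho \<bullet> rho"
proof -
  have "rho \<noteq> 0" using rho_root[of Kx] golden_ratio_props(3) by auto
  then show ?thesis by simp
qed

text \<open>The coordinate functions are orthogonal to the constants, so each Rayleigh quotient
  bounds the second eigenvalue from below; summed, they reach \<open>optimal_eigval\<close>. If the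
  eigenvalues agree, no coordinate has slack and each is an eigenfunction.\<close>

lemma optimal_eigval_le:
  assumes P: "P \<in> sym_stochastic skeleton_edges"
  shows "optimal_eigval \<le> eigval P 1"
    and "eigval P 1 = optimal_eigval \<Longrightarrow> P *v coord u = optimal_eigval *\<^sub>R coord u"
proof -
  let ?f = "\<lambda>a. coord (axis a 1)" and ?N = "real CARD(vertex) * (rho \<bullet> rho)"
  have N: "0 < ?N" using rho_inner_pos by simp
  have R: "?f a \<bullet> (P *v ?f a) \<le> eigval P 1 * (?f a \<bullet> ?f a)" for a
    by (rule rayleigh_le_eigval_1[OF P coord_orth_one])
  have "optimal_eigval * ?N \<le> (\<Sum>a\<in>UNIV. ?f a \<bullet> (P *v ?f a))" by (rule sum_coord_energy_ge[OF P])
  also have "\<dots> \<le> (\<Sum>a\<in>UNIV. eigval P 1 * (?f a \<bullet> ?f a))" by (rule sum_mono) (rule R)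
  also have "\<dots> = eigval P 1 * ?N" by (simp add: sum_coord_norm flip: sum_distrib_left)
  finally show "optimal_eigval \<le> eigval P 1" using N by (rule mult_right_le_imp_le)
  assume eq: "eigval P 1 = optimal_eigval"
  have "(\<Sum>a\<in>UNIV. eigval P 1 * (?f a \<bullet> ?f a) - ?f a \<bullet> (P *v ?f a)) \<le> 0"
    using sum_coord_energy_ge[OF P] unfolding eq
    by (simp add: sum_subtractf sum_coord_norm flip: sum_distrib_left)
  moreover have "0 \<le> (\<Sum>a\<in>UNIV. eigval P 1 * (?f a \<bullet> ?f a) - ?f a \<bullet> (P *v ?f a))"
    using R by (intro sum_nonneg) simp
  ultimately have "(\<Sum>a\<in>UNIV. eigval P 1 * (?f a \<bullet> ?f a) - ?f a \<bullet> (P *v ?f a)) = 0" by linarith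
  then have "\<forall>a\<in>UNIV. eigval P 1 * (?f a \<bullet> ?f a) - ?f a \<bullet> (P *v ?f a) = 0"
    using R by (subst (asm) sum_nonneg_eq_0_iff) auto
  then have eig: "P *v ?f a = optimal_eigval *\<^sub>R ?f a" for a
    using rayleigh_le_eigval_1(2)[OF P coord_orth_one, of "axis a 1"] eq by simp
  have u: "coord u = (\<Sum>a\<in>UNIV. u $ a *\<^sub>R ?f a)"
    by (subst basis_expansion[of u, symmetric])
      (simp add: linear_sum[OF linear_coord] linear_cmul[OF linear_coord] scalar_mult_eq_scaleR)
  have "P *v coord u = (\<Sum>a\<in>UNIV. u $ a *\<^sub>R (P *v ?f a))"
    unfolding u by (simp add: linear_sum[OF matrix_vector_mul_linear] matrix_vector_mult_scaleR)
  also have "\<dots> = optimal_eigval *\<^sub>R coord u"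
    unfolding u eig by (simp add: scaleR_sum_right mult.commute)
  finally show "P *v coord u = optimal_eigval *\<^sub>R coord u" .
qed

text \<open>Minimality is tested against all symmetric stochastic matrices. Uniqueness in the
  simplex holds because a minimiser has the coordinate functions as eigenfunctions, and they
  determine its weights.\<close>

lemma eigval_minimiser:
  "{X \<in> prob_simplex. \<forall>P\<in>sym_stochastic skeleton_edges. eigval (transition_matrix X) 1 \<le> eigval P 1}
    = {optimal_weights}"
proof (intro equalityI subsetI)
  fix X
  assume X: "X \<in> {X \<in> prob_simplex. \<forall>P\<in>sym_stochastic skeleton_edges.
      eigval (transition_matrix X) 1 \<le> eigval P 1}"
  have S: "transition_matrix X \<in> sym_stochastic skeleton_edges"
    using X transition_matrix_stochastic by auto
  have "optimal_matrix \<in> sym_stochastic skeleton_edges"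
    using optimal_weights_int by (intro transition_matrix_stochastic int_prob_simplexD)
  then have "eigval (transition_matrix X) 1 \<le> optimal_eigval" using X optimal_eigval_1 by auto
  then have eq: "eigval (transition_matrix X) 1 = optimal_eigval"
    using optimal_eigval_le(1)[OF S] by simp
  have one: "(\<Sum>k\<in>UNIV. edge_weight X k) = 1"
    using X by (cases X) (simp add: sum_edge_weight prob_simplex_def)
  have c: "golden_ratio - 1 \<noteq> 0" using golden_ratio_props(3) by simp
  have "transition_matrix X *v optimal.\<psi> u = (1 - 2 * optimal_m) *\<^sub>R optimal.\<psi> u" for u
  proof -
    have "(golden_ratio - 1) *\<^sub>R (transition_matrix X *v optimal.\<psi> u)
        = (golden_ratio - 1) *\<^sub>R (optimal_eigval *\<^sub>R optimal.\<psi> u)"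
      using optimal_eigval_le(2)[OF S eq, of u]
      by (simp add: coord_eq_\<psi> matrix_vector_mult_scaleR mult.commute)
    then show ?thesis unfolding optimal_eigval_eq using c by (simp only: scaleR_cancel_left) simp
  qed
  note w = optimal.\<psi>_eigen_determines_weights[OF one this]
  have "edge_weight X k * optimal.height k = edge_weight optimal_weights k * optimal.height k" for k
    unfolding w using optimal.\<psi>_eigen_determines_weights[OF optimal.sum_weight optimal.P_\<psi>, of k]
    by (simp add: optimal_weights_def)
  then have "X = optimal_weights"
    using optimal.height_pos by (intro edge_weight_inject) (metis less_irrefl mult_right_cancel)
  then show "X \<in> {optimal_weights}" by simp
next
  fix X assume "X \<in> {optimal_weights}"
  then show "X \<in> {X \<in> prob_simplex. \<forall>P\<in>sym_stochastic skeleton_edges.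
      eigval (transition_matrix X) 1 \<le> eigval P 1}"
    using optimal_eigval_le(1) optimal_eigval_1 int_prob_simplexD(1)[OF optimal_weights_int] by simp
qed

lemma spectral_representation_exists:
  "\<exists>\<Phi> :: vertex \<Rightarrow> real^3. spectral_representation optimal_matrix optimal_eigval \<Phi>"
proof -
  obtain \<tau> where \<tau>: "0 < \<tau>" "\<And>u w. (\<Sum>i\<in>UNIV. (u \<bullet> pos i) * (w \<bullet> pos i)) = \<tau> * (u \<bullet> w)"
    using solid_points_second_moment by blast
  define s where "s = 1 / sqrt \<tau>"
  have s: "s * s * \<tau> = 1" "s \<noteq> 0" using \<tau>(1) by (simp_all add: s_def)
  define \<Phi> where "\<Phi> i = s *\<^sub>R pos i" for i
  have "(\<Sum>i\<in>UNIV. \<Phi> i $ a * \<Phi> i $ b) = (if a = b then 1 else 0)" for a b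
  proof -
    have "(\<Sum>i\<in>UNIV. \<Phi> i $ a * \<Phi> i $ b)
        = s * s * (\<Sum>i\<in>UNIV. (axis a 1 \<bullet> pos i) * (axis b 1 \<bullet> pos i))"
      by (simp add: \<Phi>_def inner_axis' sum_distrib_left mult.assoc mult.left_commute)
    also have "\<dots> = (if a = b then 1 else 0)"
      unfolding \<tau>(2) using s by (simp add: inner_axis_axis)
    finally show ?thesis .
  qed
  moreover have "span (range (\<lambda>a. \<chi> i. \<Phi> i $ a)) = range coord"
  proof -
    have "(\<lambda>a. \<chi> i. \<Phi> i $ a) = (\<lambda>a. coord (s *\<^sub>R axis a 1))"
      by (auto simp: vec_eq_iff \<Phi>_def inner_axis')
    then have "range (\<lambda>a. \<chi> i. \<Phi> i $ a) = coord ` range (\<lambda>a. s *\<^sub>R axis a 1)"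
      by (simp only: image_image)
    then have "span (range (\<lambda>a. \<chi> i. \<Phi> i $ a)) = coord ` span (range (\<lambda>a. s *\<^sub>R axis a 1))"
      by (simp add: linear_span_image[OF linear_coord])
    moreover have "u \<in> span (range (\<lambda>a. s *\<^sub>R axis a (1 :: real)))" for u :: "real^3"
    proof -
      have "u = (\<Sum>a\<in>UNIV. (u $ a / s) *\<^sub>R (s *\<^sub>R axis a 1))"
        by (subst basis_expansion[of u, symmetric]) (simp add: s scalar_mult_eq_scaleR)
      also have "\<dots> \<in> span (range (\<lambda>a. s *\<^sub>R axis a 1))"
        by (rule span_sum, rule span_scale, rule span_base, rule rangeI)
      finally show ?thesis .
    qed
    ultimately show ?thesis by auto
  qed
  ultimately have "spectral_representation optimal_matrix optimal_eigval \<Phi>"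
    by (simp add: spectral_representation_def optimal_eigenspace)
  then show ?thesis by blast
qed

text \<open>The components of any \<open>\<Phi>\<close> are coordinate functions in directions
  \<open>U a\<close>. Orthonormality together with the isotropic second moment makes the rescaled
  \<open>U a\<close> an orthonormal basis, so \<open>\<Phi>\<close> is the vertex position up to
  scaling and an orthogonal matrix.\<close>

lemma spectral_representation_similar:
  fixes \<Phi> :: "vertex \<Rightarrow> real^3"
  assumes "spectral_representation optimal_matrix optimal_eigval \<Phi>"
  obtains s where "0 < s" "\<And>i j. norm (\<Phi> i - \<Phi> j) = s * norm (pos i - pos j)"
    "\<And>i. norm (\<Phi> i) = s * norm (pos i)"
proof -
  obtain \<tau> where \<tau>: "0 < \<tau>" "\<And>u w. (\<Sum>i\<in>UNIV. (u \<bullet> pos i) * (w \<bullet> pos i)) = \<tau> * (u \<bullet> w)"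
    using solid_points_second_moment by blast
  have orth: "(\<Sum>i\<in>UNIV. \<Phi> i $ a * \<Phi> i $ b) = (if a = b then 1 else 0)" for a b
    using assms by (simp add: spectral_representation_def)
  have sp: "span (range (\<lambda>a. \<chi> i. \<Phi> i $ a)) = range coord"
    using assms by (simp add: spectral_representation_def optimal_eigenspace)
  have "\<exists>u. (\<chi> i. \<Phi> i $ a) = coord u" for a
  proof -
    have "(\<chi> i. \<Phi> i $ a) \<in> span (range (\<lambda>a. \<chi> i. \<Phi> i $ a))" by (rule span_base) simp
    then show ?thesis unfolding sp by auto
  qed
  then obtain U where U: "\<And>a. (\<chi> i. \<Phi> i $ a) = coord (U a)" by metis
  have \<Phi>: "\<Phi> i $ a = U a \<bullet> pos i" for i a
    using U[of a] by (metis coord_nth vec_lambda_beta)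
  define M where "M = (\<chi> a. sqrt \<tau> *\<^sub>R U a)"
  have "M ** transpose M = mat 1"
  proof -
    have "\<tau> * (U a \<bullet> U b) = (if a = b then 1 else 0)" for a b
      using orth[of a b] by (simp add: \<Phi> \<tau>(2))
    moreover have "(M ** transpose M) $ a $ b = \<tau> * (U a \<bullet> U b)" for a b
    proof -
      have sq: "sqrt \<tau> * (sqrt \<tau> * y) = \<tau> * y" for y using \<tau>(1) by (simp add: mult.assoc[symmetric])
      show ?thesis
        by (simp add: sq M_def matrix_matrix_mult_def transpose_def inner_vec_def sum_distrib_left
            mult.assoc mult.left_commute)
    qed
    ultimately show ?thesis by (simp add: vec_eq_iff mat_def)
  qed
  then have "orthogonal_matrix M"
    by (simp add: orthogonal_matrix_def matrix_left_right_inverse)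
  then have "orthogonal_transformation ((*v) M)"
    by (simp add: orthogonal_transformation_matrix matrix_vector_mul_linear)
  then have M: "norm (M *v v) = norm v" for v
    by (rule orthogonal_transformation_norm)
  have eq: "\<Phi> i = (1 / sqrt \<tau>) *\<^sub>R (M *v pos i)" for i
    using \<tau>(1) by (simp add: vec_eq_iff \<Phi> M_def matrix_vector_mult_def inner_vec_def sum_distrib_left
        mult.assoc)
  show ?thesis
  proof (rule that[of "1 / sqrt \<tau>"])
    show "0 < 1 / sqrt \<tau>" using \<tau>(1) by simp
    show "norm (\<Phi> i - \<Phi> j) = 1 / sqrt \<tau> * norm (pos i - pos j)" for i j
    proof -
      have "\<Phi> i - \<Phi> j = (1 / sqrt \<tau>) *\<^sub>R (M *v (pos i - pos j))"
        by (simp add: eq matrix_vector_mult_diff_distrib scaleR_diff_right)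
      then show ?thesis using \<tau>(1) by (simp add: M)
    qed
    show "norm (\<Phi> i) = 1 / sqrt \<tau> * norm (pos i)" for i
      using \<tau>(1) by (simp add: eq M)
  qed
qed

lemma norm_pos: "norm (pos i) = norm rho"
  by (simp add: norm_eq_sqrt_inner norm_solid_points)

lemma norm_pos_nbr: "norm (pos i - pos (nbr k i)) = norm (pos j - pos (nbr l j))"
proof -
  have "norm (pos i - pos (nbr k i)) = sqrt (4 * (golden_ratio - 1)\<^sup>2)" for i k
    by (simp add: norm_eq_sqrt_inner inner_diff_left inner_diff_right norm_solid_points pos_inner_nbr
        inner_commute[of "pos (nbr k i)" "pos i"])
  then show ?thesis by simp
qed

theorem theorem1p12:
  fixes p :: real and X0 :: "real \<times> real \<times> real" and lambda1 :: "real^vertex^vertex \<Rightarrow> real"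
  assumes p: "p = golden_ratio"
    and X0: "X0 = (1 / (14 + 5 * p)) *\<^sub>R (5, 3 + 3 * p, 6 + 2 * p)"
    and lambda1: "lambda1 = (\<lambda>P. eigval P 1)"
  shows
    "bij_betw transition_matrix prob_simplex (invariant_transitions skeleton_edges)
     \<and> analytic_on_int_simplex (\<lambda>X. lambda1 (transition_matrix X))
     \<and> strictly_convex_on int_prob_simplex (\<lambda>X. lambda1 (transition_matrix X))
     \<and> (\<forall>X\<in>int_prob_simplex.
          multiplicity_of (transition_matrix X) (lambda1 (transition_matrix X)) = 3)
     \<and> {X \<in> prob_simplex. \<forall>P\<in>sym_stochastic skeleton_edges.
          lambda1 (transition_matrix X) \<le> lambda1 P} = {X0}
     \<and> lambda1 (transition_matrix X0) = (10 + 7 * p) / (14 + 5 * p)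
     \<and> (\<exists>\<Phi> :: vertex \<Rightarrow> real^3.
          spectral_representation (transition_matrix X0) (lambda1 (transition_matrix X0)) \<Phi>)
     \<and> (\<forall>\<Phi> :: vertex \<Rightarrow> real^3.
          spectral_representation (transition_matrix X0) (lambda1 (transition_matrix X0)) \<Phi> \<longrightarrow>
            (\<exists>r>0. range \<Phi> \<subseteq> sphere 0 r) \<and> inj \<Phi> \<and> equilateral skeleton_edges \<Phi>)"
proof -
  have X0': "X0 = optimal_weights"
    unfolding X0 p by (simp add: optimal_weights_def optimal_scale_def)
  have "multiplicity_of (transition_matrix X) (eigval (transition_matrix X) 1) = 3"
    if X: "X \<in> int_prob_simplex" for X
  proof -
    obtain x y z m kx ky kz where eq: "X = (x, y, z)" and per: "perron x y z m kx ky kz"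
      using X by (rule perron_exists)
    show ?thesis unfolding eq perron.eigval_eq[OF per] by (rule perron.multiplicity_eq[OF per])
  qed
  moreover have "(\<exists>r>0. range \<Phi> \<subseteq> sphere 0 r) \<and> inj \<Phi> \<and> equilateral skeleton_edges \<Phi>"
    if sr: "spectral_representation optimal_matrix optimal_eigval \<Phi>" for \<Phi> :: "vertex \<Rightarrow> real^3"
  proof -
    obtain s where s: "0 < s" "\<And>i j. norm (\<Phi> i - \<Phi> j) = s * norm (pos i - pos j)"
      "\<And>i. norm (\<Phi> i) = s * norm (pos i)"
      using spectral_representation_similar[OF sr] by metis
    have "0 < s * norm rho" using s(1) rho_inner_pos by simp
    moreover have "range \<Phi> \<subseteq> sphere 0 (s * norm rho)" by (auto simp: s(3) norm_pos)
    moreover have "inj \<Phi>"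
    proof (rule injI)
      fix i j assume "\<Phi> i = \<Phi> j"
      then have "s * norm (pos i - pos j) = 0" using s(2)[of i j] by simp
      then show "i = j" using s(1) by (simp add: pos_inject)
    qed
    moreover have "equilateral skeleton_edges \<Phi>"
    proof -
      define i0 where "i0 = (undefined :: vertex)"
      have "norm (\<Phi> i - \<Phi> j) = s * norm (pos i0 - pos (nbr Kx i0))" if "{i, j} \<in> skeleton_edges" for i j
        using that norm_pos_nbr[of i _ i0 Kx] by (auto simp: skeleton_edge_iff s(2))
      then show ?thesis unfolding equilateral_def by blast
    qed
    ultimately show ?thesis by blast
  qed
  ultimately show ?thesis
    unfolding lambda1 X0' p optimal_eigval_1
    using transition_matrix_bij eigval_analytic eigval_strictly_convex eigval_minimiser
      spectral_representation_exists optimal_eigval_def by simp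
qed

end
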